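(* Assume: (1) for every $n\in\mathbb{N}$ there is $c_n>0$ with $\xi' A(x)\xi\ge c_n|\xi|^2$ for all $x\in E_n$, $\xi\in\mathbb{R}^d$, and there are constants $\overline{\kappa}\ge\underline{\kappa}>0$ with $\underline{\kappa}A(x)\le \overline{A}(x)\le\overline{\kappa}A(x)$ for all $x\in E$; (2) $\phi_0\in C^3(E)$ is non-negative and $\lim_{n\uparrow\infty}\sup_{x\in E\setminus E_n}\mathfrak{F}[\phi_0](x)=-\infty$; (3) the martingale problem for $\mathcal{L}^{\phi_0}$ on $E$ is well-posed; (4) $\lim_{n\uparrow\infty}\inf_{x\in E\setminus E_n}\phi_0(x)=\infty$, and there is $\delta>1$ with $\lim_{n\uparrow\infty}\sup_{x\in E\setminus E_n}\mathfrak{F}[\delta\phi_0](x)=-\infty$; (5) there are $\psi_0\in C^3(E)$ and $\alpha,K>0$ such that $\lim_{n\uparrow\infty}\inf_{x\in E\setminus E_n}\mathfrak{F}[\psi_0](x)=\infty$, $\lim_{n\uparrow\infty}\inf_{x\in E\setminus E_n}(\phi_0-\psi_0)(x)=\infty$, $\inf_{x\in E}(\psi_0+K\phi_0)(x)>-\infty$ and, with the same $\delta$ as in (4), $\sup_{x\in E}\big(\mathfrak{F}[\delta\phi_0]+\alpha(\delta\phi_0-\psi_0)\big)(x)<\infty$. Let $v_0\in C(E)$ satisfy $\sup_{x\in E}(|v_0|-\phi_0)(x)<\infty$, let $v$ be the unique classical solution of $\partial_t v=\mathfrak{F}[v]$ on $(0,\infty)\times E$, $v(0,\cdot)=v_0$,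 satisfying $\sup_{[0,T]\times E}(v(t,x)-\phi_0(x))<\infty$ for each $T\ge 0$, and let $h(t,x)=v(t,x)-\hat{\lambda}t-\hat{v}(x)$. Then: (i) $\lim_{t\to\infty}h(t,\cdot)=C$ in $C(E)$ for some constant $C$; (ii) $\lim_{t\to\infty}\nabla h(t,\cdot)=0$ in $C(E)$.
   Context: Convergence in $C(E)$ means locally uniform convergence on $E$; $'$ denotes transpose; inequalities between symmetric matrices are in the sense of positive semi-definiteness. Domain: $E\subseteq\mathbb{R}^d$ is open and connected, star shaped with respect to some $x_0\in E$ (the segment from $x_0$ to any $x\in E$ lies in $E$), and $(E_n)_{n\in\mathbb{N}}$ is a sequence of open, bounded, connected domains, each star shaped with respect to $x_0$ and with $C^{2,\gamma}$ boundary for some $\gamma\in(0,1]$, such that $\overline{E_n}\subset E_{n+1}$ and $E=\bigcup_nE_n$. Coefficients: $A=(A_{ij})$ and $\overline{A}=(\overline{A}_{ij})$ belong to $C^{2,\gamma}(E,\mathbb{S}^d)$, $B=(B_i)\in C^{1,\gamma}(E,\mathbb{R}^d)$, $V\in C^{1,\gamma}(E)$ for some $\gamma\in(0,1]$, where $\mathbb{S}^d$ is the space of real symmetric $d\times d$ matrices and $C^{k,\gamma}$ denotes $k$ times differentiable functions whose $k$-th derivatives are locally H\"older continuous with exponent $\gamma$. Operators: $\mathfrak{F}[\phi]=\frac12\sum_{i,j}A_{ij}D_{ij}\phi+\frac12\sum_{i,j}\overline{A}_{ij}D_i\phi D_j\phi+\sum_iB_iD_i\phi+V$, and $\mathcal{L}^{\phi}=\frac12\sum_{i,j}A_{ij}D_{ij}+\sum_i\big(B_i+\sum_j\overline{A}_{ij}D_j\phi\big)D_i$.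 A classical solution of the Cauchy problem $\partial_tv=\mathfrak{F}[v]$, $v(0,\cdot)=v_0$ is a function $v\in C^{1,2}((0,\infty)\times E)\cap C([0,\infty)\times E)$ satisfying it. Probability: $X$ is the coordinate process on the space of continuous paths in $E$ (possibly exploding, i.e. leaving every $E_n$ in finite time). $(\mathbb{P}^{\phi,x})_{x\in E}$ denotes the unique solution to the generalized martingale problem on $E$ for $\mathcal{L}^\phi$ (under $\mathbb{P}^{\phi,x}$, $X$ is the diffusion with generator $\mathcal{L}^\phi$ started at $x$, up to its explosion time). The martingale problem for $\mathcal{L}^\phi$ is well-posed if $X$ does not explode $\mathbb{P}^{\phi,x}$-a.s. for any $x\in E$. Ergodic pair (known, taken as given): under hypotheses (1) and (2), there is a unique $\hat{\lambda}\in\mathbb{R}$ for which there exists a (unique up to an additive constant) $\hat{v}\in C^2(E)$ with $\mathfrak{F}[\hat{v}]=\hat{\lambda}$ on $E$ such that $(\mathbb{P}^{\hat{v},x})_{x\in E}$ is ergodic (positive recurrent) with an invariant probability density $\hat{m}$. $(\hat{v},\hat{\lambda})$ denotes this pair. *)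

theory Defs
  imports "HOL-Probability.Probability"
begin

section \<open>Smoothness classes\<close>

definition partial :: "'d \<Rightarrow> (real ^ 'd \<Rightarrow> real) \<Rightarrow> real ^ 'd \<Rightarrow> real" where
  "partial i f x = frechet_derivative f (at x) (axis i 1)"

definition grad :: "(real ^ 'd \<Rightarrow> real) \<Rightarrow> real ^ 'd \<Rightarrow> real ^ 'd" where
  "grad f x = (\<chi> i. partial i f x)"

text \<open>The class \<open>C\<^sup>k(U)\<close>, for open \<open>U\<close>. As everywhere below, values of \<open>f\<close> outside \<open>U\<close> are
  irrelevant.\<close>

primrec Ck_on :: "nat \<Rightarrow> (real ^ 'd) set \<Rightarrow> (real ^ 'd \<Rightarrow> real) \<Rightarrow> bool" where
  "Ck_on 0 U f \<longleftrightarrow> continuous_on U f"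
| "Ck_on (Suc k) U f \<longleftrightarrow> f differentiable_on U \<and> (\<forall>i. Ck_on k U (partial i f))"

definition locally_holder_on :: "real \<Rightarrow> (real ^ 'd) set \<Rightarrow> (real ^ 'd \<Rightarrow> real) \<Rightarrow> bool" where
  "locally_holder_on \<gamma> U f \<longleftrightarrow>
     (\<forall>K. compact K \<and> K \<subseteq> U \<longrightarrow>
        (\<exists>M. \<forall>x\<in>K. \<forall>y\<in>K. \<bar>f x - f y\<bar> \<le> M * norm (x - y) powr \<gamma>))"

text \<open>The class \<open>C\<^bsup>k,\<gamma>\<^esup>(U)\<close>, for open \<open>U\<close>: the Hoelder condition is a local one.\<close>

primrec Ck_holder_on :: "nat \<Rightarrow> real \<Rightarrow> (real ^ 'd) set \<Rightarrow> (real ^ 'd \<Rightarrow> real) \<Rightarrow> bool" where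
  "Ck_holder_on 0 \<gamma> U f \<longleftrightarrow> locally_holder_on \<gamma> U f"
| "Ck_holder_on (Suc k) \<gamma> U f \<longleftrightarrow>
     f differentiable_on U \<and> (\<forall>i. Ck_holder_on k \<gamma> U (partial i f))"

text \<open>Boundaries of class \<open>C\<^bsup>k,\<gamma>\<^esup>\<close> in the sense of Gilbarg and Trudinger (Section 6.2): near each
  boundary point a \<open>C\<^bsup>k,\<gamma>\<^esup>\<close> diffeomorphism straightens the boundary. Which coordinate defines the
  half-space does not matter, hence the existential over \<open>i\<close>.\<close>

definition Ck_holder_boundary :: "nat \<Rightarrow> real \<Rightarrow> (real ^ 'd) set \<Rightarrow> bool" where
  "Ck_holder_boundary k \<gamma> U \<longleftrightarrow>
     (\<forall>p\<in>frontier U. \<exists>r>0. \<exists>(D :: (real ^ 'd) set) \<psi> \<psi>' i.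
        open D \<and> homeomorphism (ball p r) D \<psi> \<psi>' \<and>
        (\<forall>j. Ck_holder_on k \<gamma> (ball p r) (\<lambda>x. \<psi> x $ j)) \<and>
        (\<forall>j. Ck_holder_on k \<gamma> D (\<lambda>y. \<psi>' y $ j)) \<and>
        \<psi> ` (ball p r \<inter> U) \<subseteq> {y. y $ i > 0} \<and>
        \<psi> ` (ball p r \<inter> frontier U) \<subseteq> {y. y $ i = 0})"

definition star_shaped_at :: "'a::real_vector \<Rightarrow> 'a set \<Rightarrow> bool" where
  "star_shaped_at x0 S \<longleftrightarrow> x0 \<in> S \<and> (\<forall>x\<in>S. closed_segment x0 x \<subseteq> S)"

definition psd_le :: "real ^ 'd ^ 'd \<Rightarrow> real ^ 'd ^ 'd \<Rightarrow> bool" where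
  "psd_le M N \<longleftrightarrow> (\<forall>\<xi>. 0 \<le> \<xi> \<bullet> ((N - M) *v \<xi>))"

text \<open>Convergence in \<open>C(U)\<close> as \<open>t \<rightarrow> \<infinity>\<close>.\<close>

definition tends_locally_uniformly ::
    "'a::topological_space set \<Rightarrow> (real \<Rightarrow> 'a \<Rightarrow> 'b::metric_space) \<Rightarrow> ('a \<Rightarrow> 'b) \<Rightarrow> bool" where
  "tends_locally_uniformly U f g \<longleftrightarrow>
     (\<forall>K. compact K \<and> K \<subseteq> U \<longrightarrow> uniform_limit K f g at_top)"


section \<open>Operators and the Cauchy problem\<close>

definition second_order_op ::
    "(real ^ 'd \<Rightarrow> real ^ 'd ^ 'd) \<Rightarrow> (real ^ 'd \<Rightarrow> real ^ 'd) \<Rightarrow>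
     (real ^ 'd \<Rightarrow> real) \<Rightarrow> real ^ 'd \<Rightarrow> real" where
  "second_order_op a b f x =
     1 / 2 * (\<Sum>i\<in>UNIV. \<Sum>j\<in>UNIV. a x $ i $ j * partial i (partial j f) x)
     + (\<Sum>i\<in>UNIV. b x $ i * partial i f x)"

text \<open>The operator \<open>\<FF>\<close>.\<close>

definition Fop ::
    "(real ^ 'd \<Rightarrow> real ^ 'd ^ 'd) \<Rightarrow> (real ^ 'd \<Rightarrow> real ^ 'd ^ 'd) \<Rightarrow>
     (real ^ 'd \<Rightarrow> real ^ 'd) \<Rightarrow> (real ^ 'd \<Rightarrow> real) \<Rightarrow>
     (real ^ 'd \<Rightarrow> real) \<Rightarrow> real ^ 'd \<Rightarrow> real" where
  "Fop A Abar B V \<phi> x =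
     1 / 2 * (\<Sum>i\<in>UNIV. \<Sum>j\<in>UNIV. A x $ i $ j * partial i (partial j \<phi>) x)
     + 1 / 2 * (\<Sum>i\<in>UNIV. \<Sum>j\<in>UNIV. Abar x $ i $ j * partial i \<phi> x * partial j \<phi> x)
     + (\<Sum>i\<in>UNIV. B x $ i * partial i \<phi> x) + V x"

text \<open>\<open>\<L>\<^sup>\<phi>\<close> is \<open>second_order_op A (drift Abar B \<phi>)\<close>.\<close>

definition drift ::
    "(real ^ 'd \<Rightarrow> real ^ 'd ^ 'd) \<Rightarrow> (real ^ 'd \<Rightarrow> real ^ 'd) \<Rightarrow>
     (real ^ 'd \<Rightarrow> real) \<Rightarrow> real ^ 'd \<Rightarrow> real ^ 'd" where
  "drift Abar B \<phi> x = (\<chi> i. B x $ i + (\<Sum>j\<in>UNIV. Abar x $ i $ j * partial j \<phi> x))"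

text \<open>The class \<open>C\<^bsup>1,2\<^esup>((0,\<infinity>) \<times> U)\<close>.\<close>

definition C12_on :: "(real ^ 'd) set \<Rightarrow> (real \<Rightarrow> real ^ 'd \<Rightarrow> real) \<Rightarrow> bool" where
  "C12_on U v \<longleftrightarrow>
     (\<forall>t>0. \<forall>x\<in>U. (\<lambda>s. v s x) differentiable (at t)) \<and>
     (\<forall>t>0. Ck_on 2 U (v t)) \<and>
     continuous_on ({0<..} \<times> U) (\<lambda>(t, x). v t x) \<and>
     continuous_on ({0<..} \<times> U) (\<lambda>(t, x). deriv (\<lambda>s. v s x) t) \<and>
     (\<forall>i. continuous_on ({0<..} \<times> U) (\<lambda>(t, x). partial i (v t) x)) \<and>
     (\<forall>i j. continuous_on ({0<..} \<times> U) (\<lambda>(t, x). partial i (partial j (v t)) x))"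

definition classical_solution ::
    "(real ^ 'd) set \<Rightarrow> ((real ^ 'd \<Rightarrow> real) \<Rightarrow> real ^ 'd \<Rightarrow> real) \<Rightarrow> (real ^ 'd \<Rightarrow> real) \<Rightarrow>
     (real \<Rightarrow> real ^ 'd \<Rightarrow> real) \<Rightarrow> bool" where
  "classical_solution U F v0 v \<longleftrightarrow>
     C12_on U v \<and> continuous_on ({0..} \<times> U) (\<lambda>(t, x). v t x) \<and>
     (\<forall>t>0. \<forall>x\<in>U. deriv (\<lambda>s. v s x) t = F (v t) x) \<and>
     (\<forall>x\<in>U. v 0 x = v0 x)"


section \<open>The generalized martingale problem\<close>

text \<open>A possibly exploding path is a continuous path in the one-point compactification of \<open>E\<close>, whose
  cemetery point \<open>None\<close> is absorbing. Time is \<open>[0,\<infinity>)\<close>; the condition on \<open>extensional\<close> only pins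
  down the irrelevant values at negative times.\<close>

type_synonym 'd path = "real \<Rightarrow> (real ^ 'd) option"

definition path_space :: "(real ^ 'd) set \<Rightarrow> 'd path set" where
  "path_space E =
     {\<omega> \<in> extensional {0..}.
        continuous_map (top_of_set {0..}) (Alexandroff_compactification (top_of_set E)) \<omega> \<and>
        (\<forall>s t. 0 \<le> s \<and> s \<le> t \<and> \<omega> s = None \<longrightarrow> \<omega> t = None)}"

text \<open>The \<open>\<sigma>\<close>-algebra on paths generated by the coordinates at times in \<open>T\<close>; the canonical filtration
  is \<open>coord_algebra E {0..t}\<close>.\<close>

definition coord_algebra :: "(real ^ 'd) set \<Rightarrow> real set \<Rightarrow> 'd path measure" where
  "coord_algebra E T =
     sigma (path_space E) {{\<omega> \<in> path_space E. \<omega> t \<in> Some ` S} |t S. t \<in> T \<and> S \<in> sets borel}"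

definition hitting_time :: "(real ^ 'd) option set \<Rightarrow> 'd path \<Rightarrow> ennreal" where
  "hitting_time S \<omega> = Inf {ennreal t |t. 0 \<le> t \<and> \<omega> t \<in> S}"

text \<open>The time \<open>t\<close> truncated at the first exit from \<open>U\<close>.\<close>

definition exit_cap :: "(real ^ 'd) set \<Rightarrow> real \<Rightarrow> 'd path \<Rightarrow> real" where
  "exit_cap U t \<omega> = enn2real (min (ennreal t) (hitting_time (- (Some ` U)) \<omega>))"

definition is_martingale ::
    "'a measure \<Rightarrow> (real \<Rightarrow> 'a measure) \<Rightarrow> (real \<Rightarrow> 'a \<Rightarrow> real) \<Rightarrow> bool" where
  "is_martingale M F Y \<longleftrightarrow>
     (\<forall>t\<ge>0. Y t \<in> borel_measurable (F t) \<and> integrable M (Y t)) \<and>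
     (\<forall>s t. 0 \<le> s \<and> s \<le> t \<longrightarrow> (AE \<omega> in M. real_cond_exp M (F s) (Y t) \<omega> = Y s \<omega>))"

text \<open>The generalized martingale problem on \<open>E = (\<Union>n. En n)\<close> for \<open>second_order_op a b\<close>, started at
  \<open>x\<close> (Pinsky, Positive Harmonic Functions and Diffusion, Section 1.13). In the integral the path
  lies in \<open>En n\<close> except possibly at the right end point, so \<open>the\<close> is harmless there; the paths
  started at \<open>None\<close> are null.\<close>

definition solves_gmp_at ::
    "(real ^ 'd) set \<Rightarrow> (nat \<Rightarrow> (real ^ 'd) set) \<Rightarrow>
     (real ^ 'd \<Rightarrow> real ^ 'd ^ 'd) \<Rightarrow> (real ^ 'd \<Rightarrow> real ^ 'd) \<Rightarrow>
     real ^ 'd \<Rightarrow> 'd path measure \<Rightarrow> bool" where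
  "solves_gmp_at E En a b x P \<longleftrightarrow>
     prob_space P \<and> sets P = sets (coord_algebra E {0..}) \<and>
     (AE \<omega> in P. \<omega> 0 = Some x) \<and>
     (\<forall>n f. Ck_on 2 E f \<longrightarrow>
        is_martingale P (\<lambda>t. coord_algebra E {0..t})
          (\<lambda>t \<omega>. f (the (\<omega> (exit_cap (En n) t \<omega>)))
             - (LINT s:{0..exit_cap (En n) t \<omega>}|lborel. second_order_op a b f (the (\<omega> s)))))"

text \<open>\<open>P\<close> is the unique solution: it solves the problem from every starting point, and no other law
  does.\<close>

definition gmp_unique_solution ::
    "(real ^ 'd) set \<Rightarrow> (nat \<Rightarrow> (real ^ 'd) set) \<Rightarrow>
     (real ^ 'd \<Rightarrow> real ^ 'd ^ 'd) \<Rightarrow> (real ^ 'd \<Rightarrow> real ^ 'd) \<Rightarrow>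
     (real ^ 'd \<Rightarrow> 'd path measure) \<Rightarrow> bool" where
  "gmp_unique_solution E En a b P \<longleftrightarrow>
     (\<forall>x\<in>E. solves_gmp_at E En a b x (P x) \<and> (\<forall>Q. solves_gmp_at E En a b x Q \<longrightarrow> Q = P x))"

text \<open>Since \<open>None\<close> is absorbing and the \<open>En n\<close> are relatively compact in \<open>E\<close> and exhaust it, a path
  leaves every \<open>En n\<close> before some finite time iff it reaches \<open>None\<close>.\<close>

definition non_explosive :: "(real ^ 'd) set \<Rightarrow> (real ^ 'd \<Rightarrow> 'd path measure) \<Rightarrow> bool" where
  "non_explosive E P \<longleftrightarrow> (\<forall>x\<in>E. AE \<omega> in P x. \<forall>t\<ge>0. \<omega> t \<noteq> None)"

definition recurrent_diffusion :: "(real ^ 'd) set \<Rightarrow> (real ^ 'd \<Rightarrow> 'd path measure) \<Rightarrow> bool" where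
  "recurrent_diffusion E P \<longleftrightarrow>
     (\<forall>x\<in>E. \<forall>y\<in>E. \<forall>\<epsilon>>0. AE \<omega> in P x. hitting_time (Some ` ball y \<epsilon>) \<omega> < \<infinity>)"

definition positive_recurrent :: "(real ^ 'd) set \<Rightarrow> (real ^ 'd \<Rightarrow> 'd path measure) \<Rightarrow> bool" where
  "positive_recurrent E P \<longleftrightarrow> recurrent_diffusion E P \<and>
     (\<forall>x\<in>E. \<forall>y\<in>E. \<forall>\<epsilon>>0. (\<integral>\<^sup>+\<omega>. hitting_time (Some ` ball y \<epsilon>) \<omega> \<partial>P x) < \<infinity>)"

definition invariant_density ::
    "(real ^ 'd) set \<Rightarrow> (real ^ 'd \<Rightarrow> 'd path measure) \<Rightarrow> (real ^ 'd \<Rightarrow> real) \<Rightarrow> bool" where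
  "invariant_density E P m \<longleftrightarrow>
     set_borel_measurable lborel E m \<and> (\<forall>x\<in>E. 0 \<le> m x) \<and>
     (\<integral>\<^sup>+x\<in>E. ennreal (m x) \<partial>lborel) = 1 \<and>
     (\<forall>t\<ge>0. \<forall>S\<in>sets borel. S \<subseteq> E \<longrightarrow>
        (\<integral>\<^sup>+x\<in>E. ennreal (m x) * emeasure (P x) {\<omega> \<in> space (P x). \<omega> t \<in> Some ` S} \<partial>lborel)
        = (\<integral>\<^sup>+x\<in>S. ennreal (m x) \<partial>lborel))"

definition well_posed ::
    "(real ^ 'd) set \<Rightarrow> (nat \<Rightarrow> (real ^ 'd) set) \<Rightarrow>
     (real ^ 'd \<Rightarrow> real ^ 'd ^ 'd) \<Rightarrow> (real ^ 'd \<Rightarrow> real ^ 'd) \<Rightarrow> bool" where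
  "well_posed E En a b \<longleftrightarrow> (\<exists>P. gmp_unique_solution E En a b P \<and> non_explosive E P)"

definition ergodic_with_density ::
    "(real ^ 'd) set \<Rightarrow> (nat \<Rightarrow> (real ^ 'd) set) \<Rightarrow>
     (real ^ 'd \<Rightarrow> real ^ 'd ^ 'd) \<Rightarrow> (real ^ 'd \<Rightarrow> real ^ 'd) \<Rightarrow> (real ^ 'd \<Rightarrow> real) \<Rightarrow> bool" where
  "ergodic_with_density E En a b m \<longleftrightarrow>
     (\<exists>P. gmp_unique_solution E En a b P \<and> positive_recurrent E P \<and> invariant_density E P m)"

end

theory Submission
  imports Defs
begin

text \<open>Write \<open>|p|\<^sup>2\<close> for the quadratic form of \<open>Abar\<close> (called \<open>quad (Abar x) p\<close> below). The difference \<open>h\<close>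
  solves \<open>\<partial>\<^sub>t h = \<L> h + |\<nabla>h|\<^sup>2 / 2\<close>, where \<open>\<L>\<close> is the operator with drift
  \<open>drift Abar B vhat\<close>.

  Recurrence enters once, to show that \<open>\<phi>0 - vhat\<close> is bounded below: otherwise a truncation of
  \<open>exp (\<kappa>l (\<phi>0 - vhat))\<close> is a bounded nonconstant superharmonic function. The function \<open>\<psi>0 - vhat\<close>
  is then bounded above by comparison, so that \<open>w = \<delta> \<phi>0 - vhat\<close> satisfies
  \<open>\<L> w + |\<nabla>w|\<^sup>2 / 2 \<le> C - \<alpha> w\<close>. Hence \<open>exp (- \<alpha> t) w\<close> plus constants is a barrier for \<open>h\<close> from both
  sides, and the asymptotic upper and lower bounds of \<open>h\<close> no longer depend on \<open>x\<close>.

  If the optimal asymptotic bounds were different, then at some late time \<open>h\<close> would stay away from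
  one of them on a ball around \<open>x0\<close> whose radius does not depend on the time (interior Lipschitz
  estimate). This gap spreads to a large sublevel set of \<open>w\<close> (positivity propagates along the
  segments from \<open>x0\<close>), and from there to all of \<open>E\<close> by the barrier, contradicting optimality. The
  Lipschitz estimate is linear in the oscillation of \<open>h\<close>, which also gives \<open>\<nabla>h \<rightarrow> 0\<close>.\<close>

section \<open>Second-order jets and quadratic forms\<close>

text \<open>\<open>Abar\<close> need not be a multiple of \<open>A\<close>, so no exponential
  transform linearizes the equation. The two-sided bound between the forms leaves one-sided
  substitutes: \<open>exp (kl * h)\<close> keeps a convex gradient term, which suits comparison on
  all of \<open>E\<close>; \<open>- exp (ku * h)\<close> gives supersolutions of a linear equation,
  so that a gap below an upper bound can be propagated like a gap above a lower one.

  The obstacle is that \<open>h\<close> need not be bounded on \<open>E\<close>. Every global bound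
  therefore carries a multiple of \<open>w\<close>, and a local gain becomes global only at the
  price of some slope, which the barrier converts back into a constant. From above, the convex
  gradient term admits slopes up to 1 only; \<delta> > 1 makes this enough, since \<open>w\<close>
  then dominates \<open>h\<close> with the margin (\<delta> - 1) * \<open>\<phi>0\<close>, up to
  constants.

  The final contradiction needs a gain that is fixed before the errors in the asymptotic bounds are
  chosen. Hence the constants of the Lipschitz and propagation estimates must not depend on the time
  at which they are applied.\<close>

definition mdot :: "real ^ 'd ^ 'd \<Rightarrow> real ^ 'd ^ 'd \<Rightarrow> real" where
  "mdot a H = (\<Sum>i\<in>UNIV. \<Sum>j\<in>UNIV. a $ i $ j * H $ j $ i)"

definition quad :: "real ^ 'd ^ 'd \<Rightarrow> real ^ 'd \<Rightarrow> real" where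
  "quad a p = p \<bullet> (a *v p)"

definition outer :: "real ^ 'd \<Rightarrow> real ^ 'd \<Rightarrow> real ^ 'd ^ 'd" where
  "outer p q = (\<chi> i j. p $ i * q $ j)"

lemma mdot_add: "mdot a (H + G) = mdot a H + mdot a G"
  and mdot_diff: "mdot a (H - G) = mdot a H - mdot a G"
  and mdot_scale: "mdot a (c *\<^sub>R H) = c * mdot a H"
  and mdot_add_left: "mdot (a + a') H = mdot a H + mdot a' H"
  and mdot_scale_left: "mdot (c *\<^sub>R a) H = c * mdot a H"
  by (simp_all add: mdot_def algebra_simps sum.distrib sum_subtractf sum_distrib_left)

lemma mdot_zero [simp]: "mdot a 0 = 0"
  by (simp add: mdot_def)

lemma inner_matrix_vector: "p \<bullet> (a *v q) = (\<Sum>i\<in>UNIV. \<Sum>j\<in>UNIV. p $ i * a $ i $ j * q $ j)"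
  by (simp add: inner_vec_def matrix_vector_mult_def sum_distrib_left algebra_simps)

lemma mdot_outer: "mdot a (outer p q) = q \<bullet> (a *v p)"
  unfolding mdot_def inner_matrix_vector outer_def by (simp add: algebra_simps)

lemma mdot_outer_left: "mdot (outer p q) H = q \<bullet> (H *v p)"
proof -
  have "mdot (outer p q) H = (\<Sum>i\<in>UNIV. \<Sum>j\<in>UNIV. p $ i * q $ j * H $ j $ i)"
    by (simp add: mdot_def outer_def)
  also have "\<dots> = (\<Sum>j\<in>UNIV. \<Sum>i\<in>UNIV. p $ i * q $ j * H $ j $ i)"
    by (rule sum.swap)
  finally show ?thesis
    by (simp add: inner_matrix_vector algebra_simps)
qed

lemma outer_mult: "outer p q *v \<xi> = (q \<bullet> \<xi>) *\<^sub>R p"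
  by (simp add: outer_def matrix_vector_mult_def vec_eq_iff inner_vec_def sum_distrib_left
      algebra_simps)

lemma mdot_mat_1: "mdot a (mat 1) = trace a"
  by (simp add: mdot_def mat_def trace_def if_distrib cong: if_cong)

lemma quad_scale: "quad a (c *\<^sub>R p) = c\<^sup>2 * quad a p"
  by (simp add: quad_def power2_eq_square matrix_vector_mult_scaleR)

section \<open>Symmetric and positive semidefinite matrices\<close>

lemma inner_sym_matrix:
  fixes a :: "real ^ 'd ^ 'd"
  assumes "transpose a = a"
  shows "p \<bullet> (a *v q) = q \<bullet> (a *v p)"
proof -
  have "p \<bullet> (a *v q) = (p v* a) \<bullet> q" by (rule dot_lmul_matrix[symmetric])
  also have "p v* a = transpose a *v p" by simp
  finally show ?thesis unfolding assms by (simp add: inner_commute)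
qed

lemma quad_add:
  assumes "transpose a = a"
  shows "quad a (p + q) = quad a p + quad a q + 2 * (p \<bullet> (a *v q))"
  using inner_sym_matrix[OF assms, of q p]
  by (simp add: quad_def inner_add_left inner_add_right matrix_vector_right_distrib)

text \<open>Cholesky elimination: the induction splits off one index and passes to the Schur
  complement of its pivot. Functions on an arbitrary finite index set let the induction run, and
  later allow a disjoint sum as index type, for block matrices.\<close>

lemma psd_sum_squares:
  fixes a :: "'i \<Rightarrow> 'i \<Rightarrow> real"
  assumes "finite S"
    and "\<And>i j. i \<in> S \<Longrightarrow> j \<in> S \<Longrightarrow> a i j = a j i"
    and "\<And>x. (\<Sum>i\<in>S. \<Sum>j\<in>S. x i * a i j * x j) \<ge> 0"
  shows "\<exists>v. \<forall>i\<in>S. \<forall>j\<in>S. a i j = (\<Sum>k\<in>S. v k i * v k j)"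
  using assms
proof (induction S arbitrary: a rule: finite_induct)
  case empty
  then show ?case by simp
next
  case (insert p S)
  note sym = insert.prems(1) and psd = insert.prems(2)
  have expand: "(\<Sum>i\<in>insert p S. \<Sum>j\<in>insert p S. x i * a i j * x j) =
      x p * x p * a p p + 2 * x p * (\<Sum>j\<in>S. a p j * x j) + (\<Sum>i\<in>S. \<Sum>j\<in>S. x i * a i j * x j)"
    for x
  proof -
    have "(\<Sum>i\<in>S. x i * a i p * x p) = (\<Sum>j\<in>S. x p * a p j * x j)"
      by (intro sum.cong) (auto simp: sym)
    moreover have "(\<Sum>j\<in>S. x p * a p j * x j) = x p * (\<Sum>j\<in>S. a p j * x j)"
      by (simp add: sum_distrib_left mult.assoc)
    ultimately show ?thesis
      using insert.hyps by (simp add: sum.distrib)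
  qed
  \<comment> \<open>The Schur complement of the pivot \<open>a p p\<close>. If the pivot is 0,
    division by zero makes the correction vanish, which is right because then the whole row is 0
    (fact \<open>row\<close>).\<close>
  define a' where "a' i j = a i j - a p i * a p j / a p p" for i j
  have app: "a p p \<ge> 0"
    using psd[of "\<lambda>i. if i = p then 1 else 0"] insert.hyps
    unfolding expand by (simp add: sum.neutral)
  have row: "a p j = 0" if "a p p = 0" "j \<in> S" for j
  proof -
    \<comment> \<open>If \<open>a p j\<close> is nonzero, this \<open>s\<close> gives the form the
      value \<open>2 * s * a p j + a j j = - 1\<close>, contradicting positivity.\<close>
    define s where "s = (if a p j = 0 then 0 else - (a j j + 1) / (2 * a p j))"
    let ?x = "\<lambda>i. if i = p then s else if i = j then 1 else 0"
    have "(\<Sum>i\<in>S. \<Sum>k\<in>S. ?x i * a i k * ?x k) = (\<Sum>i\<in>S. \<Sum>k\<in>S. if i = j \<and> k = j then a j j else 0)"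
      using insert.hyps by (intro sum.cong) auto
    also have "\<dots> = (\<Sum>i\<in>S. if i = j then a j j else 0)"
      using insert.hyps that by (intro sum.cong) auto
    also have "\<dots> = a j j" using insert.hyps that by simp
    finally have 1: "(\<Sum>i\<in>S. \<Sum>k\<in>S. ?x i * a i k * ?x k) = a j j" .
    have "(\<Sum>k\<in>S. a p k * ?x k) = (\<Sum>k\<in>S. if k = j then a p j else 0)"
      using insert.hyps by (intro sum.cong) auto
    also have "\<dots> = a p j" using insert.hyps that by simp
    finally have 2: "(\<Sum>k\<in>S. a p k * ?x k) = a p j" .
    have "0 \<le> 2 * s * a p j + a j j"
      using psd[of ?x] that(1) unfolding expand 1 2 by simp
    moreover have "2 * s * a p j = - (a j j + 1)" if "a p j \<noteq> 0"
      using that by (simp add: s_def)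
    ultimately show ?thesis by (cases "a p j = 0") auto
  qed
  have "(\<Sum>i\<in>S. \<Sum>j\<in>S. x i * a' i j * x j) \<ge> 0" for x
  proof -
    define y where "y = (\<Sum>j\<in>S. a p j * x j)"
    have cross: "(\<Sum>i\<in>S. \<Sum>j\<in>S. x i * a' i j * x j) =
        (\<Sum>i\<in>S. \<Sum>j\<in>S. x i * a i j * x j) - y * y / a p p"
    proof -
      have "y * y / a p p = (\<Sum>i\<in>S. \<Sum>j\<in>S. (a p i * x i) * (a p j * x j)) / a p p"
        by (simp add: y_def sum_product)
      also have "\<dots> = (\<Sum>i\<in>S. \<Sum>j\<in>S. x i * (a p i * a p j / a p p) * x j)"
        by (simp add: sum_divide_distrib algebra_simps)
      finally show ?thesis
        by (simp add: a'_def algebra_simps sum_subtractf)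
    qed
    \<comment> \<open>For a positive pivot this value of the \<open>p\<close>-coordinate minimizes
      the form, and the minimum is the form of \<open>a'\<close>.\<close>
    let ?x = "\<lambda>i. if i = p then - y / a p p else x i"
    have 1: "(\<Sum>i\<in>S. \<Sum>k\<in>S. ?x i * a i k * ?x k) = (\<Sum>i\<in>S. \<Sum>j\<in>S. x i * a i j * x j)"
      using insert.hyps by (intro sum.cong) auto
    have 2: "(\<Sum>k\<in>S. a p k * ?x k) = y"
      unfolding y_def using insert.hyps by (intro sum.cong) auto
    have "0 \<le> (- y / a p p) * (- y / a p p) * a p p + 2 * (- y / a p p) * y
          + (\<Sum>i\<in>S. \<Sum>j\<in>S. x i * a i j * x j)"
      using psd[of ?x] unfolding expand 1 2 by simp
    also have "(- y / a p p) * (- y / a p p) * a p p + 2 * (- y / a p p) * y = - (y * y / a p p)"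
      by (cases "a p p = 0") simp_all
    finally show ?thesis unfolding cross by simp
  qed
  moreover have "a' i j = a' j i" if "i \<in> S" "j \<in> S" for i j
    using sym[of i j] that by (simp add: a'_def)
  ultimately obtain v where v: "\<forall>i\<in>S. \<forall>j\<in>S. a' i j = (\<Sum>k\<in>S. v k i * v k j)"
    using insert.IH[of a'] by blast
  define u where "u k i = (if k = p then a p i / sqrt (a p p) else if i = p then 0 else v k i)" for k i
  have "a i j = (\<Sum>k\<in>insert p S. u k i * u k j)" if ij: "i \<in> insert p S" "j \<in> insert p S" for i j
  proof -
    have S1: "(\<Sum>k\<in>insert p S. u k i * u k j) = a p i * a p j / a p p + (\<Sum>k\<in>S. u k i * u k j)"
      using insert.hyps by (simp add: u_def app)
    have S2: "(\<Sum>k\<in>S. u k i * u k j) = (if i = p \<or> j = p then 0 else a' i j)"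
    proof (cases "i = p \<or> j = p")
      case True
      then have "(\<Sum>k\<in>S. u k i * u k j) = 0"
        using insert.hyps by (intro sum.neutral) (auto simp: u_def)
      then show ?thesis using True by simp
    next
      case False
      then have "(\<Sum>k\<in>S. u k i * u k j) = (\<Sum>k\<in>S. v k i * v k j)"
        using insert.hyps by (intro sum.cong) (auto simp: u_def)
      then show ?thesis using False v ij by simp
    qed
    have pj: "a p p = 0 \<Longrightarrow> j \<in> insert p S \<Longrightarrow> a p j = 0" for j
      using row by auto
    consider "i = p" | "j = p" "i \<noteq> p" | "i \<noteq> p" "j \<noteq> p" by blast
    then show ?thesis
    proof cases
      case 1
      then show ?thesis unfolding S1 S2 using pj[OF _ ij(2)] by (cases "a p p = 0") auto
    next
      case 2
      then show ?thesis unfolding S1 S2 using pj[OF _ ij(1)] sym[OF ij]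
        by (cases "a p p = 0") auto
    next
      case 3
      then show ?thesis unfolding S1 S2 by (simp add: a'_def)
    qed
  qed
  then show ?case by blast
qed

lemma sum_outer_mdot:
  assumes "\<And>i j. a $ i $ j = (\<Sum>k\<in>S. v k $ i * v k $ j)"
  shows "mdot a H = (\<Sum>k\<in>S. v k \<bullet> (H *v v k))"
proof -
  have "mdot a H = (\<Sum>i\<in>UNIV. \<Sum>j\<in>UNIV. \<Sum>k\<in>S. v k $ i * v k $ j * H $ j $ i)"
    by (simp add: mdot_def assms sum_distrib_right)
  also have "\<dots> = (\<Sum>i\<in>UNIV. \<Sum>k\<in>S. \<Sum>j\<in>UNIV. v k $ i * v k $ j * H $ j $ i)"
    by (intro sum.cong refl sum.swap)
  also have "\<dots> = (\<Sum>k\<in>S. \<Sum>i\<in>UNIV. \<Sum>j\<in>UNIV. v k $ i * v k $ j * H $ j $ i)"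
    by (rule sum.swap)
  also have "\<dots> = (\<Sum>k\<in>S. mdot (outer (v k) (v k)) H)"
    by (simp add: mdot_def outer_def)
  finally show ?thesis by (simp add: mdot_outer_left)
qed

lemma transpose_eqD: "transpose a = a \<Longrightarrow> a $ i $ j = a $ j $ i"
  by (simp add: transpose_def vec_eq_iff)

text \<open>Decomposing \<open>a\<close> into rank-one matrices turns the trace into a sum of values
  of the quadratic form of \<open>H\<close>.\<close>

lemma mdot_nonneg:
  fixes a H :: "real ^ 'd ^ 'd"
  assumes "transpose a = a" "\<And>\<xi>. 0 \<le> quad a \<xi>" "\<And>\<xi>. 0 \<le> \<xi> \<bullet> (H *v \<xi>)"
  shows "0 \<le> mdot a H"
proof -
  have "\<exists>v. \<forall>i\<in>UNIV. \<forall>j\<in>UNIV. a $ i $ j = (\<Sum>k\<in>(UNIV::'d set). v k i * v k j)"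
  proof (rule psd_sum_squares)
    show "(\<Sum>i\<in>UNIV. \<Sum>j\<in>UNIV. x i * a $ i $ j * x j) \<ge> 0" for x :: "'d \<Rightarrow> real"
      using assms(2)[of "\<chi> i. x i"] by (simp add: quad_def inner_matrix_vector)
  qed (auto intro: transpose_eqD assms)
  then obtain v where v: "\<And>i j. a $ i $ j = (\<Sum>k\<in>(UNIV::'d set). v k i * v k j)" by blast
  have "mdot a H = (\<Sum>k\<in>(UNIV::'d set). (\<chi> i. v k i) \<bullet> (H *v (\<chi> i. v k i)))"
    by (rule sum_outer_mdot) (simp add: v)
  then show ?thesis
    using assms(3) by (simp add: sum_nonneg)
qed

section \<open>Second-order jets and their calculus\<close>

text \<open>The Hessian \<open>H\<close> need not be symmetric: second-order conditions along lines only involve its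
  quadratic form.\<close>

definition has_jet :: "(real ^ 'd \<Rightarrow> real) \<Rightarrow> real ^ 'd \<Rightarrow> real ^ 'd \<Rightarrow> real ^ 'd ^ 'd \<Rightarrow> bool" where
  "has_jet f x p H \<longleftrightarrow>
     (\<exists>G. (\<forall>\<^sub>F y in nhds x. (f has_derivative (\<lambda>\<xi>. G y \<bullet> \<xi>)) (at y)) \<and> G x = p \<and>
        (G has_derivative (\<lambda>\<xi>. H *v \<xi>)) (at x))"

text \<open>The derivative matrix of \<open>grad f\<close>: row \<open>j\<close> is the gradient of
  \<open>partial j f\<close>, hence the index order. Together with the index order in
  \<open>mdot\<close>, the trace of a product, it reproduces the second-order sum of
  \<open>second_order_op\<close> term by term.\<close>

definition hess :: "(real ^ 'd \<Rightarrow> real) \<Rightarrow> real ^ 'd \<Rightarrow> real ^ 'd ^ 'd" where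
  "hess f x = (\<chi> j i. partial i (partial j f) x)"

lemma has_jetI:
  assumes "open U" "x \<in> U" "\<And>y. y \<in> U \<Longrightarrow> (f has_derivative (\<lambda>\<xi>. G y \<bullet> \<xi>)) (at y)"
    "(G has_derivative (\<lambda>\<xi>. H *v \<xi>)) (at x)" "G x = p"
  shows "has_jet f x p H"
  unfolding has_jet_def using assms eventually_nhds by (metis (mono_tags, lifting))

lemma has_jet_derivative: "has_jet f x p H \<Longrightarrow> (f has_derivative (\<lambda>\<xi>. p \<bullet> \<xi>)) (at x)"
  unfolding has_jet_def by (meson eventually_nhds_x_imp_x)

lemma has_jet_isCont: "has_jet f x p H \<Longrightarrow> isCont f x"
  using has_jet_derivative has_derivative_continuous by blast

lemma differentiable_partial:
  assumes "f differentiable (at x)"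
  shows "(f has_derivative (\<lambda>\<xi>. grad f x \<bullet> \<xi>)) (at x)"
proof -
  have D: "(f has_derivative frechet_derivative f (at x)) (at x)"
    using assms frechet_derivative_works by blast
  then have lin: "linear (frechet_derivative f (at x))"
    using has_derivative_linear by blast
  have "frechet_derivative f (at x) \<xi> = grad f x \<bullet> \<xi>" for \<xi>
  proof -
    have "frechet_derivative f (at x) \<xi> = frechet_derivative f (at x) (\<Sum>i\<in>UNIV. \<xi> $ i *s axis i 1)"
      by (simp add: basis_expansion)
    also have "\<dots> = (\<Sum>i\<in>UNIV. \<xi> $ i * partial i f x)"
      using lin by (simp add: linear_sum linear_cmul scalar_mult_eq_scaleR partial_def)
    finally show ?thesis by (simp add: grad_def inner_vec_def mult.commute)
  qed
  then show ?thesis using D by (metis ext)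
qed

lemma has_derivative_gradD:
  assumes "(f has_derivative (\<lambda>\<xi>. p \<bullet> \<xi>)) (at x)"
  shows "partial i f x = p $ i"
  using frechet_derivative_at[OF assms, symmetric]
  by (simp add: partial_def inner_axis)

lemma Ck_on_2_has_jet:
  assumes "Ck_on 2 U f" "open U" "x \<in> U"
  shows "has_jet f x (grad f x) (hess f x)"
proof (rule has_jetI[OF assms(2,3), of _ "grad f"])
  have C: "f differentiable_on U" "\<And>i. partial i f differentiable_on U"
    using assms(1) by (auto simp: numeral_2_eq_2)
  show "(f has_derivative (\<lambda>\<xi>. grad f y \<bullet> \<xi>)) (at y)" if "y \<in> U" for y
    using C(1) that assms(2) differentiable_partial differentiable_on_eq_differentiable_at by blast
  have "(partial i f has_derivative (\<lambda>\<xi>. (hess f x *v \<xi>) $ i)) (at x)" for i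
  proof -
    have "(partial i f has_derivative (\<lambda>\<xi>. grad (partial i f) x \<bullet> \<xi>)) (at x)"
      using C(2) assms(2,3) differentiable_partial differentiable_on_eq_differentiable_at by blast
    then show ?thesis
      by (simp add: grad_def hess_def inner_vec_def matrix_vector_mult_def)
  qed
  then show "(grad f has_derivative (\<lambda>\<xi>. hess f x *v \<xi>)) (at x)"
    unfolding has_derivative_componentwise_within[of "grad f"]
    by (auto simp: Basis_vec_def inner_axis grad_def)
qed auto

text \<open>Jets are unique, so a jet computed by calculus rules identifies \<open>grad\<close> and
  \<open>hess\<close>. The second derivatives can be read off because \<open>partial j f\<close>
  agrees with a component of \<open>G\<close> on a whole neighbourhood of \<open>x\<close>.\<close>

lemma has_jetD:
  assumes "has_jet f x p H"
  shows "grad f x = p" "hess f x = H"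
proof -
  obtain G where G: "\<forall>\<^sub>F y in nhds x. (f has_derivative (\<lambda>\<xi>. G y \<bullet> \<xi>)) (at y)" "G x = p"
    "(G has_derivative (\<lambda>\<xi>. H *v \<xi>)) (at x)"
    using assms unfolding has_jet_def by blast
  have eq: "\<forall>\<^sub>F y in nhds x. partial j f y = G y $ j" for j
    using G(1) by eventually_elim (rule has_derivative_gradD)
  have "partial j f x = p $ j" for j
    using eventually_nhds_x_imp_x[OF eq] G(2) by auto
  then show "grad f x = p" by (simp add: grad_def vec_eq_iff)
  have "partial i (partial j f) x = H $ j $ i" for i j
  proof (rule has_derivative_gradD)
    have "((\<lambda>y. G y $ j) has_derivative (\<lambda>\<xi>. (H *v \<xi>) $ j)) (at x)"
      using bounded_linear.has_derivative[OF bounded_linear_vec_nth G(3)] .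
    moreover have "(H *v \<xi>) $ j = H $ j \<bullet> \<xi>" for \<xi>
      by (simp add: matrix_vector_mult_def inner_vec_def)
    ultimately have D: "((\<lambda>y. G y $ j) has_derivative (\<lambda>\<xi>. H $ j \<bullet> \<xi>)) (at x)" by simp
    show "(partial j f has_derivative (\<lambda>\<xi>. H $ j \<bullet> \<xi>)) (at x)"
      using D
    proof (rule has_derivative_transform_eventually)
      show "\<forall>\<^sub>F y in at x. G y $ j = partial j f y"
        using eq[of j] by (simp add: eventually_at_filter eventually_mono)
      show "G x $ j = partial j f x"
        using eventually_nhds_x_imp_x[OF eq] by simp
    qed simp
  qed
  then show "hess f x = H" by (simp add: hess_def vec_eq_iff)
qed

lemma has_jet_add:
  assumes "has_jet f x p H" "has_jet g x q K"
  shows "has_jet (\<lambda>y. f y + g y) x (p + q) (H + K)"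
proof -
  obtain F where F: "\<forall>\<^sub>F y in nhds x. (f has_derivative (\<lambda>\<xi>. F y \<bullet> \<xi>)) (at y)" "F x = p"
    "(F has_derivative (\<lambda>\<xi>. H *v \<xi>)) (at x)"
    using assms(1) unfolding has_jet_def by blast
  obtain G where G: "\<forall>\<^sub>F y in nhds x. (g has_derivative (\<lambda>\<xi>. G y \<bullet> \<xi>)) (at y)" "G x = q"
    "(G has_derivative (\<lambda>\<xi>. K *v \<xi>)) (at x)"
    using assms(2) unfolding has_jet_def by blast
  show ?thesis unfolding has_jet_def
  proof (intro exI[of _ "\<lambda>y. F y + G y"] conjI)
    show "\<forall>\<^sub>F y in nhds x. ((\<lambda>y. f y + g y) has_derivative (\<lambda>\<xi>. (F y + G y) \<bullet> \<xi>)) (at y)"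
      using F(1) G(1) by eventually_elim (auto intro!: derivative_eq_intros simp: inner_add)
    show "((\<lambda>y. F y + G y) has_derivative (*v) (H + K)) (at x)"
      using F(3) G(3)
      by (auto intro!: derivative_eq_intros simp: matrix_vector_mult_add_rdistrib)
  qed (use F G in auto)
qed

lemma has_jet_const: "has_jet (\<lambda>y. c) x 0 0"
  by (rule has_jetI[of UNIV x _ "\<lambda>_. 0"]) auto

lemma has_jet_compose:
  fixes \<Theta> \<Theta>' :: "real \<Rightarrow> real"
  assumes f: "has_jet f x p H"
    and 1: "\<forall>\<^sub>F s in nhds (f x). (\<Theta> has_real_derivative \<Theta>' s) (at s)"
    and 2: "(\<Theta>' has_real_derivative \<Theta>'') (at (f x))"
  shows "has_jet (\<lambda>y. \<Theta> (f y)) x (\<Theta>' (f x) *\<^sub>R p) (\<Theta>' (f x) *\<^sub>R H + \<Theta>'' *\<^sub>R outer p p)"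
proof -
  obtain F where F: "\<forall>\<^sub>F y in nhds x. (f has_derivative (\<lambda>\<xi>. F y \<bullet> \<xi>)) (at y)" "F x = p"
    "(F has_derivative (\<lambda>\<xi>. H *v \<xi>)) (at x)"
    using f unfolding has_jet_def by blast
  have "filterlim f (nhds (f x)) (nhds x)"
    using has_jet_isCont[OF f] by (simp add: isCont_def tendsto_at_iff_tendsto_nhds)
  then have ev: "\<forall>\<^sub>F y in nhds x. (\<Theta> has_real_derivative \<Theta>' (f y)) (at (f y))"
    using 1 unfolding filterlim_iff by auto
  show ?thesis unfolding has_jet_def
  proof (intro exI[of _ "\<lambda>y. \<Theta>' (f y) *\<^sub>R F y"] conjI)
    show "\<forall>\<^sub>F y in nhds x. ((\<lambda>y. \<Theta> (f y)) has_derivative (\<lambda>\<xi>. (\<Theta>' (f y) *\<^sub>R F y) \<bullet> \<xi>)) (at y)"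
      using F(1) ev
    proof eventually_elim
      case (elim y)
      show ?case
        using has_derivative_compose[OF elim(1), of \<Theta> "(*) (\<Theta>' (f y))"] elim(2)
        by (simp add: has_field_derivative_def o_def)
    qed
    have "((\<lambda>y. \<Theta>' (f y)) has_derivative (\<lambda>\<xi>. \<Theta>'' * (p \<bullet> \<xi>))) (at x)"
      using has_derivative_compose[OF has_jet_derivative[OF f], of \<Theta>' "(*) \<Theta>''"] 2
      by (simp add: has_field_derivative_def o_def)
    then show "((\<lambda>y. \<Theta>' (f y) *\<^sub>R F y) has_derivative
        (*v) (\<Theta>' (f x) *\<^sub>R H + \<Theta>'' *\<^sub>R outer p p)) (at x)"
    proof (rule has_derivative_eq_rhs[OF has_derivative_scaleR[OF _ F(3)]])
      show "(\<lambda>\<xi>. \<Theta>' (f x) *\<^sub>R (H *v \<xi>) + (\<Theta>'' * (p \<bullet> \<xi>)) *\<^sub>R F x) =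
          (*v) (\<Theta>' (f x) *\<^sub>R H + \<Theta>'' *\<^sub>R outer p p)"
        by (simp add: fun_eq_iff F(2) matrix_vector_mult_add_rdistrib
            scaleR_matrix_vector_assoc[symmetric] outer_mult)
    qed
  qed (use F in auto)
qed

lemma has_jet_scale:
  assumes "has_jet f x p H"
  shows "has_jet (\<lambda>y. c * f y) x (c *\<^sub>R p) (c *\<^sub>R H)"
  using has_jet_compose[OF assms, of "\<lambda>s. c * s" "\<lambda>_. c" 0]
  by (auto intro!: derivative_eq_intros)

lemma has_jet_diff:
  assumes "has_jet f x p H" "has_jet g x q K"
  shows "has_jet (\<lambda>y. f y - g y) x (p - q) (H - K)"
  using has_jet_add[OF assms(1) has_jet_scale[OF assms(2), of "-1"]] by simp

lemma has_jet_exp: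
  assumes "has_jet f x p H"
  shows "has_jet (\<lambda>y. exp (k * f y)) x ((k * exp (k * f x)) *\<^sub>R p)
           ((k * exp (k * f x)) *\<^sub>R (H + k *\<^sub>R outer p p))"
proof -
  have "has_jet (\<lambda>y. exp (k * f y)) x ((k * exp (k * f x)) *\<^sub>R p)
      ((k * exp (k * f x)) *\<^sub>R H + (k * (k * exp (k * f x))) *\<^sub>R outer p p)"
    by (rule has_jet_compose[OF assms, of _ "\<lambda>s. k * exp (k * s)"])
      (auto intro!: always_eventually derivative_eq_intros)
  then show ?thesis by (simp add: scaleR_add_right mult.commute mult.left_commute)
qed

lemma has_jet_dist_sq:
  "has_jet (\<lambda>y. (norm (y - c))\<^sup>2) x (2 *\<^sub>R (x - c)) (2 *\<^sub>R mat 1)"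
proof (rule has_jetI[of UNIV x _ "\<lambda>y. 2 *\<^sub>R (y - c)"])
  show "((\<lambda>y. (norm (y - c))\<^sup>2) has_derivative (\<bullet>) (2 *\<^sub>R (y - c))) (at y)" for y
    unfolding power2_norm_eq_inner
    by (auto intro!: derivative_eq_intros simp: inner_commute)
  show "((\<lambda>y. 2 *\<^sub>R (y - c)) has_derivative (*v) (2 *\<^sub>R mat 1)) (at x)"
    by (auto intro!: derivative_eq_intros simp: scaleR_matrix_vector_assoc[symmetric])
qed auto

section \<open>Optimality conditions at minima in space and time\<close>

lemma second_derivative_nonneg_at_min:
  fixes \<phi> :: "real \<Rightarrow> real"
  assumes 1: "\<forall>\<^sub>F s in nhds 0. (\<phi> has_real_derivative \<phi>' s) (at s)"
    and 2: "(\<phi>' has_real_derivative c) (at 0)"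
    and m: "\<forall>\<^sub>F s in nhds 0. \<phi> 0 \<le> \<phi> s"
  shows "\<phi>' 0 = 0" "0 \<le> c"
proof -
  obtain d where d: "d > 0" "\<And>s. \<bar>s\<bar> < d \<Longrightarrow> (\<phi> has_real_derivative \<phi>' s) (at s)"
      "\<And>s. \<bar>s\<bar> < d \<Longrightarrow> \<phi> 0 \<le> \<phi> s"
    using eventually_conj[OF 1 m] unfolding eventually_nhds_metric by (auto simp: dist_real_def)
  show z: "\<phi>' 0 = 0"
    using DERIV_local_min[OF d(2)[of 0] d(1)] d by auto
  show "0 \<le> c"
  proof (rule ccontr)
    assume "\<not> 0 \<le> c"
    then obtain e where e: "e > 0" "\<And>s. 0 < s \<Longrightarrow> s < e \<Longrightarrow> \<phi>' s < \<phi>' 0"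
      using DERIV_neg_dec_right[OF 2] by auto
    define s where "s = min d e / 2"
    have s: "0 < s" "s < d" "s < e" using d(1) e(1) by (auto simp: s_def)
    obtain r where r: "0 < r" "r < s" "\<phi> s - \<phi> 0 = (s - 0) * \<phi>' r"
      using MVT2[of 0 s \<phi> \<phi>'] s d(2) by auto
    have "\<phi>' r < 0" using e(2)[of r] r s z by auto
    then have "s * \<phi>' r < 0" using s by (simp add: mult_pos_neg)
    then have "\<phi> s < \<phi> 0" using r(3) by simp
    then show False using d(3)[of s] s by auto
  qed
qed

lemma has_jet_line:
  assumes "has_jet f x p H"
  obtains \<phi>' where "\<forall>\<^sub>F s in nhds (0::real). ((\<lambda>s. f (x + s *\<^sub>R \<xi>)) has_real_derivative \<phi>' s) (at s)"
    "\<phi>' 0 = p \<bullet> \<xi>" "(\<phi>' has_real_derivative \<xi> \<bullet> (H *v \<xi>)) (at 0)"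
proof -
  obtain F where F: "\<forall>\<^sub>F y in nhds x. (f has_derivative (\<lambda>\<xi>. F y \<bullet> \<xi>)) (at y)" "F x = p"
    "(F has_derivative (\<lambda>\<xi>. H *v \<xi>)) (at x)"
    using assms unfolding has_jet_def by blast
  have "((\<lambda>s. x + s *\<^sub>R \<xi>) \<longlongrightarrow> x + 0 *\<^sub>R \<xi>) (nhds (0::real))"
    using tendsto_ident_at by (intro tendsto_intros) (simp add: filterlim_ident)
  then have "filterlim (\<lambda>s. x + s *\<^sub>R \<xi>) (nhds x) (nhds (0::real))"
    by simp
  then have ev: "\<forall>\<^sub>F s in nhds (0::real). (f has_derivative (\<lambda>\<zeta>. F (x + s *\<^sub>R \<xi>) \<bullet> \<zeta>)) (at (x + s *\<^sub>R \<xi>))"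
    using F(1) unfolding filterlim_iff by auto
  have line: "((\<lambda>s. x + s *\<^sub>R \<xi>) has_derivative (\<lambda>r. r *\<^sub>R \<xi>)) (at s)" for s :: real
    by (auto intro!: derivative_eq_intros)
  show ?thesis
  proof
    show "\<forall>\<^sub>F s in nhds (0::real). ((\<lambda>s. f (x + s *\<^sub>R \<xi>)) has_real_derivative F (x + s *\<^sub>R \<xi>) \<bullet> \<xi>) (at s)"
      using ev
    proof eventually_elim
      case (elim s)
      show ?case
        using has_derivative_compose[OF line elim]
        by (simp add: has_field_derivative_def o_def mult.commute[of _ "F _ \<bullet> \<xi>"])
    qed
    have "((\<lambda>s. F (x + s *\<^sub>R \<xi>)) has_derivative (\<lambda>r. H *v (r *\<^sub>R \<xi>))) (at 0)"
      using has_derivative_compose[OF line[of 0], of F "\<lambda>\<xi>. H *v \<xi>"] F(3) by (simp add: o_def)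
    then have "((\<lambda>s. F (x + s *\<^sub>R \<xi>) \<bullet> \<xi>) has_derivative (\<lambda>r. (H *v (r *\<^sub>R \<xi>)) \<bullet> \<xi>)) (at 0)"
      by (auto intro!: derivative_eq_intros)
    moreover have "(\<lambda>r. (H *v (r *\<^sub>R \<xi>)) \<bullet> \<xi>) = (*) (\<xi> \<bullet> (H *v \<xi>))"
      by (simp add: fun_eq_iff matrix_vector_mult_scaleR inner_commute mult.commute)
    ultimately show "((\<lambda>s. F (x + s *\<^sub>R \<xi>) \<bullet> \<xi>) has_real_derivative \<xi> \<bullet> (H *v \<xi>)) (at 0)"
      by (simp add: has_field_derivative_def)
  qed (use F in auto)
qed

lemma jet_at_min:
  assumes "has_jet f x p H" "\<forall>\<^sub>F y in nhds x. f x \<le> f y"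
  shows "p = 0" "0 \<le> \<xi> \<bullet> (H *v \<xi>)"
proof -
  have *: "p \<bullet> \<xi> = 0 \<and> 0 \<le> \<xi> \<bullet> (H *v \<xi>)" for \<xi>
  proof -
    obtain \<phi>' where \<phi>': "\<forall>\<^sub>F s in nhds (0::real). ((\<lambda>s. f (x + s *\<^sub>R \<xi>)) has_real_derivative \<phi>' s) (at s)"
      "\<phi>' 0 = p \<bullet> \<xi>" "(\<phi>' has_real_derivative \<xi> \<bullet> (H *v \<xi>)) (at 0)"
      by (rule has_jet_line[OF assms(1)])
    have "((\<lambda>s. x + s *\<^sub>R \<xi>) \<longlongrightarrow> x + 0 *\<^sub>R \<xi>) (nhds (0::real))"
      by (intro tendsto_intros) (simp add: filterlim_ident)
    then have "\<forall>\<^sub>F s in nhds (0::real). f (x + 0 *\<^sub>R \<xi>) \<le> f (x + s *\<^sub>R \<xi>)"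
      using assms(2) unfolding filterlim_iff by auto
    from second_derivative_nonneg_at_min[OF \<phi>'(1,3) this] show ?thesis
      using \<phi>'(2) by auto
  qed
  show "p = 0" using *[of p] by simp
  show "0 \<le> \<xi> \<bullet> (H *v \<xi>)" using * by blast
qed

text \<open>Only the past is compared, since a minimum over a time interval may sit at its right end
  point.\<close>

lemma derivative_nonpos_at_past_min:
  fixes f :: "real \<Rightarrow> real"
  assumes "(f has_real_derivative d) (at t)" "\<forall>\<^sub>F s in at_left t. f t \<le> f s"
  shows "d \<le> 0"
proof (rule ccontr)
  assume "\<not> d \<le> 0"
  then obtain e where e: "e > 0" "\<And>h. 0 < h \<Longrightarrow> h < e \<Longrightarrow> f (t - h) < f t"
    using DERIV_pos_inc_left[OF assms(1)] by auto
  have "\<forall>\<^sub>F s in at_left t. s \<in> {t - e<..<t}"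
    using e(1) by (intro eventually_at_leftI[of "t - e"]) auto
  with assms(2) have "\<forall>\<^sub>F s in at_left t. False"
  proof eventually_elim
    case (elim s)
    then show ?case using e(2)[of "t - s"] by auto
  qed
  then show False by simp
qed

section \<open>Comparison with Lyapunov barriers\<close>

definition lop :: "real ^ 'd ^ 'd \<Rightarrow> real ^ 'd \<Rightarrow> real ^ 'd \<Rightarrow> real ^ 'd ^ 'd \<Rightarrow> real" where
  "lop a b p H = mdot a H / 2 + b \<bullet> p"

lemma lop_diff: "lop a b (p - q) (H - K) = lop a b p H - lop a b q K"
  and lop_scale: "lop a b (c *\<^sub>R p) (c *\<^sub>R H) = c * lop a b p H"
  by (simp_all add: lop_def mdot_diff mdot_scale inner_diff_right algebra_simps diff_divide_distrib)

lemma mdot_exp_jet: "mdot a (c *\<^sub>R (H + k *\<^sub>R outer p p)) = c * (mdot a H + k * quad a p)"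
  by (simp add: mdot_add mdot_scale mdot_outer quad_def)

definition form_bounded_on :: "(real ^ 'd) set \<Rightarrow> (real ^ 'd \<Rightarrow> real ^ 'd ^ 'd) \<Rightarrow> bool" where
  "form_bounded_on S M \<longleftrightarrow>
     (\<exists>l\<ge>0. \<forall>x\<in>S. \<forall>\<xi> \<zeta>. \<bar>\<xi> \<bullet> (M x *v \<zeta>)\<bar> \<le> l * (norm \<xi> * norm \<zeta>))"

definition form_lipschitz_on :: "(real ^ 'd) set \<Rightarrow> (real ^ 'd \<Rightarrow> real ^ 'd ^ 'd) \<Rightarrow> bool" where
  "form_lipschitz_on S M \<longleftrightarrow> (\<exists>l\<ge>0. \<forall>x y. closed_segment x y \<subseteq> S \<longrightarrow>
     (\<forall>\<xi> \<zeta>. \<bar>\<xi> \<bullet> ((M x - M y) *v \<zeta>)\<bar> \<le> l * norm (x - y) * (norm \<xi> * norm \<zeta>)))"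

text \<open>Meant for a minimum of \<open>exp (k * D1) + \<epsilon> * exp (k * D2)\<close>, where
  \<open>a1\<close> and \<open>a2\<close> are the weights that differentiation produces. The
  vanishing weighted gradient cancels the drift and the cross terms with \<open>q\<close>; the
  rank-one terms from the exponentials are absorbed by \<open>Ab\<close>. What is left is a weighted
  sum of the two rates, whose sign the applications contradict.\<close>

lemma two_exponentials_at_min:
  fixes A Ab :: "real ^ 'd ^ 'd"
  assumes pos: "0 \<le> a1" "0 \<le> a2"
    and grad: "a1 *\<^sub>R p1 + a2 *\<^sub>R p2 = 0"
    and hess: "0 \<le> mdot A (a1 *\<^sub>R (H1 + k *\<^sub>R outer p1 p1) + a2 *\<^sub>R (H2 + k *\<^sub>R outer p2 p2))"
    and Ab: "\<And>p. k * quad A p \<le> quad Ab p"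
    and c: "lop A b p1 H1 + quad Ab p1 / 2 + q \<bullet> (Ab *v p1) \<le> c1"
      "lop A b p2 H2 + quad Ab p2 / 2 + q \<bullet> (Ab *v p2) \<le> c2"
  shows "0 \<le> a1 * c1 + a2 * c2"
proof -
  have b0: "a1 * (b \<bullet> p1) + a2 * (b \<bullet> p2) = 0"
    using arg_cong[OF grad, of "\<lambda>p. b \<bullet> p"] by (simp add: inner_add_right)
  have q0: "a1 * (q \<bullet> (Ab *v p1)) + a2 * (q \<bullet> (Ab *v p2)) = 0"
    using arg_cong[OF grad, of "\<lambda>p. q \<bullet> (Ab *v p)"]
    by (simp add: inner_add_right matrix_vector_right_distrib matrix_vector_mult_scaleR)
  have "0 \<le> a1 * (mdot A H1 + k * quad A p1) + a2 * (mdot A H2 + k * quad A p2)"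
    using hess by (simp add: mdot_add[of A "a1 *\<^sub>R _"] mdot_exp_jet)
  also have "\<dots> \<le> a1 * (mdot A H1 + quad Ab p1) + a2 * (mdot A H2 + quad Ab p2)"
    using pos Ab by (intro add_mono mult_left_mono) auto
  also have "\<dots> = 2 * (a1 * (lop A b p1 H1 + quad Ab p1 / 2 + q \<bullet> (Ab *v p1))
      + a2 * (lop A b p2 H2 + quad Ab p2 / 2 + q \<bullet> (Ab *v p2)))"
    using b0 q0 by (simp add: lop_def algebra_simps)
  also have "\<dots> \<le> 2 * (a1 * c1 + a2 * c2)"
    using pos c by (intro mult_left_mono add_mono) auto
  finally show ?thesis by simp
qed

text \<open>The cross term with \<open>q\<close> is exactly what turns the quadratic term of a
  difference into a difference of quadratic terms.\<close>

lemma quad_diff_shift: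
  fixes Ab :: "real ^ 'd ^ 'd"
  assumes "transpose Ab = Ab"
  shows "quad Ab (p - q) / 2 + q \<bullet> (Ab *v (p - q)) = quad Ab p / 2 - quad Ab q / 2"
  using quad_add[OF assms, of "p - q" q] inner_sym_matrix[OF assms, of q "p - q"]
  by (simp add: add_divide_distrib)

text \<open>The analytic core, detached from the probabilistic data; in the application
  \<open>w\<close> is a shift of \<delta> * \<open>\<phi>0\<close> - \<open>vhat\<close>. The two
  bounds on \<open>h 0\<close> are asymmetric: the convex gradient term makes \<open>s * w\<close> a
  supersolution for slopes \<open>s\<close> between 0 and 1, whereas \<open>- s * w\<close> is a
  subsolution, up to constants, for every slope.\<close>

locale quadratic_flow =
  fixes E :: "(real ^ 'd) set" and x0 :: "real ^ 'd"
    and A Ab :: "real ^ 'd \<Rightarrow> real ^ 'd ^ 'd" and b :: "real ^ 'd \<Rightarrow> real ^ 'd"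
    and kl ku al C :: real and w :: "real ^ 'd \<Rightarrow> real" and h :: "real \<Rightarrow> real ^ 'd \<Rightarrow> real"
  assumes open_E: "open E" and star: "star_shaped_at x0 E"
    and A_sym: "x \<in> E \<Longrightarrow> transpose (A x) = A x"
    and Ab_sym: "x \<in> E \<Longrightarrow> transpose (Ab x) = Ab x"
    and elliptic: "compact S \<Longrightarrow> S \<subseteq> E \<Longrightarrow> \<exists>c>0. \<forall>x\<in>S. \<forall>\<xi>. c * (norm \<xi>)\<^sup>2 \<le> quad (A x) \<xi>"
    and A_bounded: "compact S \<Longrightarrow> S \<subseteq> E \<Longrightarrow> form_bounded_on S A"
    and Ab_bounded: "compact S \<Longrightarrow> S \<subseteq> E \<Longrightarrow> form_bounded_on S Ab"
    and A_lipschitz: "compact S \<Longrightarrow> S \<subseteq> E \<Longrightarrow> form_lipschitz_on S A"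
    and Ab_lipschitz: "compact S \<Longrightarrow> S \<subseteq> E \<Longrightarrow> form_lipschitz_on S Ab"
    and b_bounded: "compact S \<Longrightarrow> S \<subseteq> E \<Longrightarrow> \<exists>l\<ge>0. \<forall>x\<in>S. norm (b x) \<le> l"
    and kl_pos: "0 < kl" and ku_ge: "kl \<le> ku"
    and kl: "x \<in> E \<Longrightarrow> kl * quad (A x) \<xi> \<le> quad (Ab x) \<xi>"
    and ku: "x \<in> E \<Longrightarrow> quad (Ab x) \<xi> \<le> ku * quad (A x) \<xi>"
    and h_cont: "continuous_on ({0..} \<times> E) (\<lambda>(t, x). h t x)"
    and h_jet: "0 < t \<Longrightarrow> x \<in> E \<Longrightarrow> has_jet (h t) x (grad (h t) x) (hess (h t) x)"
    and h_eq: "0 < t \<Longrightarrow> x \<in> E \<Longrightarrow> ((\<lambda>s. h s x) has_real_derivative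
      (lop (A x) (b x) (grad (h t) x) (hess (h t) x) + quad (Ab x) (grad (h t) x) / 2)) (at t)"
    and al_pos: "0 < al" and C_nonneg: "0 \<le> C"
    and w_nonneg: "x \<in> E \<Longrightarrow> 0 \<le> w x"
    and w_jet: "x \<in> E \<Longrightarrow> has_jet w x (grad w x) (hess w x)"
    and w_super: "x \<in> E \<Longrightarrow>
      lop (A x) (b x) (grad w x) (hess w x) + quad (Ab x) (grad w x) / 2 \<le> C - al * w x"
    and w_coercive: "\<exists>S. compact S \<and> S \<subseteq> E \<and> (\<forall>x\<in>E - S. c \<le> w x)"
    and w_dominates: "\<exists>S. compact S \<and> S \<subseteq> E \<and> (\<forall>t\<in>{0..T}. \<forall>x\<in>E - S. c \<le> w x - h t x)"
    and h0_upper: "\<exists>c. \<forall>x\<in>E. h 0 x \<le> c + w x"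
    and h0_lower: "\<exists>c s. 0 \<le> s \<and> (\<forall>x\<in>E. c - s * w x \<le> h 0 x)"
begin

lemma quad_A_nonneg: "x \<in> E \<Longrightarrow> 0 \<le> quad (A x) \<xi>"
proof -
  assume "x \<in> E"
  then obtain c where "0 < c" "c * (norm \<xi>)\<^sup>2 \<le> quad (A x) \<xi>"
    using elliptic[of "{x}"] by auto
  moreover have "0 \<le> c * (norm \<xi>)\<^sup>2" using \<open>0 < c\<close> by simp
  ultimately show ?thesis by linarith
qed

lemma quad_Ab_nonneg:
  assumes "x \<in> E"
  shows "0 \<le> quad (Ab x) \<xi>"
proof -
  have "0 \<le> kl * quad (A x) \<xi>" using quad_A_nonneg[OF assms] kl_pos by simp
  then show ?thesis using kl[OF assms, of \<xi>] by linarith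
qed

lemma x0_in: "x0 \<in> E"
  using star by (simp add: star_shaped_at_def)

lemma w_cont: "continuous_on E w"
  using w_jet has_jet_isCont continuous_at_imp_continuous_on by blast

lemma w_cont_snd: "S \<subseteq> T \<times> E \<Longrightarrow> continuous_on S (\<lambda>p. w (snd p))"
  by (rule continuous_on_compose2[OF w_cont continuous_on_snd[OF continuous_on_id]]) auto

lemma h_cont_on: "0 \<le> t1 \<Longrightarrow> continuous_on ({t1..t2} \<times> E) (\<lambda>p. h (fst p) (snd p))"
  using h_cont by (auto simp: case_prod_unfold intro: continuous_on_subset)

text \<open>A negative value forces, by nonnegativity outside the compact set \<open>S\<close>, a
  global negative minimum at a time after \<open>t1\<close>. The differential inequality enters as
  \<open>contra\<close>, so that each application can exploit the vanishing gradient in its own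
  nonlinear way.\<close>

lemma parabolic_min_principle:
  fixes f :: "real \<Rightarrow> real ^ 'd \<Rightarrow> real"
  assumes S: "compact S" "S \<subseteq> E"
    and cont: "continuous_on ({t1..t2} \<times> E) (\<lambda>p. f (fst p) (snd p))"
    and outside: "\<And>t x. t \<in> {t1..t2} \<Longrightarrow> x \<in> E - S \<Longrightarrow> 0 \<le> f t x"
    and initial: "\<And>x. x \<in> E \<Longrightarrow> 0 \<le> f t1 x"
    and jet: "\<And>t x. t1 < t \<Longrightarrow> t \<le> t2 \<Longrightarrow> x \<in> E \<Longrightarrow> has_jet (f t) x (P t x) (H t x)"
    and deriv: "\<And>t x. t1 < t \<Longrightarrow> t \<le> t2 \<Longrightarrow> x \<in> E \<Longrightarrow>
      ((\<lambda>s. f s x) has_real_derivative D t x) (at t)"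
    and contra: "\<And>t x. t1 < t \<Longrightarrow> t \<le> t2 \<Longrightarrow> x \<in> E \<Longrightarrow> f t x < 0 \<Longrightarrow> P t x = 0 \<Longrightarrow>
      0 \<le> mdot (A x) (H t x) \<Longrightarrow> D t x \<le> 0 \<Longrightarrow> False"
    and tx: "t \<in> {t1..t2}" "x \<in> E"
  shows "0 \<le> f t x"
proof (rule ccontr)
  assume neg: "\<not> 0 \<le> f t x"
  then have "x \<in> S" using outside tx by (meson DiffI)
  have "compact ({t1..t2} \<times> S)" using S by (simp add: compact_Times)
  moreover have "continuous_on ({t1..t2} \<times> S) (\<lambda>p. f (fst p) (snd p))"
    using cont by (rule continuous_on_subset) (use S in auto)
  moreover have "{t1..t2} \<times> S \<noteq> {}" using \<open>x \<in> S\<close> tx by auto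
  ultimately have "\<exists>p\<in>{t1..t2} \<times> S. \<forall>q\<in>{t1..t2} \<times> S. f (fst p) (snd p) \<le> f (fst q) (snd q)"
    by (intro continuous_attains_inf)
  then obtain p where p: "p \<in> {t1..t2} \<times> S"
      "\<And>q. q \<in> {t1..t2} \<times> S \<Longrightarrow> f (fst p) (snd p) \<le> f (fst q) (snd q)"
    by metis
  define s y where "s = fst p" and "y = snd p"
  have sy: "s \<in> {t1..t2}" "y \<in> S" using p(1) by (auto simp: s_def y_def)
  have yE: "y \<in> E" using sy S by auto
  have "f s y \<le> f t x" using p(2)[of "(t, x)"] tx \<open>x \<in> S\<close> by (simp add: s_def y_def)
  then have fneg: "f s y < 0" using neg by simp
  have min: "f s y \<le> f r z" if "r \<in> {t1..t2}" "z \<in> E" for r z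
  proof (cases "z \<in> S")
    case True
    then show ?thesis using p(2)[of "(r, z)"] that by (simp add: s_def y_def)
  next
    case False
    then show ?thesis using outside[of r z] that fneg by auto
  qed
  have "s \<noteq> t1" using initial[OF yE] fneg by auto
  then have s: "t1 < s" "s \<le> t2" using sy by auto
  have "\<forall>\<^sub>F z in nhds y. f s y \<le> f s z"
    using eventually_nhds_in_open[OF open_E yE] by eventually_elim (use min sy in auto)
  note J = jet_at_min[OF jet[OF s yE] this]
  have "0 \<le> mdot (A y) (H s y)"
    by (rule mdot_nonneg[OF A_sym[OF yE] quad_A_nonneg[OF yE] J(2)])
  moreover have "\<forall>\<^sub>F r in at_left s. f s y \<le> f r y"
    using eventually_at_left_real[OF s(1)] by eventually_elim (use min yE s in auto)
  then have "D s y \<le> 0"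
    by (rule derivative_nonpos_at_past_min[OF deriv[OF s yE]])
  ultimately show False using contra[OF s yE fneg J(1)] by blast
qed

text \<open>In \<open>t\<close> this solves y' = C - al * y with value \<open>w x\<close> at time
  \<open>t1\<close>, so by \<open>w_super\<close> it is a supersolution of the quadratic equation:
  the initial profile is forgotten exponentially, at the bounded cost \<open>C / al\<close>.\<close>

definition barrier :: "real \<Rightarrow> real \<Rightarrow> real ^ 'd \<Rightarrow> real" where
  "barrier t1 t x = exp (- al * (t - t1)) * w x + C / al * (1 - exp (- al * (t - t1)))"

lemma barrier_le: "t1 \<le> t \<Longrightarrow> barrier t1 t x \<le> exp (- al * (t - t1)) * w x + C / al"
  using C_nonneg al_pos by (simp add: barrier_def divide_right_mono mult_left_le)

lemma barrier_nonneg: "t1 \<le> t \<Longrightarrow> x \<in> E \<Longrightarrow> 0 \<le> barrier t1 t x"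
  using C_nonneg al_pos w_nonneg by (simp add: barrier_def)

lemma barrier_jet:
  "x \<in> E \<Longrightarrow> has_jet (barrier t1 t) x (exp (- al * (t - t1)) *\<^sub>R grad w x)
     (exp (- al * (t - t1)) *\<^sub>R hess w x)"
  unfolding barrier_def
  using has_jet_add[OF has_jet_scale[OF w_jet] has_jet_const] by fastforce

lemma barrier_deriv:
  "((\<lambda>s. barrier t1 s x) has_real_derivative exp (- al * (t - t1)) * (C - al * w x)) (at t)"
  unfolding barrier_def using al_pos
  by (auto intro!: derivative_eq_intros simp: field_simps)

lemma barrier_cont: "continuous_on (T \<times> E) (\<lambda>p. barrier t1 (fst p) (snd p))"
  unfolding barrier_def by (intro continuous_intros w_cont_snd[OF order_refl])

text \<open>In terms of \<open>y = exp (kl * h)\<close> the nonlinearity is \<open>|\<nabla>y|\<^sup>2 / y\<close> with the form of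
  \<open>Ab - kl A \<ge> 0\<close>, which is jointly convex and 1-homogeneous. Sums of supersolutions are therefore
  supersolutions, and \<open>\<epsilon> exp (kl * (w + (C + 1) * t))\<close> can be added to dominate \<open>y\<close> at infinity.\<close>

lemma upper_comparison:
  assumes t1: "0 \<le> t1" and s: "0 \<le> s" "s \<le> 1"
    and init: "\<And>x. x \<in> E \<Longrightarrow> h t1 x \<le> c + s * w x"
    and tx: "t1 \<le> t" "x \<in> E"
  shows "h t x \<le> c + s * barrier t1 t x"
proof -
  define D1 where "D1 r y = c + s * barrier t1 r y - h r y" for r y
  \<comment> \<open>The rate \<open>C + 1\<close> exceeds what \<open>w_super\<close> requires by 1;
    this strictness yields the contradiction at the minimum.\<close>
  define D2 where "D2 r y = w y + (C + 1) * (r - t1) - h r y" for r y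
  have key: "0 \<le> exp (kl * D1 r y) + \<epsilon> * exp (kl * D2 r y) - 1"
    if \<epsilon>: "0 < \<epsilon>" and r: "r \<in> {t1..t}" and y: "y \<in> E" for \<epsilon> r y
  proof -
    \<comment> \<open>Outside this set the term with the second exponential is at least 1 by
      itself.\<close>
    obtain S where S: "compact S" "S \<subseteq> E"
      "\<And>r y. r \<in> {0..t} \<Longrightarrow> y \<in> E - S \<Longrightarrow> - ln \<epsilon> / kl \<le> w y - h r y"
      using w_dominates[of t "- ln \<epsilon> / kl"] by blast
    define p1 where "p1 r y = (s * exp (- al * (r - t1))) *\<^sub>R grad w y - grad (h r) y" for r y
    define H1 where "H1 r y = (s * exp (- al * (r - t1))) *\<^sub>R hess w y - hess (h r) y" for r y
    define p2 where "p2 r y = grad w y - grad (h r) y" for r y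
    define H2 where "H2 r y = hess w y - hess (h r) y" for r y
    define N where "N r y = lop (A y) (b y) (grad (h r) y) (hess (h r) y)
        + quad (Ab y) (grad (h r) y) / 2" for r y
    define d1 where "d1 r y = s * (exp (- al * (r - t1)) * (C - al * w y)) - N r y" for r y
    define d2 where "d2 r y = C + 1 - N r y" for r y
    have j1: "has_jet (D1 r) y (p1 r y) (H1 r y)" if "t1 < r" "y \<in> E" for r y
      unfolding D1_def p1_def H1_def
      using has_jet_diff[OF has_jet_add[OF has_jet_const[of c] has_jet_scale[OF barrier_jet]] h_jet, of y r s t1 r]
        that t1 by simp
    have j2: "has_jet (D2 r) y (p2 r y) (H2 r y)" if "t1 < r" "y \<in> E" for r y
      unfolding D2_def p2_def H2_def
      using has_jet_diff[OF has_jet_add[OF w_jet has_jet_const] h_jet] that t1 by fastforce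
    define a1 a2 where "a1 r y = kl * exp (kl * D1 r y)" and "a2 r y = \<epsilon> * (kl * exp (kl * D2 r y))" for r y
    let ?S = "\<lambda>r y. exp (kl * D1 r y) + \<epsilon> * exp (kl * D2 r y) - 1"
    let ?P = "\<lambda>r y. a1 r y *\<^sub>R p1 r y + a2 r y *\<^sub>R p2 r y"
    let ?H = "\<lambda>r y. a1 r y *\<^sub>R (H1 r y + kl *\<^sub>R outer (p1 r y) (p1 r y))
      + a2 r y *\<^sub>R (H2 r y + kl *\<^sub>R outer (p2 r y) (p2 r y))"
    let ?D = "\<lambda>r y. a1 r y * d1 r y + a2 r y * d2 r y"
    show ?thesis
    proof (rule parabolic_min_principle[where f = ?S and P = ?P and H = ?H and D = ?D and S = S,
          OF S(1,2) _ _ _ _ _ _ r y])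
      show "continuous_on ({t1..t} \<times> E) (\<lambda>p. ?S (fst p) (snd p))"
        unfolding D1_def D2_def
        by (intro continuous_intros barrier_cont h_cont_on t1 w_cont_snd[OF order_refl])
      show "0 \<le> ?S r y" if "r \<in> {t1..t}" "y \<in> E - S" for r y
      proof -
        have "- ln \<epsilon> / kl \<le> w y - h r y" using S(3)[of r y] that t1 by auto
        also have "\<dots> \<le> D2 r y" using that C_nonneg by (simp add: D2_def)
        finally have "- ln \<epsilon> \<le> kl * D2 r y" using kl_pos by (simp add: field_simps)
        then have "exp (- ln \<epsilon>) \<le> exp (kl * D2 r y)" by simp
        then have "\<epsilon> * exp (- ln \<epsilon>) \<le> \<epsilon> * exp (kl * D2 r y)" using \<epsilon> by simp
        then show ?thesis using \<epsilon> by (simp add: exp_minus) (smt (verit) exp_gt_zero)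
      qed
      show "0 \<le> ?S t1 y" if "y \<in> E" for y
      proof -
        have "0 \<le> kl * D1 t1 y" using init[OF that] kl_pos by (simp add: D1_def barrier_def)
        then have "1 \<le> exp (kl * D1 t1 y)" by simp
        moreover have "0 \<le> \<epsilon> * exp (kl * D2 t1 y)" using \<epsilon> by simp
        ultimately show ?thesis by linarith
      qed
      fix r y assume ry: "t1 < r" "r \<le> t" "y \<in> E"
      have r0: "0 < r" using ry t1 by simp
      show "has_jet (?S r) y (?P r y) (?H r y)"
        unfolding a1_def a2_def
        using has_jet_diff[OF has_jet_add[OF has_jet_exp[OF j1[OF ry(1,3)]]
              has_jet_scale[OF has_jet_exp[OF j2[OF ry(1,3)]]]] has_jet_const] by fastforce
      have e1: "((\<lambda>r. D1 r y) has_real_derivative d1 r y) (at r)"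
        unfolding D1_def d1_def N_def
        using h_eq[OF r0 ry(3)] barrier_deriv[of t1 y r] by (auto intro!: derivative_eq_intros)
      have e2: "((\<lambda>r. D2 r y) has_real_derivative d2 r y) (at r)"
        unfolding D2_def d2_def N_def
        using h_eq[OF r0 ry(3)] by (auto intro!: derivative_eq_intros)
      show "((\<lambda>r. ?S r y) has_real_derivative ?D r y) (at r)"
        unfolding a1_def a2_def using e1 e2 by (auto intro!: derivative_eq_intros)
      assume g0: "?P r y = 0" and h0: "0 \<le> mdot (A y) (?H r y)" and d0: "?D r y \<le> 0"
      define \<theta> where "\<theta> = s * exp (- al * (r - t1))"
      have "exp (- al * (r - t1)) \<le> 1" using al_pos ry by (simp add: mult_nonneg_nonpos)
      then have \<theta>: "0 \<le> \<theta>" "\<theta> \<le> 1" using s by (auto simp: \<theta>_def mult_le_one)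
      have c1: "lop (A y) (b y) (p1 r y) (H1 r y) + quad (Ab y) (p1 r y) / 2
          + grad (h r) y \<bullet> (Ab y *v p1 r y) \<le> d1 r y"
      proof -
        have "lop (A y) (b y) (p1 r y) (H1 r y) + quad (Ab y) (p1 r y) / 2
          + grad (h r) y \<bullet> (Ab y *v p1 r y)
          = \<theta> * lop (A y) (b y) (grad w y) (hess w y) + \<theta>\<^sup>2 * quad (Ab y) (grad w y) / 2 - N r y"
          using quad_diff_shift[OF Ab_sym[OF ry(3)], of "\<theta> *\<^sub>R grad w y" "grad (h r) y"]
          unfolding p1_def H1_def \<theta>_def[symmetric] N_def lop_diff lop_scale quad_scale by simp
        \<comment> \<open>Here slopes at most 1 are used: the square of \<theta> is at most
          \<theta>, so \<open>\<theta> * w\<close> inherits the supersolution inequality from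
          \<open>w\<close>.\<close>
        also have "\<theta>\<^sup>2 * quad (Ab y) (grad w y) / 2 \<le> \<theta> * (quad (Ab y) (grad w y) / 2)"
        proof -
          have "0 \<le> quad (Ab y) (grad w y)"
            by (rule quad_Ab_nonneg[OF ry(3)])
          moreover have "\<theta>\<^sup>2 \<le> \<theta>" using \<theta> by (simp add: power2_eq_square mult_left_le)
          ultimately show ?thesis by (simp add: mult_right_mono)
        qed
        also have "\<theta> * lop (A y) (b y) (grad w y) (hess w y) + \<theta> * (quad (Ab y) (grad w y) / 2) - N r y
          \<le> \<theta> * (C - al * w y) - N r y"
          using mult_left_mono[OF w_super[OF ry(3)] \<theta>(1)] by (simp add: algebra_simps)
        finally show ?thesis by (simp add: d1_def \<theta>_def)
      qed
      have c2: "lop (A y) (b y) (p2 r y) (H2 r y) + quad (Ab y) (p2 r y) / 2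
          + grad (h r) y \<bullet> (Ab y *v p2 r y) \<le> d2 r y - 1"
      proof -
        have "lop (A y) (b y) (p2 r y) (H2 r y) + quad (Ab y) (p2 r y) / 2
          + grad (h r) y \<bullet> (Ab y *v p2 r y)
          = lop (A y) (b y) (grad w y) (hess w y) + quad (Ab y) (grad w y) / 2 - N r y"
          using quad_diff_shift[OF Ab_sym[OF ry(3)], of "grad w y" "grad (h r) y"]
          unfolding p2_def H2_def N_def lop_diff by simp
        also have "\<dots> \<le> C - N r y"
          using w_super[OF ry(3)] w_nonneg[OF ry(3)] al_pos
          by (smt (verit) mult_nonneg_nonneg)
        finally show ?thesis by (simp add: d2_def)
      qed
      have a: "0 < a1 r y" "0 < a2 r y" using kl_pos \<epsilon> by (auto simp: a1_def a2_def)
      have "0 \<le> a1 r y * d1 r y + a2 r y * (d2 r y - 1)"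
        by (rule two_exponentials_at_min[OF _ _ g0 h0 kl[OF ry(3)] c1 c2]) (use a in auto)
      then show False using d0 a by (simp add: algebra_simps)
    qed
  qed
  \<comment> \<open>Now \<epsilon> tends to 0 at the fixed point \<open>(t, x)\<close>, where the
    second exponential is a fixed number.\<close>
  have "1 \<le> exp (kl * D1 t x)"
  proof (rule field_le_epsilon)
    fix e :: real assume "0 < e"
    then show "1 \<le> exp (kl * D1 t x) + e"
      using key[of "e / exp (kl * D2 t x)" t x] tx by simp
  qed
  then have "0 \<le> D1 t x" using kl_pos by (simp add: zero_le_mult_iff)
  then show ?thesis by (simp add: D1_def)
qed

text \<open>\<open>exp (kl * h)\<close> is a supersolution of the linear equation because
  \<open>kl * A\<close> is dominated by \<open>Ab\<close>, and \<open>exp (kl * l)\<close> is a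
  subsolution, so their difference can be compared linearly. As \<open>l\<close> is at most
  \<open>c\<close>, the difference is bounded below, and the penalty \<open>\<epsilon> * w\<close>
  controls it at infinity however small \<open>h\<close> becomes there. Any slope works because the
  quadratic term of \<open>- s * w\<close> has the good sign.\<close>

lemma lower_comparison:
  assumes t1: "0 \<le> t1" and s: "0 \<le> s"
    and init: "\<And>x. x \<in> E \<Longrightarrow> c - s * w x \<le> h t1 x"
    and tx: "t1 \<le> t" "x \<in> E"
  shows "c - s * barrier t1 t x \<le> h t x"
proof -
  define l where "l r y = c - s * barrier t1 r y" for r y
  have key: "0 \<le> exp (kl * h r y) - exp (kl * l r y) + \<epsilon> * (w y + (C + 1) * (r - t1))"
    if \<epsilon>: "0 < \<epsilon>" and r: "r \<in> {t1..t}" and y: "y \<in> E" for \<epsilon> r y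
  proof -
    obtain S where S: "compact S" "S \<subseteq> E" "\<And>y. y \<in> E - S \<Longrightarrow> exp (kl * c) / \<epsilon> \<le> w y"
      using w_coercive[of "exp (kl * c) / \<epsilon>"] by blast
    define \<theta> where "\<theta> r = s * exp (- al * (r - t1))" for r
    define p1 where "p1 r y = - (\<theta> r *\<^sub>R grad w y)" for r y
    define H1 where "H1 r y = - (\<theta> r *\<^sub>R hess w y)" for r y
    define N where "N r y = lop (A y) (b y) (grad (h r) y) (hess (h r) y)
        + quad (Ab y) (grad (h r) y) / 2" for r y
    have j1: "has_jet (l r) y (p1 r y) (H1 r y)" if "y \<in> E" for r y
      unfolding l_def p1_def H1_def \<theta>_def
      using has_jet_diff[OF has_jet_const[of c] has_jet_scale[OF barrier_jet[OF that]], of s t1 r]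
      by simp
    define e1 e2 where "e1 r y = kl * exp (kl * h r y)" and "e2 r y = kl * exp (kl * l r y)" for r y
    let ?S = "\<lambda>r y. exp (kl * h r y) - exp (kl * l r y) + \<epsilon> * (w y + (C + 1) * (r - t1))"
    let ?P = "\<lambda>r y. e1 r y *\<^sub>R grad (h r) y - e2 r y *\<^sub>R p1 r y + \<epsilon> *\<^sub>R grad w y"
    let ?H = "\<lambda>r y. e1 r y *\<^sub>R (hess (h r) y + kl *\<^sub>R outer (grad (h r) y) (grad (h r) y))
      - e2 r y *\<^sub>R (H1 r y + kl *\<^sub>R outer (p1 r y) (p1 r y)) + \<epsilon> *\<^sub>R hess w y"
    let ?D = "\<lambda>r y. e1 r y * N r y - e2 r y * (- \<theta> r * (C - al * w y)) + \<epsilon> * (C + 1)"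
    show ?thesis
    proof (rule parabolic_min_principle[where f = ?S and P = ?P and H = ?H and D = ?D and S = S,
          OF S(1,2) _ _ _ _ _ _ r y])
      show "continuous_on ({t1..t} \<times> E) (\<lambda>p. ?S (fst p) (snd p))"
        unfolding l_def
        by (intro continuous_intros barrier_cont h_cont_on t1 w_cont_snd[OF order_refl])
      show "0 \<le> ?S r y"
        if "r \<in> {t1..t}" "y \<in> E - S" for r y
      proof -
        have "l r y \<le> c" using that s barrier_nonneg[of t1 r y] by (simp add: l_def)
        then have "exp (kl * l r y) \<le> exp (kl * c)" using kl_pos by simp
        also have "exp (kl * c) \<le> \<epsilon> * w y" using S(3)[OF that(2)] \<epsilon> by (simp add: field_simps)
        finally have "exp (kl * l r y) \<le> \<epsilon> * w y" .
        moreover have "0 \<le> \<epsilon> * ((C + 1) * (r - t1))" using \<epsilon> C_nonneg that by auto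
        moreover have "0 < exp (kl * h r y)" by simp
        ultimately show ?thesis unfolding distrib_left by linarith
      qed
      show "0 \<le> ?S t1 y" if "y \<in> E" for y
      proof -
        have "l t1 y \<le> h t1 y" using init[OF that] by (simp add: l_def barrier_def)
        then have "exp (kl * l t1 y) \<le> exp (kl * h t1 y)" using kl_pos by simp
        moreover have "0 \<le> \<epsilon> * w y" using \<epsilon> w_nonneg[OF that] by simp
        ultimately show ?thesis by simp
      qed
      fix r y assume ry: "t1 < r" "r \<le> t" "y \<in> E"
      have r0: "0 < r" using ry t1 by simp
      show "has_jet (?S r) y (?P r y) (?H r y)"
        unfolding e1_def e2_def
        using has_jet_add[OF has_jet_diff[OF has_jet_exp[OF h_jet[OF r0 ry(3)]] has_jet_exp[OF j1[OF ry(3)]]]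
            has_jet_scale[OF has_jet_add[OF w_jet[OF ry(3)] has_jet_const]]] by fastforce
      have "((\<lambda>r. l r y) has_real_derivative - \<theta> r * (C - al * w y)) (at r)"
        unfolding l_def \<theta>_def using barrier_deriv[of t1 y r] by (auto intro!: derivative_eq_intros)
      then show "((\<lambda>r. ?S r y) has_real_derivative ?D r y) (at r)"
        unfolding e1_def e2_def N_def using h_eq[OF r0 ry(3)] by (auto intro!: derivative_eq_intros)
      assume g0: "?P r y = 0" and h0: "0 \<le> mdot (A y) (?H r y)" and d0: "?D r y \<le> 0"
      have e: "0 < e1 r y" "0 < e2 r y" using kl_pos by (auto simp: e1_def e2_def)
      define ah aw where "ah = lop (A y) (b y) (grad (h r) y) (hess (h r) y)"
        and "aw = lop (A y) (b y) (grad w y) (hess w y)"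
      have L: "0 \<le> e1 r y * (ah + kl * quad (A y) (grad (h r) y) / 2)
          - e2 r y * (- \<theta> r * aw + kl * quad (A y) (p1 r y) / 2) + \<epsilon> * aw"
      proof -
        have "0 = b y \<bullet> (e1 r y *\<^sub>R grad (h r) y - e2 r y *\<^sub>R p1 r y + \<epsilon> *\<^sub>R grad w y)"
          using g0 by simp
        then have "0 = e1 r y * (b y \<bullet> grad (h r) y) - e2 r y * (b y \<bullet> p1 r y) + \<epsilon> * (b y \<bullet> grad w y)"
          by (simp add: inner_add_right inner_diff_right)
        moreover have "0 \<le> e1 r y * (mdot (A y) (hess (h r) y) + kl * quad (A y) (grad (h r) y))
            - e2 r y * (mdot (A y) (H1 r y) + kl * quad (A y) (p1 r y)) + \<epsilon> * mdot (A y) (hess w y)"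
          using h0 unfolding mdot_add[of _ "_ - _"] mdot_diff mdot_exp_jet by (simp add: mdot_scale mdot_add mdot_outer quad_def)
        moreover have "mdot (A y) (H1 r y) = - \<theta> r * mdot (A y) (hess w y)"
          using mdot_scale[of "A y" "- \<theta> r" "hess w y"] by (simp add: H1_def)
        moreover have "b y \<bullet> p1 r y = - \<theta> r * (b y \<bullet> grad w y)" by (simp add: p1_def)
        ultimately show ?thesis by (simp add: ah_def aw_def lop_def algebra_simps)
      qed
      have Q: "0 \<le> quad (A y) \<xi>" "0 \<le> quad (Ab y) \<xi>" for \<xi>
        using quad_A_nonneg[OF ry(3), of \<xi>] quad_Ab_nonneg[OF ry(3), of \<xi>] by auto
      have "e1 r y * (ah + kl * quad (A y) (grad (h r) y) / 2) \<le> e1 r y * N r y"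
        using kl[OF ry(3)] e by (simp add: N_def ah_def)
      moreover have aw: "aw \<le> C - al * w y"
        using w_super[OF ry(3)] Q(2)[of "grad w y"] by (simp add: aw_def)
      moreover have "e2 r y * (- \<theta> r * (C - al * w y)) \<le> e2 r y * (- \<theta> r * aw + kl * quad (A y) (p1 r y) / 2)"
      proof -
        have "\<theta> r * aw \<le> \<theta> r * (C - al * w y)"
          using aw s by (intro mult_left_mono) (auto simp: \<theta>_def)
        moreover have "0 \<le> kl * quad (A y) (p1 r y) / 2" using Q(1) kl_pos by simp
        ultimately show ?thesis using e by (intro mult_left_mono) auto
      qed
      moreover have "\<epsilon> * aw < \<epsilon> * (C + 1)"
      proof -
        have "aw < C + 1"
          using aw w_nonneg[OF ry(3)] al_pos by (smt (verit) mult_nonneg_nonneg)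
        then show ?thesis using \<epsilon> by simp
      qed
      ultimately show False
        using L d0 by linarith
    qed
  qed
  have "exp (kl * l t x) \<le> exp (kl * h t x)"
  proof (rule field_le_epsilon)
    fix e :: real assume e: "0 < e"
    have pos: "0 < w x + (C + 1) * (t - t1) + 1"
      using w_nonneg[OF tx(2)] C_nonneg tx by (simp add: add_nonneg_pos)
    have "e / (w x + (C + 1) * (t - t1) + 1) * (w x + (C + 1) * (t - t1)) \<le> e"
      using pos e by (simp add: field_simps)
    then show "exp (kl * l t x) \<le> exp (kl * h t x) + e"
      using key[of "e / (w x + (C + 1) * (t - t1) + 1)" t x] tx e pos
      by simp
  qed
  then show ?thesis using kl_pos by (simp add: l_def)
qed

end

section \<open>Propagation of positivity\<close>

context quadratic_flow
begin

text \<open>Supersolutions of the linear equation for \<open>lop\<close>. The jets are existential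
  so that nonlinear transforms of \<open>h\<close> can be inserted with the jets that the chain rule
  gives.\<close>

definition supersolution :: "real \<Rightarrow> real \<Rightarrow> (real \<Rightarrow> real ^ 'd \<Rightarrow> real) \<Rightarrow> bool" where
  "supersolution t1 t2 z \<longleftrightarrow> continuous_on ({t1..t2} \<times> E) (\<lambda>p. z (fst p) (snd p)) \<and>
     (\<forall>s y. t1 < s \<longrightarrow> s \<le> t2 \<longrightarrow> y \<in> E \<longrightarrow> (\<exists>p H d. has_jet (z s) y p H \<and>
        ((\<lambda>s. z s y) has_real_derivative d) (at s) \<and> lop (A y) (b y) p H \<le> d))"

lemma trace_bounded:
  assumes "compact S" "S \<subseteq> E"
  obtains T where "0 \<le> T" "\<And>x. x \<in> S \<Longrightarrow> trace (A x) \<le> T"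
proof -
  obtain l where l: "0 \<le> l" "\<And>x \<xi> \<zeta>. x \<in> S \<Longrightarrow> \<bar>\<xi> \<bullet> (A x *v \<zeta>)\<bar> \<le> l * (norm \<xi> * norm \<zeta>)"
    using A_bounded[OF assms] unfolding form_bounded_on_def by blast
  have "trace (A x) \<le> (\<Sum>i\<in>(UNIV::'d set). l)" if "x \<in> S" for x
    unfolding trace_def
  proof (rule sum_mono)
    fix i
    have "A x $ i $ i = axis i 1 \<bullet> (A x *v axis i 1)"
      by (simp add: inner_axis' matrix_vector_mult_basis column_def)
    also have "\<dots> \<le> l" using l(2)[OF that, of "axis i 1" "axis i 1"] by simp
    finally show "A x $ i $ i \<le> l" .
  qed
  then show ?thesis by (rule that[rotated]) (use l(1) in \<open>auto intro: sum_nonneg\<close>)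
qed

text \<open>Completing the square: \<open>B\<close> is twice the value at which the discriminant
  vanishes.\<close>

lemma moving_ball_barrier:
  fixes q B M a :: real
  assumes "0 < a" "B = M\<^sup>2 / (8 * a)"
  shows "0 < B * q\<^sup>2 - M * q + 4 * a"
proof -
  have "B * q\<^sup>2 - M * q + 4 * a = ((M * q - 4 * a)\<^sup>2 + 16 * a\<^sup>2) / (8 * a)"
    using assms by (simp add: field_simps power2_eq_square)
  moreover have "0 < (M * q - 4 * a)\<^sup>2 + 16 * a\<^sup>2"
    using assms by (simp add: add_nonneg_pos)
  ultimately show ?thesis using assms by simp
qed

text \<open>The barrier is \<open>exp (- B * s) * (\<rho>\<^sup>2 - |y - c s|\<^sup>2)\<^sup>2\<close> in a ball whose centre \<open>c s\<close> moves from \<open>x0\<close>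
  to \<open>x\<close> in unit time; the choice of \<open>B\<close> makes it a strict subsolution.\<close>

lemma positivity_propagation:
  assumes K: "compact K" "K \<subseteq> E" and r: "0 < r"
  shows "\<exists>\<Omega> \<eta>. compact \<Omega> \<and> \<Omega> \<subseteq> E \<and> 0 < \<eta> \<and> \<eta> \<le> 1 \<and>
    (\<forall>z t. supersolution t (t + 1) z \<longrightarrow> (\<forall>s\<in>{t..t+1}. \<forall>y\<in>\<Omega>. 0 \<le> z s y) \<longrightarrow>
       (\<forall>y\<in>cball x0 r. 1 \<le> z t y) \<longrightarrow> (\<forall>x\<in>K. \<eta> \<le> z (t + 1) x))"
proof -
  \<comment> \<open>The union of the segments from \<open>x0\<close> to the points of
    \<open>K\<close>, compact and, by star-shapedness, inside \<open>E\<close>.\<close>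
  define K' where "K' = (\<lambda>p. x0 + fst p *\<^sub>R (snd p - x0)) ` ({0..1} \<times> K)"
  have "compact K'" unfolding K'_def
    by (intro compact_continuous_image compact_Times compact_Icc K continuous_intros)
  moreover have "K' \<subseteq> E"
  proof -
    have "x0 + s *\<^sub>R (x - x0) \<in> E" if "s \<in> {0..1}" "x \<in> K" for s x
    proof -
      have "x0 + s *\<^sub>R (x - x0) = (1 - s) *\<^sub>R x0 + s *\<^sub>R x" by (simp add: algebra_simps)
      then have "x0 + s *\<^sub>R (x - x0) \<in> closed_segment x0 x"
        using that(1) by (auto simp: closed_segment_def)
      then show ?thesis using star that(2) K by (auto simp: star_shaped_at_def)
    qed
    then show ?thesis by (auto simp: K'_def)
  qed
  ultimately obtain e where e: "0 < e" "(\<Union>x\<in>K'. cball x e) \<subseteq> E"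
    using compact_subset_open_imp_cball_epsilon_subset[OF _ open_E] by blast
  define \<rho> where "\<rho> = min e r"
  have \<rho>: "0 < \<rho>" "\<rho> \<le> r" "\<rho> \<le> e" using e r by (auto simp: \<rho>_def)
  \<comment> \<open>A tube of radius \<rho> around these segments. All moving balls stay in it, so
    the coefficient bounds are uniform in the target point and in time.\<close>
  define \<Omega> where "\<Omega> = (\<lambda>p. fst p + snd p) ` (K' \<times> cball 0 \<rho>)"
  have \<Omega>c: "compact \<Omega>" unfolding \<Omega>_def
    by (intro compact_continuous_image compact_Times \<open>compact K'\<close> compact_cball continuous_intros)
  have \<Omega>E: "\<Omega> \<subseteq> E"
  proof
    fix y assume "y \<in> \<Omega>"
    then obtain k \<xi> where k: "k \<in> K'" "norm \<xi> \<le> \<rho>" "y = k + \<xi>" by (auto simp: \<Omega>_def)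
    then have "y \<in> cball k e" using \<rho> by (simp add: dist_norm)
    then show "y \<in> E" using e k by blast
  qed
  obtain c0 where c0: "0 < c0" "\<And>x \<xi>. x \<in> \<Omega> \<Longrightarrow> c0 * (norm \<xi>)\<^sup>2 \<le> quad (A x) \<xi>"
    using elliptic[OF \<Omega>c \<Omega>E] by blast
  obtain \<beta> where \<beta>: "0 \<le> \<beta>" "\<And>x. x \<in> \<Omega> \<Longrightarrow> norm (b x) \<le> \<beta>"
    using b_bounded[OF \<Omega>c \<Omega>E] by blast
  obtain T where T: "0 \<le> T" "\<And>x. x \<in> \<Omega> \<Longrightarrow> trace (A x) \<le> T"
    using trace_bounded[OF \<Omega>c \<Omega>E] by blast
  have "bounded K" by (rule compact_imp_bounded[OF K(1)])
  then obtain d1 where d1: "\<And>x. x \<in> K \<Longrightarrow> dist x0 x \<le> d1"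
    unfolding bounded_any_center[where a = x0] by blast
  define d0 where "d0 = max 0 d1"
  have d0: "0 \<le> d0" "\<And>x. x \<in> K \<Longrightarrow> norm (x - x0) \<le> d0"
    using d1 by (force simp: d0_def dist_norm norm_minus_commute)+
  \<comment> \<open>\<open>M\<close> collects the coefficients of \<open>q\<close> in the
    subsolution inequality: motion of the centre, trace term, drift, and the ellipticity lost
    through c0 * |\<xi>|^2 = c0 * (\<rho>^2 - q).\<close>
  define M where "M = 4 * \<rho> * d0 + 2 * T + 4 * \<beta> * \<rho> + 4 * c0"
  define B where "B = M\<^sup>2 / (8 * (c0 * \<rho>\<^sup>2))"
  show ?thesis
  proof (rule exI[of _ \<Omega>], rule exI[of _ "exp (- B)"], intro conjI \<Omega>c \<Omega>E allI impI ballI)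
    have "0 \<le> B" using c0 by (simp add: B_def)
    then show "exp (- B) \<le> 1" by simp
    fix z t x
    assume super: "supersolution t (t + 1) z"
      and nonneg': "\<forall>s\<in>{t..t+1}. \<forall>y\<in>\<Omega>. 0 \<le> z s y"
      and init': "\<forall>y\<in>cball x0 r. 1 \<le> z t y" and x: "x \<in> K"
    note nonneg = nonneg'[rule_format] and init = init'[rule_format]
    define c where "c s = x0 + (s - t) *\<^sub>R (x - x0)" for s
    define q where "q s y = \<rho>\<^sup>2 - (norm (y - c s))\<^sup>2" for s y
    define \<phi> where "\<phi> s y = exp (- B * (s - t)) * (q s y)\<^sup>2" for s y
    \<comment> \<open>Normalized so that the subtracted barrier is at most 1 at time
      \<open>t\<close> and equals \<open>exp (- B)\<close> at the centre at time
      \<open>t + 1\<close>.\<close>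
    define S where "S s y = z s y - 1 / \<rho>^4 * \<phi> s y" for s y
    have c_in: "c s + \<xi> \<in> \<Omega>" if "s \<in> {t..t+1}" "norm \<xi> \<le> \<rho>" for s \<xi>
    proof -
      have "c s \<in> K'"
        unfolding c_def K'_def using that x by (intro image_eqI[of _ _ "(s - t, x)"]) auto
      then show ?thesis using that by (auto simp: \<Omega>_def intro!: image_eqI[of _ _ "(c s, \<xi>)"])
    qed
    show "exp (- B) \<le> z (t + 1) x"
    proof (rule ccontr)
      assume "\<not> exp (- B) \<le> z (t + 1) x"
      moreover have "q (t + 1) x = \<rho>\<^sup>2" by (simp add: q_def c_def)
      then have "\<phi> (t + 1) x = exp (- B) * \<rho>^4" by (simp add: \<phi>_def)
      ultimately have Sx: "S (t + 1) (c (t + 1) + 0) < 0"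
        using \<rho> by (simp add: S_def c_def)
      \<comment> \<open>The minimum is sought in the moving frame, over offsets from the centre,
        which turns the moving ball into a fixed compact cylinder.\<close>
      have cont: "continuous_on ({t..t+1} \<times> cball 0 \<rho>) (\<lambda>p. S (fst p) (c (fst p) + snd p))"
      proof -
        have "continuous_on ({t..t+1} \<times> cball 0 \<rho>) (\<lambda>p. z (fst (fst p, c (fst p) + snd p)) (snd (fst p, c (fst p) + snd p)))"
        proof (rule continuous_on_compose2[where g = "\<lambda>p. z (fst p) (snd p)"])
          show "continuous_on ({t..t+1} \<times> E) (\<lambda>p. z (fst p) (snd p))"
            using super by (simp add: supersolution_def)
          show "continuous_on ({t..t+1} \<times> cball 0 \<rho>) (\<lambda>p. (fst p, c (fst p) + snd p))"
            unfolding c_def by (intro continuous_intros)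
          show "(\<lambda>p. (fst p, c (fst p) + snd p)) ` ({t..t+1} \<times> cball 0 \<rho>) \<subseteq> {t..t+1} \<times> E"
            using c_in \<Omega>E by auto
        qed
        then show ?thesis unfolding S_def \<phi>_def q_def c_def
          by (intro continuous_intros) simp
      qed
      have "\<exists>p\<in>{t..t+1} \<times> cball 0 \<rho>. \<forall>q\<in>{t..t+1} \<times> cball 0 \<rho>.
          S (fst p) (c (fst p) + snd p) \<le> S (fst q) (c (fst q) + snd q)"
        using \<rho> by (intro continuous_attains_inf cont compact_Times compact_Icc compact_cball) auto
      then obtain s \<xi> where s: "s \<in> {t..t+1}" and \<xi>: "norm \<xi> \<le> \<rho>"
        and min: "\<And>s' \<xi>'. s' \<in> {t..t+1} \<Longrightarrow> norm \<xi>' \<le> \<rho> \<Longrightarrow> S s (c s + \<xi>) \<le> S s' (c s' + \<xi>')"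
        by auto
      define y where "y = c s + \<xi>"
      have y\<Omega>: "y \<in> \<Omega>" using c_in[OF s \<xi>] by (simp add: y_def)
      then have yE: "y \<in> E" using \<Omega>E by blast
      have Sy: "S s y < 0" using min[of "t + 1" 0] Sx \<rho> by (simp add: y_def)
      have qy: "q s y = \<rho>\<^sup>2 - (norm \<xi>)\<^sup>2" by (simp add: q_def y_def)
      \<comment> \<open>On the lateral boundary the barrier vanishes while \<open>z\<close> is
        nonnegative, so a negative minimum lies inside.\<close>
      have \<xi>': "norm \<xi> < \<rho>"
      proof (rule ccontr)
        assume "\<not> norm \<xi> < \<rho>"
        then have "q s y = 0" using \<xi> qy by simp
        then have "S s y = z s y" by (simp add: S_def \<phi>_def)
        then show False using nonneg[OF s y\<Omega>] Sy by simp
      qed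
      have q0: "0 < q s y" "q s y \<le> \<rho>\<^sup>2"
        using \<xi>' qy \<rho> by (auto simp: power_strict_mono)
      have "s \<noteq> t"
      proof
        assume "s = t"
        then have "y \<in> cball x0 r" using \<xi> \<rho> by (simp add: y_def c_def dist_norm)
        then have "1 \<le> z s y" using init \<open>s = t\<close> by simp
        moreover have "(q s y)\<^sup>2 \<le> (\<rho>\<^sup>2)\<^sup>2" using q0 by (intro power_mono) auto
        then have "\<phi> s y \<le> \<rho>^4" using \<open>s = t\<close> by (simp add: \<phi>_def)
        then have "1 / \<rho>^4 * \<phi> s y \<le> 1" using \<rho> by (simp add: field_simps)
        ultimately show False using Sy by (simp add: S_def)
      qed
      then have ts: "t < s" "s \<le> t + 1" using s by auto
      obtain p H d where z: "has_jet (z s) y p H" "((\<lambda>s. z s y) has_real_derivative d) (at s)"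
          "lop (A y) (b y) p H \<le> d"
        using super ts yE unfolding supersolution_def by blast
      define e\<phi> where "e\<phi> = exp (- B * (s - t))"
      define p\<phi> where "p\<phi> = e\<phi> *\<^sub>R ((2 * q s y) *\<^sub>R (- (2 *\<^sub>R \<xi>)))"
      define H\<phi> where "H\<phi> = e\<phi> *\<^sub>R ((2 * q s y) *\<^sub>R (- (2 *\<^sub>R mat 1)) + 2 *\<^sub>R outer (- (2 *\<^sub>R \<xi>)) (- (2 *\<^sub>R \<xi>)))"
      define d\<phi> where "d\<phi> = e\<phi> * (- B * (q s y)\<^sup>2 + 4 * q s y * (\<xi> \<bullet> (x - x0)))"
      have yc: "y - c s = \<xi>" by (simp add: y_def)
      have jq: "has_jet (q s) y (- (2 *\<^sub>R \<xi>)) (- (2 *\<^sub>R mat 1))"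
        using has_jet_diff[OF has_jet_const has_jet_dist_sq, of "\<rho>\<^sup>2" "c s" y]
        by (simp add: yc q_def[abs_def])
      have "has_jet (\<lambda>y. (q s y)\<^sup>2) y ((2 * q s y) *\<^sub>R (- (2 *\<^sub>R \<xi>)))
          ((2 * q s y) *\<^sub>R (- (2 *\<^sub>R mat 1)) + 2 *\<^sub>R outer (- (2 *\<^sub>R \<xi>)) (- (2 *\<^sub>R \<xi>)))"
        by (rule has_jet_compose[OF jq, of "\<lambda>s. s\<^sup>2" "\<lambda>s. 2 * s" 2])
          (auto intro!: always_eventually derivative_eq_intros)
      then have j\<phi>: "has_jet (\<phi> s) y p\<phi> H\<phi>"
        unfolding \<phi>_def p\<phi>_def H\<phi>_def e\<phi>_def by (rule has_jet_scale)
      have jS: "has_jet (S s) y (p - (1 / \<rho>^4) *\<^sub>R p\<phi>) (H - (1 / \<rho>^4) *\<^sub>R H\<phi>)"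
        unfolding S_def by (rule has_jet_diff[OF z(1) has_jet_scale[OF j\<phi>]])
      define v where "v = x - x0"
      have "y - c s' = \<xi> - (s' - s) *\<^sub>R v" for s'
        unfolding yc[symmetric] c_def v_def by (simp add: algebra_simps)
      then have "(norm (y - c s'))\<^sup>2 = \<xi> \<bullet> \<xi> - 2 * (s' - s) * (\<xi> \<bullet> v) + (s' - s)\<^sup>2 * (v \<bullet> v)" for s'
        by (simp only: power2_norm_eq_inner)
          (simp add: inner_diff_left inner_diff_right inner_commute[of v \<xi>] power2_eq_square
            algebra_simps)
      then have "((\<lambda>s. (norm (y - c s))\<^sup>2) has_real_derivative - 2 * (\<xi> \<bullet> (x - x0))) (at s)"
        unfolding v_def by (auto intro!: derivative_eq_intros)
      then have "((\<lambda>s. q s y) has_real_derivative 2 * (\<xi> \<bullet> (x - x0))) (at s)"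
        unfolding q_def using DERIV_diff[OF DERIV_const[of "\<rho>\<^sup>2"]] by fastforce
      then have "((\<lambda>s. \<phi> s y) has_real_derivative d\<phi>) (at s)"
        unfolding \<phi>_def d\<phi>_def e\<phi>_def
        by (auto intro!: derivative_eq_intros simp: algebra_simps power2_eq_square)
      then have dS: "((\<lambda>s. S s y) has_real_derivative d - 1 / \<rho>^4 * d\<phi>) (at s)"
        unfolding S_def using z(2) by (intro DERIV_diff DERIV_cmult)
      have "\<forall>\<^sub>F y' in nhds y. norm (y' - c s) < \<rho>"
      proof -
        have "y \<in> ball (c s) \<rho>" using \<xi>' yc by (simp add: dist_norm norm_minus_commute)
        from eventually_nhds_in_open[OF open_ball this] show ?thesis
          by eventually_elim (simp add: dist_norm norm_minus_commute)
      qed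
      then have "\<forall>\<^sub>F y' in nhds y. S s y \<le> S s y'"
      proof eventually_elim
        case (elim y')
        then show ?case using min[OF s, of "y' - c s"] by (simp add: y_def)
      qed
      note J = jet_at_min[OF jS this]
      have mdot0: "0 \<le> mdot (A y) (H - (1 / \<rho>^4) *\<^sub>R H\<phi>)"
        by (rule mdot_nonneg[OF A_sym[OF yE] quad_A_nonneg[OF yE] J(2)])
      have "((\<lambda>s'. norm (y - c s')) \<longlongrightarrow> norm (y - c s)) (at_left s)"
        unfolding c_def by (intro tendsto_intros)
      then have "\<forall>\<^sub>F s' in at_left s. norm (y - c s') < \<rho>"
        by (rule order_tendstoD) (simp add: yc \<xi>')
      then have "\<forall>\<^sub>F s' in at_left s. S s y \<le> S s' y"
        using eventually_at_left_real[OF ts(1)]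
      proof eventually_elim
        case (elim s')
        then show ?case using min[of s' "y - c s'"] s by (simp add: y_def)
      qed
      then have dneg: "d - 1 / \<rho>^4 * d\<phi> \<le> 0"
        by (rule derivative_nonpos_at_past_min[OF dS])
      have lopS: "0 \<le> lop (A y) (b y) p H - 1 / \<rho>^4 * lop (A y) (b y) p\<phi> H\<phi>"
        using mdot0 unfolding lop_scale[symmetric] lop_diff[symmetric] J(1) by (simp add: lop_def)
      have "d\<phi> < lop (A y) (b y) p\<phi> H\<phi>"
      proof -
        have tr: "trace (A y) \<le> T" and bb: "norm (b y) \<le> \<beta>" using T \<beta> y\<Omega> by auto
        have "mdot (A y) ((2 * q s y) *\<^sub>R (- (2 *\<^sub>R mat 1)) + 2 *\<^sub>R outer (- (2 *\<^sub>R \<xi>)) (- (2 *\<^sub>R \<xi>)))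
            = - 4 * q s y * trace (A y) + 8 * quad (A y) \<xi>"
        proof -
          have "mdot (A y) (- (2 *\<^sub>R mat 1)) = - 2 * trace (A y)"
            using mdot_scale[of "A y" "-2" "mat 1"] by (simp add: mdot_mat_1)
          then show ?thesis
            unfolding mdot_add mdot_scale mdot_outer quad_def
            by (simp add: matrix_vector_mult_scaleR linear_neg[OF matrix_vector_mul_linear])
        qed
        then have L: "lop (A y) (b y) p\<phi> H\<phi> = e\<phi> * (- 2 * q s y * trace (A y) + 4 * quad (A y) \<xi>
            - 4 * q s y * (b y \<bullet> \<xi>))"
          unfolding p\<phi>_def H\<phi>_def lop_scale by (simp add: lop_def)
        have "\<xi> \<bullet> (x - x0) \<le> \<rho> * d0"
          using norm_cauchy_schwarz[of \<xi> "x - x0"] mult_mono[OF \<xi> d0(2)[OF x]] \<rho>(1) by simp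
        then have 1: "q s y * (\<xi> \<bullet> (x - x0)) \<le> q s y * (\<rho> * d0)"
          using q0 by simp
        have "b y \<bullet> \<xi> \<le> \<beta> * \<rho>"
          using norm_cauchy_schwarz[of "b y" \<xi>] mult_mono[OF bb \<xi> \<beta>(1)] by simp
        then have 2: "q s y * (b y \<bullet> \<xi>) \<le> q s y * (\<beta> * \<rho>)" using q0 by simp
        have 3: "q s y * trace (A y) \<le> q s y * T" using tr q0 by simp
        have 4: "c0 * (\<rho>\<^sup>2 - q s y) \<le> quad (A y) \<xi>" using c0(2)[OF y\<Omega>, of \<xi>] qy by simp
        have "0 < B * (q s y)\<^sup>2 - M * q s y + 4 * (c0 * \<rho>\<^sup>2)"
          by (rule moving_ball_barrier) (use c0 \<rho> in \<open>auto simp: B_def\<close>)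
        then have "- B * (q s y)\<^sup>2 + 4 * q s y * (\<xi> \<bullet> (x - x0)) < - 2 * q s y * trace (A y) + 4 * quad (A y) \<xi>
            - 4 * q s y * (b y \<bullet> \<xi>)"
          using 1 2 3 4 by (simp add: M_def algebra_simps)
        then show ?thesis unfolding L d\<phi>_def by (simp add: e\<phi>_def)
      qed
      then have "1 / \<rho>^4 * d\<phi> < 1 / \<rho>^4 * lop (A y) (b y) p\<phi> H\<phi>"
        using \<rho> by (intro mult_strict_left_mono) auto
      then show False using lopS dneg z(3) by linarith
    qed
  qed simp
qed

end

section \<open>Interior Lipschitz estimate\<close>

lemma has_jet_norm:
  fixes z :: "real ^ 'd"
  assumes "z \<noteq> 0"
  shows "has_jet norm z ((1 / norm z) *\<^sub>R z)
    ((1 / norm z) *\<^sub>R mat 1 - (1 / norm z ^ 3) *\<^sub>R outer z z)"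
proof -
  have n: "0 < norm z" using assms by simp
  have "has_jet (\<lambda>y. sqrt ((norm (y - 0))\<^sup>2)) z
     ((1 / (2 * sqrt ((norm (z - 0))\<^sup>2))) *\<^sub>R (2 *\<^sub>R (z - 0)))
     ((1 / (2 * sqrt ((norm (z - 0))\<^sup>2))) *\<^sub>R (2 *\<^sub>R mat 1)
       + (- (1 / (4 * norm z ^ 3))) *\<^sub>R outer (2 *\<^sub>R (z - 0)) (2 *\<^sub>R (z - 0)))"
  proof (rule has_jet_compose[OF has_jet_dist_sq, where \<Theta>' = "\<lambda>s. 1 / (2 * sqrt s)"])
    have "\<forall>\<^sub>F s in nhds ((norm (z - 0))\<^sup>2). 0 < s"
      using eventually_nhds_in_open[of "{0<..}" "(norm (z - 0))\<^sup>2"] n by auto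
    then show "\<forall>\<^sub>F s in nhds ((norm (z - 0))\<^sup>2). (sqrt has_real_derivative 1 / (2 * sqrt s)) (at s)"
      by eventually_elim (auto intro!: derivative_eq_intros simp: field_simps)
    have "((\<lambda>s. 1 / (2 * sqrt s)) has_real_derivative
        - (1 / (2 * (norm z)\<^sup>2)) * (1 / (2 * norm z))* 1) (at ((norm (z - 0))\<^sup>2))"
      using n by (auto intro!: derivative_eq_intros simp: field_simps power2_eq_square)
    then show "((\<lambda>s. 1 / (2 * sqrt s)) has_real_derivative - (1 / (4 * norm z ^ 3))) (at ((norm (z - 0))\<^sup>2))"
      by (simp add: field_simps power2_eq_square power3_eq_cube)
  qed
  moreover have "outer (2 *\<^sub>R (z - 0)) (2 *\<^sub>R (z - 0)) = 4 *\<^sub>R outer z z"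
    by (simp add: outer_def vec_eq_iff)
  ultimately show ?thesis by simp
qed

text \<open>The maximum in the doubled variables is tested along all lines with direction (\<xi>,
  \<zeta>). As \<open>f\<close> and \<open>g\<close> have classical jets, this replaces the theorem
  on sums of viscosity theory.\<close>

lemma jets_at_doubling_max:
  fixes f g :: "real ^ 'd \<Rightarrow> real"
  assumes f: "has_jet f x p X" and g: "has_jet g y q Y"
    and G: "has_jet G (x - y) \<gamma> Z" and F: "has_jet F x \<phi> W"
    and max: "\<forall>\<^sub>F s in nhds (x, y).
      f (fst s) - g (snd s) - G (fst s - snd s) - F (fst s) \<le> f x - g y - G (x - y) - F x"
  shows "p = \<gamma> + \<phi>" "q = \<gamma>"
    "\<xi> \<bullet> (X *v \<xi>) - \<zeta> \<bullet> (Y *v \<zeta>) - (\<xi> - \<zeta>) \<bullet> (Z *v (\<xi> - \<zeta>)) - \<xi> \<bullet> (W *v \<xi>) \<le> 0"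
proof -
  have *: "p \<bullet> \<xi> - q \<bullet> \<zeta> - \<gamma> \<bullet> (\<xi> - \<zeta>) - \<phi> \<bullet> \<xi> = 0 \<and>
      \<xi> \<bullet> (X *v \<xi>) - \<zeta> \<bullet> (Y *v \<zeta>) - (\<xi> - \<zeta>) \<bullet> (Z *v (\<xi> - \<zeta>)) - \<xi> \<bullet> (W *v \<xi>) \<le> 0" for \<xi> \<zeta>
  proof -
    obtain f' where f': "\<forall>\<^sub>F s in nhds (0::real). ((\<lambda>s. f (x + s *\<^sub>R \<xi>)) has_real_derivative f' s) (at s)"
      "f' 0 = p \<bullet> \<xi>" "(f' has_real_derivative \<xi> \<bullet> (X *v \<xi>)) (at 0)"
      by (rule has_jet_line[OF f])
    obtain g' where g': "\<forall>\<^sub>F s in nhds (0::real). ((\<lambda>s. g (y + s *\<^sub>R \<zeta>)) has_real_derivative g' s) (at s)"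
      "g' 0 = q \<bullet> \<zeta>" "(g' has_real_derivative \<zeta> \<bullet> (Y *v \<zeta>)) (at 0)"
      by (rule has_jet_line[OF g])
    obtain G' where G': "\<forall>\<^sub>F s in nhds (0::real). ((\<lambda>s. G (x - y + s *\<^sub>R (\<xi> - \<zeta>))) has_real_derivative G' s) (at s)"
      "G' 0 = \<gamma> \<bullet> (\<xi> - \<zeta>)" "(G' has_real_derivative (\<xi> - \<zeta>) \<bullet> (Z *v (\<xi> - \<zeta>))) (at 0)"
      by (rule has_jet_line[OF G])
    obtain F' where F': "\<forall>\<^sub>F s in nhds (0::real). ((\<lambda>s. F (x + s *\<^sub>R \<xi>)) has_real_derivative F' s) (at s)"
      "F' 0 = \<phi> \<bullet> \<xi>" "(F' has_real_derivative \<xi> \<bullet> (W *v \<xi>)) (at 0)"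
      by (rule has_jet_line[OF F])
    define L where "L s = g (y + s *\<^sub>R \<zeta>) + G (x - y + s *\<^sub>R (\<xi> - \<zeta>)) + F (x + s *\<^sub>R \<xi>) - f (x + s *\<^sub>R \<xi>)" for s
    have 1: "\<forall>\<^sub>F s in nhds 0. (L has_real_derivative g' s + G' s + F' s - f' s) (at s)"
      using f'(1) g'(1) G'(1) F'(1)
      by eventually_elim (auto simp: L_def[abs_def] intro!: derivative_eq_intros)
    have 2: "((\<lambda>s. g' s + G' s + F' s - f' s) has_real_derivative
        \<zeta> \<bullet> (Y *v \<zeta>) + (\<xi> - \<zeta>) \<bullet> (Z *v (\<xi> - \<zeta>)) + \<xi> \<bullet> (W *v \<xi>) - \<xi> \<bullet> (X *v \<xi>)) (at 0)"
      using f'(3) g'(3) G'(3) F'(3) by (auto intro!: derivative_eq_intros)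
    have "((\<lambda>s. (x + s *\<^sub>R \<xi>, y + s *\<^sub>R \<zeta>)) \<longlongrightarrow> (x + 0 *\<^sub>R \<xi>, y + 0 *\<^sub>R \<zeta>)) (nhds (0::real))"
      by (intro tendsto_intros) (simp_all add: filterlim_ident)
    then have "filterlim (\<lambda>s. (x + s *\<^sub>R \<xi>, y + s *\<^sub>R \<zeta>)) (nhds (x, y)) (nhds (0::real))" by simp
    from eventually_compose_filterlim[OF max this]
    have 3: "\<forall>\<^sub>F s in nhds 0. L 0 \<le> L s"
      by eventually_elim (simp add: L_def algebra_simps)
    show ?thesis
      using second_derivative_nonneg_at_min[OF 1 2 3] f'(2) g'(2) G'(2) F'(2) by linarith
  qed
  have "(p - \<gamma> - \<phi>) \<bullet> (p - \<gamma> - \<phi>) = 0"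
    using *[of "p - \<gamma> - \<phi>" 0] by (simp add: inner_diff_left)
  then have "p - \<gamma> - \<phi> = 0" by (simp only: inner_eq_zero_iff)
  then show "p = \<gamma> + \<phi>" by (simp add: algebra_simps)
  have "(q - \<gamma>) \<bullet> (q - \<gamma>) = 0"
    using conjunct1[OF *[of 0 "q - \<gamma>"]]
    unfolding inner_zero_right diff_0 diff_0_right inner_minus_right inner_diff_left by linarith
  then have "q - \<gamma> = 0" by (simp only: inner_eq_zero_iff)
  then show "q = \<gamma>" by simp
  show "\<xi> \<bullet> (X *v \<xi>) - \<zeta> \<bullet> (Y *v \<zeta>) - (\<xi> - \<zeta>) \<bullet> (Z *v (\<xi> - \<zeta>)) - \<xi> \<bullet> (W *v \<xi>) \<le> 0"
    using * by blast
qed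

section \<open>Coupling of two diffusion matrices\<close>

lemma sum_UNIV_sum_type:
  fixes f :: "'a::finite + 'b::finite \<Rightarrow> real"
  shows "(\<Sum>k\<in>UNIV. f k) = (\<Sum>i\<in>UNIV. f (Inl i)) + (\<Sum>i\<in>UNIV. f (Inr i))"
  unfolding UNIV_Plus_UNIV[symmetric] by (subst sum.Plus) auto

text \<open>The arithmetic-geometric mean inequality, to be used with u = |\<xi> + \<zeta>| and d =
  |\<xi> - \<zeta>|; positivity of the coupled block matrix reduces to it.\<close>

lemma young_quadratic_nonneg:
  fixes u d :: real
  assumes "0 \<le> n" "n \<le> lam" "0 \<le> l" "l\<^sup>2 \<le> 4 * lam * n" "0 \<le> u" "0 \<le> d"
  shows "0 \<le> (lam - n / 2) * u\<^sup>2 - l / 2 * (u * d) + n / 2 * d\<^sup>2"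
proof -
  have lam: "0 \<le> lam" using assms by linarith
  have "l \<le> 2 * (sqrt lam * sqrt n)"
  proof (rule power2_le_imp_le)
    show "l\<^sup>2 \<le> (2 * (sqrt lam * sqrt n))\<^sup>2" using assms lam by (simp add: power_mult_distrib)
  qed (use assms lam in auto)
  then have "l / 2 * (u * d) \<le> (sqrt lam * sqrt n) * (u * d)"
    using assms by (intro mult_right_mono) auto
  also have "\<dots> = (sqrt lam * u) * (sqrt n * d)" by simp
  also have "\<dots> \<le> ((sqrt lam * u)\<^sup>2 + (sqrt n * d)\<^sup>2) / 2"
    using sum_squares_bound[of "sqrt lam * u" "sqrt n * d"] by simp
  also have "\<dots> = lam / 2 * u\<^sup>2 + n / 2 * d\<^sup>2"
    using assms lam by (simp add: power_mult_distrib)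
  also have "lam / 2 * u\<^sup>2 \<le> (lam - n / 2) * u\<^sup>2"
    using assms by (intro mult_right_mono) auto
  finally show ?thesis by simp
qed

text \<open>The two diffusion matrices \<open>P\<close> and \<open>Q\<close> are coupled by the positive semidefinite block matrix
  with off-diagonal block \<open>(P + Q) / 2 - n\<close>; this replaces the matrix square roots of the usual
  Ishii-Lions argument.\<close>

lemma coupled_trace_bound:
  fixes P Q X Y Z :: "real ^ 'd ^ 'd"
  assumes sym: "transpose P = P" "transpose Q = Q"
    and ell: "\<And>\<xi>. lam * (norm \<xi>)\<^sup>2 \<le> quad P \<xi>" "\<And>\<xi>. lam * (norm \<xi>)\<^sup>2 \<le> quad Q \<xi>"
    and diff: "\<And>\<xi> \<zeta>. \<bar>\<xi> \<bullet> ((P - Q) *v \<zeta>)\<bar> \<le> l * norm \<xi> * norm \<zeta>"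
    and n: "0 \<le> n" "n \<le> lam" "0 \<le> l" "l\<^sup>2 \<le> 4 * lam * n"
    and max: "\<And>\<xi> \<zeta>. \<xi> \<bullet> (X *v \<xi>) - \<zeta> \<bullet> (Y *v \<zeta>) - (\<xi> - \<zeta>) \<bullet> (Z *v (\<xi> - \<zeta>)) - m * (norm \<xi>)\<^sup>2 \<le> 0"
  shows "mdot P X - mdot Q Y \<le> 2 * n * trace Z + m * trace P"
proof -
  \<comment> \<open>This off-diagonal block gives P + Q - 2 R = 2 n I. The differences
    \<open>\<xi> k - \<zeta> k\<close> of the Gram vectors then sum to a multiple of the identity,
    and \<open>Z\<close> enters through its trace.\<close>
  define R where "R = (1 / 2) *\<^sub>R (P + Q) - n *\<^sub>R mat 1"
  define a :: "'d + 'd \<Rightarrow> 'd + 'd \<Rightarrow> real" where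
    "a i j = (case i of Inl i \<Rightarrow> (case j of Inl j \<Rightarrow> P $ i $ j | Inr j \<Rightarrow> R $ i $ j)
       | Inr i \<Rightarrow> (case j of Inl j \<Rightarrow> R $ i $ j | Inr j \<Rightarrow> Q $ i $ j))" for i j
  have Rsym: "R $ i $ j = R $ j $ i" for i j
    using transpose_eqD[OF sym(1), of i j] transpose_eqD[OF sym(2), of i j] by (simp add: R_def mat_def)
  have "\<exists>v. \<forall>i\<in>UNIV. \<forall>j\<in>UNIV. a i j = (\<Sum>k\<in>(UNIV::('d + 'd) set). v k i * v k j)"
  proof (rule psd_sum_squares)
    show "a i j = a j i" for i j
      using transpose_eqD[OF sym(1)] transpose_eqD[OF sym(2)] Rsym
      by (simp add: a_def split: sum.split)
    fix x :: "'d + 'd \<Rightarrow> real"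
    define \<xi> \<zeta> where "\<xi> = (\<chi> i. x (Inl i))" and "\<zeta> = (\<chi> i. x (Inr i))"
    have "(\<Sum>i\<in>UNIV. \<Sum>j\<in>UNIV. x i * a i j * x j)
        = quad P \<xi> + \<xi> \<bullet> (R *v \<zeta>) + (\<zeta> \<bullet> (R *v \<xi>) + quad Q \<zeta>)"
      unfolding sum_UNIV_sum_type quad_def inner_matrix_vector \<xi>_def \<zeta>_def
      by (simp add: a_def sum.distrib)
    also have "\<dots> = quad P \<xi> + quad Q \<zeta> + \<xi> \<bullet> (P *v \<zeta>) + \<xi> \<bullet> (Q *v \<zeta>) - 2 * n * (\<xi> \<bullet> \<zeta>)"
    proof -
      have R: "R *v v = (1 / 2) *\<^sub>R (P *v v + Q *v v) - n *\<^sub>R v" for v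
        by (simp add: R_def matrix_vector_mult_diff_rdistrib matrix_vector_mult_add_rdistrib
            scaleR_matrix_vector_assoc[symmetric])
      show ?thesis
        using inner_sym_matrix[OF sym(1), of \<zeta> \<xi>] inner_sym_matrix[OF sym(2), of \<zeta> \<xi>]
        unfolding R by (simp add: inner_add_right inner_diff_right inner_commute[of \<zeta> \<xi>])
    qed
    \<comment> \<open>In the variables \<xi> + \<zeta> and \<xi> - \<zeta> the mixed term contains
      only \<open>P - Q\<close>, which is small when the two base points are close.\<close>
    also have "\<dots> = (quad P (\<xi> + \<zeta>) + quad Q (\<xi> + \<zeta>)) / 2 + (\<xi> - \<zeta>) \<bullet> ((P - Q) *v (\<xi> + \<zeta>)) / 2
        + n / 2 * ((norm (\<xi> - \<zeta>))\<^sup>2 - (norm (\<xi> + \<zeta>))\<^sup>2)"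
    proof -
      have 1: "(\<xi> - \<zeta>) \<bullet> ((P - Q) *v (\<xi> + \<zeta>)) = quad P \<xi> - quad P \<zeta> - (quad Q \<xi> - quad Q \<zeta>)"
        using inner_sym_matrix[OF sym(1), of \<zeta> \<xi>] inner_sym_matrix[OF sym(2), of \<zeta> \<xi>]
        by (simp add: quad_def matrix_vector_mult_diff_rdistrib matrix_vector_right_distrib
            inner_add_right inner_diff_left inner_diff_right)
      have 2: "(norm (\<xi> - \<zeta>))\<^sup>2 - (norm (\<xi> + \<zeta>))\<^sup>2 = - 4 * (\<xi> \<bullet> \<zeta>)"
        by (simp add: power2_norm_eq_inner inner_add_left inner_add_right inner_diff_left
            inner_diff_right inner_commute[of \<zeta> \<xi>])
      show ?thesis
        unfolding quad_add[OF sym(1)] quad_add[OF sym(2)] 1 2 by (simp add: field_simps)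
    qed
    also have "\<dots> \<ge> 0"
    proof -
      have "\<bar>(\<xi> - \<zeta>) \<bullet> ((P - Q) *v (\<xi> + \<zeta>))\<bar> \<le> l * norm (\<xi> - \<zeta>) * norm (\<xi> + \<zeta>)"
        by (rule diff)
      moreover have "lam * (norm (\<xi> + \<zeta>))\<^sup>2 \<le> (quad P (\<xi> + \<zeta>) + quad Q (\<xi> + \<zeta>)) / 2"
        using ell[of "\<xi> + \<zeta>"] by simp
      moreover have "0 \<le> (lam - n / 2) * (norm (\<xi> + \<zeta>))\<^sup>2
          - l / 2 * (norm (\<xi> + \<zeta>) * norm (\<xi> - \<zeta>)) + n / 2 * (norm (\<xi> - \<zeta>))\<^sup>2"
        by (rule young_quadratic_nonneg) (use n in auto)
      ultimately show ?thesis
        unfolding left_diff_distrib right_diff_distrib mult.commute[of "norm (\<xi> + \<zeta>)"]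
          mult.assoc abs_le_iff by (auto simp: field_simps)
    qed
    finally show "0 \<le> (\<Sum>i\<in>UNIV. \<Sum>j\<in>UNIV. x i * a i j * x j)" .
  qed simp
  then obtain v where v: "\<And>i j. a i j = (\<Sum>k\<in>(UNIV::('d + 'd) set). v k i * v k j)" by blast
  define \<xi> \<zeta> where "\<xi> k = (\<chi> i. v k (Inl i))" and "\<zeta> k = (\<chi> i. v k (Inr i))" for k
  have P: "P $ i $ j = (\<Sum>k\<in>UNIV. \<xi> k $ i * \<xi> k $ j)" for i j
    using v[of "Inl i" "Inl j"] by (simp add: a_def \<xi>_def)
  have Q: "Q $ i $ j = (\<Sum>k\<in>UNIV. \<zeta> k $ i * \<zeta> k $ j)" for i j
    using v[of "Inr i" "Inr j"] by (simp add: a_def \<zeta>_def)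
  have R1: "R $ i $ j = (\<Sum>k\<in>UNIV. \<xi> k $ i * \<zeta> k $ j)" for i j
    using v[of "Inl i" "Inr j"] by (simp add: a_def \<zeta>_def \<xi>_def)
  have R2: "R $ i $ j = (\<Sum>k\<in>UNIV. \<zeta> k $ i * \<xi> k $ j)" for i j
    using v[of "Inr i" "Inl j"] by (simp add: a_def \<zeta>_def \<xi>_def)
  have I: "((2 * n) *\<^sub>R mat 1 :: real^'d^'d) $ i $ j = (\<Sum>k\<in>UNIV. (\<xi> k - \<zeta> k) $ i * (\<xi> k - \<zeta> k) $ j)" for i j
  proof -
    have "(\<Sum>k\<in>UNIV. (\<xi> k - \<zeta> k) $ i * (\<xi> k - \<zeta> k) $ j) = P $ i $ j - R $ i $ j - R $ i $ j + Q $ i $ j"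
      unfolding P Q by (subst R1, subst R2) (simp add: algebra_simps sum.distrib sum_subtractf)
    then show ?thesis by (simp add: R_def algebra_simps)
  qed
  have "mdot P X - mdot Q Y - mdot ((2 * n) *\<^sub>R mat 1) Z - m * mdot P (mat 1)
      = (\<Sum>k\<in>UNIV. \<xi> k \<bullet> (X *v \<xi> k) - \<zeta> k \<bullet> (Y *v \<zeta> k) - (\<xi> k - \<zeta> k) \<bullet> (Z *v (\<xi> k - \<zeta> k))
          - m * (norm (\<xi> k))\<^sup>2)"
    unfolding sum_outer_mdot[OF P] sum_outer_mdot[OF Q] sum_outer_mdot[OF I]
    by (simp add: sum_subtractf sum_distrib_left power2_norm_eq_inner)
  also have "\<dots> \<le> 0" by (rule sum_nonpos) (rule max)
  also have "mdot ((2 * n) *\<^sub>R mat 1) Z = 2 * n * trace Z"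
    by (simp add: mdot_scale_left) (simp add: mdot_def mat_def trace_def if_distrib[of "\<lambda>x. x * _"] cong: if_cong)
  finally show ?thesis by (simp add: mdot_mat_1)
qed


text \<open>A reflection coupling in direction \<open>e\<close>: the part
  \<open>lam *\<^sub>R outer e e\<close> is removed from both matrices and tested with the opposite
  vectors \<open>e\<close> and \<open>- e\<close>, which yields \<open>4 * lam\<close> times the
  second derivative of the penalty in that direction. Ellipticity \<open>2 * lam\<close> leaves
  \<open>lam\<close> for the remaining matrices.\<close>

lemma coupled_trace_bound_direction:
  fixes P Q X Y Z :: "real ^ 'd ^ 'd"
  assumes sym: "transpose P = P" "transpose Q = Q"
    and lam: "0 \<le> lam" and e: "norm e = 1"
    and ell: "\<And>\<xi>. 2 * lam * (norm \<xi>)\<^sup>2 \<le> quad P \<xi>" "\<And>\<xi>. 2 * lam * (norm \<xi>)\<^sup>2 \<le> quad Q \<xi>"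
    and diff: "\<And>\<xi> \<zeta>. \<bar>\<xi> \<bullet> ((P - Q) *v \<zeta>)\<bar> \<le> l * norm \<xi> * norm \<zeta>"
    and n: "0 \<le> n" "n \<le> lam" "0 \<le> l" "l\<^sup>2 \<le> 4 * lam * n"
    and max: "\<And>\<xi> \<zeta>. \<xi> \<bullet> (X *v \<xi>) - \<zeta> \<bullet> (Y *v \<zeta>) - (\<xi> - \<zeta>) \<bullet> (Z *v (\<xi> - \<zeta>)) - m * (norm \<xi>)\<^sup>2 \<le> 0"
  shows "mdot P X - mdot Q Y \<le> 2 * n * trace Z + 4 * lam * (e \<bullet> (Z *v e)) + m * trace P"
proof -
  define W where "W = lam *\<^sub>R outer e e"
  have We: "\<xi> \<bullet> (W *v \<xi>) = lam * (e \<bullet> \<xi>)\<^sup>2" for \<xi>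
    by (simp add: W_def scaleR_matrix_vector_assoc[symmetric] outer_mult power2_eq_square inner_commute)
  have Wle: "\<xi> \<bullet> (W *v \<xi>) \<le> lam * (norm \<xi>)\<^sup>2" for \<xi>
  proof -
    have "(e \<bullet> \<xi>)\<^sup>2 \<le> (norm \<xi>)\<^sup>2"
      using Cauchy_Schwarz_ineq2[of e \<xi>] e by (simp add: abs_le_square_iff[symmetric])
    then show ?thesis unfolding We using lam by (simp add: mult_left_mono)
  qed
  have tW: "transpose W = W" by (simp add: W_def outer_def transpose_def vec_eq_iff mult.commute)
  have "mdot (P - W) X - mdot (Q - W) Y \<le> 2 * n * trace Z + m * trace (P - W)"
  proof (rule coupled_trace_bound[OF _ _ _ _ _ n max])
    show "transpose (P - W) = P - W" "transpose (Q - W) = Q - W"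
      using sym tW by (simp_all add: transpose_def vec_eq_iff)
    show "lam * (norm \<xi>)\<^sup>2 \<le> quad (P - W) \<xi>" "lam * (norm \<xi>)\<^sup>2 \<le> quad (Q - W) \<xi>" for \<xi>
      using ell[of \<xi>] Wle[of \<xi>]
      by (simp_all add: quad_def matrix_vector_mult_diff_rdistrib inner_diff_right)
    show "\<bar>\<xi> \<bullet> ((P - W - (Q - W)) *v \<zeta>)\<bar> \<le> l * norm \<xi> * norm \<zeta>" for \<xi> \<zeta>
      using diff by simp
  qed
  moreover have "mdot (P - W) X = mdot P X - lam * (e \<bullet> (X *v e))"
    "mdot (Q - W) Y = mdot Q Y - lam * (e \<bullet> (Y *v e))"
    using mdot_add_left[of "P - W" W X] mdot_add_left[of "Q - W" W Y]
    by (simp_all add: W_def mdot_scale_left mdot_outer_left)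
  moreover have "lam * (e \<bullet> (X *v e) - e \<bullet> (Y *v e) - 4 * (e \<bullet> (Z *v e)) - m) \<le> 0"
  proof -
    have "e - - e = 2 *\<^sub>R e" by (simp add: scaleR_2)
    then have "e \<bullet> (X *v e) - e \<bullet> (Y *v e) - 4 * (e \<bullet> (Z *v e)) - m \<le> 0"
      using max[of e "- e"] e
      by (simp add: matrix_vector_mult_scaleR linear_neg[OF matrix_vector_mul_linear])
    then show ?thesis using lam by (rule mult_nonneg_nonpos[rotated])
  qed
  moreover have "trace (P - W) = trace P - lam"
  proof -
    have "trace W = lam * (e \<bullet> e)" by (simp add: W_def trace_def outer_def inner_vec_def sum_distrib_left)
    then show ?thesis using e by (simp add: trace_def sum_subtractf norm_eq_1)
  qed
  ultimately show ?thesis by (simp add: algebra_simps)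
qed

lemma gradient_bound_of_lipschitz:
  fixes f :: "real ^ 'd \<Rightarrow> real"
  assumes "(f has_derivative (\<lambda>\<xi>. p \<bullet> \<xi>)) (at x)" "0 < r"
    and lip: "\<And>y. y \<in> cball x r \<Longrightarrow> \<bar>f y - f x\<bar> \<le> M * norm (y - x)"
  shows "norm p \<le> M"
proof (cases "p = 0")
  case True
  obtain y where "y \<in> cball x r" "y \<noteq> x"
    using vector_choose_dist[of r x] assms(2) by (metis less_imp_le mem_cball dist_eq_0_iff order_refl less_irrefl)
  then have "0 \<le> M * norm (y - x)" "0 < norm (y - x)" using lip[of y] by auto
  then show ?thesis using True by (simp add: zero_le_mult_iff)
next
  case False
  have line: "((\<lambda>s. x + s *\<^sub>R p) has_derivative (\<lambda>s. s *\<^sub>R p)) (at (0::real))"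
    by (auto intro!: derivative_eq_intros)
  have "((\<lambda>s. f (x + s *\<^sub>R p)) has_derivative (\<lambda>s. p \<bullet> (s *\<^sub>R p))) (at 0)"
    using has_derivative_compose[OF line, of f "\<lambda>\<xi>. p \<bullet> \<xi>"] assms(1) by simp
  then have "((\<lambda>s. f (x + s *\<^sub>R p)) has_real_derivative p \<bullet> p) (at 0)"
    by (simp add: has_field_derivative_def mult_commute_abs)
  then have lim: "((\<lambda>s. (f (x + s *\<^sub>R p) - f x) / s) \<longlongrightarrow> p \<bullet> p) (at_right 0)"
    by (auto simp: has_field_derivative_iff intro: tendsto_mono[OF at_le])
  have "\<forall>\<^sub>F s in at_right 0. s \<in> {0<..<r / norm p}"
    using False assms(2) by (intro eventually_at_right_real) simp
  then have "\<forall>\<^sub>F s in at_right 0. (f (x + s *\<^sub>R p) - f x) / s \<le> M * norm p"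
  proof eventually_elim
    fix s assume s: "s \<in> {0<..<r / norm p}"
    then have "x + s *\<^sub>R p \<in> cball x r" using False by (simp add: dist_norm field_simps)
    from lip[OF this] have "f (x + s *\<^sub>R p) - f x \<le> M * (s * norm p)" using s by simp
    then show "(f (x + s *\<^sub>R p) - f x) / s \<le> M * norm p" using s by (simp add: field_simps)
  qed
  then have "p \<bullet> p \<le> M * norm p" by (intro tendsto_upperbound[OF lim]) auto
  then show ?thesis using False by (simp add: power2_norm_eq_inner[symmetric] power2_eq_square)
qed

text \<open>Final bookkeeping of the Lipschitz estimate. By \<epsilon> \<le> k and k * r \<le> 2 *
  \<epsilon>, every error term is at most \<open>k\<close> times a constant that depends on
  \<open>\<epsilon>0\<close> but not on \<epsilon>; \<open>C0\<close> is the sum of these constants.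
  The concavity of the modulus contributes - k * (C0 + 1), which leaves - k.\<close>

lemma doubling_inequality:
  fixes \<epsilon> \<epsilon>0 k K \<rho> r lam l \<tau> \<beta> \<Lambda> kap N C0 :: real
  assumes pos: "0 < \<epsilon>" "\<epsilon> \<le> \<epsilon>0" "0 < \<rho>" "0 < r" "r \<le> 1" "0 < lam" "0 \<le> l" "0 \<le> \<tau>" "0 \<le> \<beta>"
      "0 \<le> \<Lambda>" "0 \<le> N" "\<epsilon> \<le> k" "k * r \<le> 2 * \<epsilon>"
    and C0: "C0 = 2 + l\<^sup>2 * N / (4 * lam) + 2 * \<tau> / \<rho>\<^sup>2 + \<beta> * (2 + 4 / \<rho>)
      + \<Lambda> / 2 * (4 * \<epsilon>0 / \<rho>) * (2 + 4 / \<rho>) + l * \<epsilon>0"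
    and kap: "kap = (C0 + 1) / (4 * lam)"
  shows "2 * \<epsilon> + (2 * (l\<^sup>2 * r\<^sup>2 / (4 * lam)) * (k * N / r) + 4 * lam * (- 2 * kap * k) + 4 * \<epsilon> / \<rho>\<^sup>2 * \<tau>) / 2
    + \<beta> * (2 * k + 4 * \<epsilon> / \<rho>) + \<Lambda> / 2 * (4 * \<epsilon> / \<rho>) * (2 * k + 4 * \<epsilon> / \<rho>) + l / 2 * r * k\<^sup>2 < 0"
proof -
  have k: "0 < k" using pos by linarith
  have "l\<^sup>2 * r * k * N \<le> l\<^sup>2 * 1 * k * N"
    using pos k by (intro mult_right_mono mult_left_mono) auto
  then have 1: "2 * (l\<^sup>2 * r\<^sup>2 / (4 * lam)) * (k * N / r) / 2 \<le> k * (l\<^sup>2 * N / (4 * lam))"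
    using pos by (simp add: field_simps power2_eq_square)
  have 2: "4 * \<epsilon> / \<rho>\<^sup>2 * \<tau> / 2 \<le> k * (2 * \<tau> / \<rho>\<^sup>2)"
    using pos mult_right_mono[of \<epsilon> k "2 * \<tau> / \<rho>\<^sup>2"] by (simp add: algebra_simps)
  have e: "2 * k + 4 * \<epsilon> / \<rho> \<le> k * (2 + 4 / \<rho>)"
    using pos by (simp add: field_simps)
  then have 3: "\<beta> * (2 * k + 4 * \<epsilon> / \<rho>) \<le> k * (\<beta> * (2 + 4 / \<rho>))"
    using mult_left_mono[OF e pos(9)] by (simp add: algebra_simps)
  have "\<Lambda> / 2 * (4 * \<epsilon> / \<rho>) * (2 * k + 4 * \<epsilon> / \<rho>) \<le> \<Lambda> / 2 * (4 * \<epsilon>0 / \<rho>) * (k * (2 + 4 / \<rho>))"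
    using pos k by (intro mult_mono e mult_nonneg_nonneg divide_right_mono) auto
  then have 4: "\<Lambda> / 2 * (4 * \<epsilon> / \<rho>) * (2 * k + 4 * \<epsilon> / \<rho>) \<le> k * (\<Lambda> / 2 * (4 * \<epsilon>0 / \<rho>) * (2 + 4 / \<rho>))"
    by (simp add: algebra_simps)
  have "l / 2 * k * (k * r) \<le> l / 2 * k * (2 * \<epsilon>0)"
    using pos k by (intro mult_left_mono) auto
  then have 5: "l / 2 * r * k\<^sup>2 \<le> k * (l * \<epsilon>0)" by (simp add: power2_eq_square algebra_simps)
  have 6: "4 * lam * (- 2 * kap * k) / 2 = - k * (C0 + 1)"
    using pos by (simp add: kap field_simps)
  have "2 * \<epsilon> \<le> k * 2" using pos by simp
  then have "2 * \<epsilon> + (2 * (l\<^sup>2 * r\<^sup>2 / (4 * lam)) * (k * N / r) + 4 * lam * (- 2 * kap * k) + 4 * \<epsilon> / \<rho>\<^sup>2 * \<tau>) / 2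
    + \<beta> * (2 * k + 4 * \<epsilon> / \<rho>) + \<Lambda> / 2 * (4 * \<epsilon> / \<rho>) * (2 * k + 4 * \<epsilon> / \<rho>) + l / 2 * r * k\<^sup>2
    \<le> k * 2 + k * (l\<^sup>2 * N / (4 * lam)) + k * (2 * \<tau> / \<rho>\<^sup>2) + k * (\<beta> * (2 + 4 / \<rho>))
      + k * (\<Lambda> / 2 * (4 * \<epsilon>0 / \<rho>) * (2 + 4 / \<rho>)) + k * (l * \<epsilon>0) - k * (C0 + 1)"
    using 1 2 3 4 5 6 by (simp only: add_divide_distrib)
  also have "\<dots> = - k" unfolding C0 by (simp add: algebra_simps)
  finally show ?thesis using k by linarith
qed

context quadratic_flow
begin

text \<open>Doubling of variables with the modulus \<open>\<psi> r = r - kap * r\<^sup>2\<close>: its concavity in the direction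
  \<open>y1 - y2\<close>, gained from ellipticity, beats the drift and the quadratic terms.\<close>

lemma interior_lipschitz:
  assumes S: "compact S" "S \<subseteq> E"
  shows "\<exists>S' r L. compact S' \<and> S' \<subseteq> E \<and> 0 < r \<and> 0 \<le> L \<and> (\<forall>x\<in>S. cball x r \<subseteq> S') \<and>
    (\<forall>t>1. \<forall>x\<in>S. \<forall>\<epsilon>. 0 < \<epsilon> \<longrightarrow> \<epsilon> \<le> \<epsilon>0 \<longrightarrow>
       (\<forall>s\<in>{t-1..t}. \<forall>y\<in>S'. \<forall>y'\<in>S'. h s y - h s y' \<le> \<epsilon>) \<longrightarrow>
       (\<forall>y\<in>cball x r. \<bar>h t y - h t x\<bar> \<le> L * \<epsilon> * norm (y - x)))"
proof -
  obtain e where e: "0 < e" "(\<Union>x\<in>S. cball x e) \<subseteq> E"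
    using compact_subset_open_imp_cball_epsilon_subset[OF S(1) open_E S(2)] by blast
  \<comment> \<open>Half of \<open>e\<close>: the first point stays within \<rho> of
    \<open>x\<close> and the second within \<rho> of the first, so both remain in
    \<open>S'\<close>.\<close>
  define \<rho> where "\<rho> = e / 2"
  have \<rho>: "0 < \<rho>" using e by (simp add: \<rho>_def)
  define S' where "S' = (\<lambda>p. fst p + snd p) ` (S \<times> cball 0 e)"
  have S'c: "compact S'" unfolding S'_def
    by (intro compact_continuous_image compact_Times S compact_cball continuous_intros)
  have cb: "cball x e \<subseteq> S'" if "x \<in> S" for x
  proof
    fix y assume "y \<in> cball x e"
    then show "y \<in> S'" unfolding S'_def using that
      by (intro image_eqI[of _ _ "(x, y - x)"]) (auto simp: dist_norm norm_minus_commute)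
  qed
  have S'E: "S' \<subseteq> E"
  proof
    fix y assume "y \<in> S'"
    then obtain x \<xi> where "x \<in> S" "norm \<xi> \<le> e" "y = x + \<xi>" by (auto simp: S'_def)
    then have "y \<in> cball x e" by (simp add: dist_norm)
    then show "y \<in> E" using e(2) \<open>x \<in> S\<close> by blast
  qed
  obtain c0 where c0: "0 < c0" "\<And>x \<xi>. x \<in> S' \<Longrightarrow> c0 * (norm \<xi>)\<^sup>2 \<le> quad (A x) \<xi>"
    using elliptic[OF S'c S'E] by blast
  define lam where "lam = c0 / 2"
  have lam: "0 < lam" and ell: "\<And>x \<xi>. x \<in> S' \<Longrightarrow> 2 * lam * (norm \<xi>)\<^sup>2 \<le> quad (A x) \<xi>"
    using c0 by (auto simp: lam_def)
  obtain \<tau> where \<tau>: "0 \<le> \<tau>" "\<And>x. x \<in> S' \<Longrightarrow> trace (A x) \<le> \<tau>"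
    using trace_bounded[OF S'c S'E] by blast
  obtain \<beta> where \<beta>: "0 \<le> \<beta>" "\<And>x. x \<in> S' \<Longrightarrow> norm (b x) \<le> \<beta>"
    using b_bounded[OF S'c S'E] by blast
  obtain \<Lambda> where \<Lambda>: "0 \<le> \<Lambda>"
    "\<And>x \<xi> \<zeta>. x \<in> S' \<Longrightarrow> \<bar>\<xi> \<bullet> (Ab x *v \<zeta>)\<bar> \<le> \<Lambda> * (norm \<xi> * norm \<zeta>)"
    using Ab_bounded[OF S'c S'E] unfolding form_bounded_on_def by blast
  obtain l1 where l1: "0 \<le> l1" "\<And>x y \<xi> \<zeta>. closed_segment x y \<subseteq> S' \<Longrightarrow>
      \<bar>\<xi> \<bullet> ((A x - A y) *v \<zeta>)\<bar> \<le> l1 * norm (x - y) * (norm \<xi> * norm \<zeta>)"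
    using A_lipschitz[OF S'c S'E] unfolding form_lipschitz_on_def by blast
  obtain l2 where l2: "0 \<le> l2" "\<And>x y \<xi> \<zeta>. closed_segment x y \<subseteq> S' \<Longrightarrow>
      \<bar>\<xi> \<bullet> ((Ab x - Ab y) *v \<zeta>)\<bar> \<le> l2 * norm (x - y) * (norm \<xi> * norm \<zeta>)"
    using Ab_lipschitz[OF S'c S'E] unfolding form_lipschitz_on_def by blast
  define l where "l = max l1 l2"
  have l0: "0 \<le> l" using l1(1) by (simp add: l_def)
  have lA: "\<bar>\<xi> \<bullet> ((A x - A y) *v \<zeta>)\<bar> \<le> l * norm (x - y) * (norm \<xi> * norm \<zeta>)"
    and lAb: "\<bar>\<xi> \<bullet> ((Ab x - Ab y) *v \<zeta>)\<bar> \<le> l * norm (x - y) * (norm \<xi> * norm \<zeta>)"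
    if "closed_segment x y \<subseteq> S'" for x y \<xi> \<zeta>
    by (intro order_trans[OF l1(2)[OF that]] order_trans[OF l2(2)[OF that]] mult_right_mono;
        simp add: l_def)+
  define N where "N = real CARD('d)"
  \<comment> \<open>For negative \<open>\<epsilon>0\<close> the claim is vacuous; the maximum keeps
    the constants below nonnegative.\<close>
  define \<epsilon>1 where "\<epsilon>1 = max 0 \<epsilon>0"
  define C0 where "C0 = 2 + l\<^sup>2 * N / (4 * lam) + 2 * \<tau> / \<rho>\<^sup>2 + \<beta> * (2 + 4 / \<rho>)
      + \<Lambda> / 2 * (4 * \<epsilon>1 / \<rho>) * (2 + 4 / \<rho>) + l * \<epsilon>1"
  define kap where "kap = (C0 + 1) / (4 * lam)"
  have "0 < C0" unfolding C0_def
    using lam l0 \<tau> \<beta> \<Lambda> \<rho> by (intro add_pos_nonneg) (auto simp: N_def \<epsilon>1_def)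
  then have kap: "0 < kap" using lam by (simp add: kap_def)
  \<comment> \<open>The bounds serve, in this order: the final inequality, the localization in
    \<open>S'\<close>, the condition n \<le> lam of the coupling, and a modulus of at least 3/4 of
    the distance.\<close>
  define r0 where "r0 = min (min 1 \<rho>) (min (2 * lam / (l + 1)) (1 / (4 * kap)))"
  have r0: "0 < r0" "r0 \<le> 1" "r0 \<le> \<rho>" "4 * kap * r0 \<le> 1" "l * r0 \<le> 2 * lam"
  proof -
    show "0 < r0" "r0 \<le> 1" "r0 \<le> \<rho>" using \<rho> lam l0 kap by (auto simp: r0_def add_nonneg_pos)
    have "r0 \<le> 1 / (4 * kap)" by (simp add: r0_def)
    then show "4 * kap * r0 \<le> 1" using kap by (simp add: field_simps)
    have "r0 \<le> 2 * lam / (l + 1)" by (simp add: r0_def)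
    then have "r0 * (l + 1) \<le> 2 * lam" using l0 by (simp add: pos_le_divide_eq)
    then show "l * r0 \<le> 2 * lam" using \<open>0 < r0\<close> by (simp add: algebra_simps)
  qed
  \<comment> \<open>At distance \<open>r0\<close> the penalty \<open>G\<close> is then at least 3/2
    * \<epsilon>, more than the oscillation, so the maximum is not attained there.\<close>
  define K where "K = 2 / r0"
  have K: "1 \<le> K" "K * r0 = 2" using r0 by (auto simp: K_def field_simps)
  have main: "\<bar>h t y - h t x\<bar> \<le> (K + 2 / \<rho>) * \<epsilon> * norm (y - x)"
    if t: "1 < t" and x: "x \<in> S" and \<epsilon>: "0 < \<epsilon>" "\<epsilon> \<le> \<epsilon>0"
      and osc: "\<And>s y y'. s \<in> {t-1..t} \<Longrightarrow> y \<in> S' \<Longrightarrow> y' \<in> S' \<Longrightarrow> h s y - h s y' \<le> \<epsilon>"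
      and y: "y \<in> cball x r0"
    for t x y \<epsilon>
  proof -
    define k where "k = K * \<epsilon>"
    have k: "0 < k" "\<epsilon> \<le> k" "k * r0 = 2 * \<epsilon>" using K \<epsilon> by (auto simp: k_def)
    define \<psi> where "\<psi> r = r - kap * r\<^sup>2" for r :: real
    have \<psi>: "3 / 4 * r \<le> \<psi> r" "\<psi> r \<le> r" if "0 \<le> r" "r \<le> r0" for r
    proof -
      have "4 * kap * r \<le> 1"
        using r0 kap that by (meson mult_left_mono order_trans less_imp_le mult_nonneg_nonneg zero_le_numeral)
      then have "4 * kap * r * r \<le> 1 * r" using that by (intro mult_right_mono)
      then show "3 / 4 * r \<le> \<psi> r" by (simp add: \<psi>_def power2_eq_square)
      show "\<psi> r \<le> r" using kap by (simp add: \<psi>_def)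
    qed
    \<comment> \<open>Chosen so that \<open>F\<close> equals 2 * \<epsilon> on the sphere of radius
      \<rho> around \<open>x\<close>.\<close>
    define m where "m = 4 * \<epsilon> / \<rho>\<^sup>2"
    have m0: "0 < m" using \<epsilon> \<rho> by (simp add: m_def)
    define F where "F z = m / 2 * (norm (z - x))\<^sup>2" for z
    define G where "G z = k * \<psi> (norm z)" for z :: "real^'d"
    \<comment> \<open>The last term equals 2 * \<epsilon> at time t - 1 and so excludes a positive
      maximum at the initial time.\<close>
    define \<Phi> where "\<Phi> s y1 y2 = h s y1 - h s y2 - G (y1 - y2) - F y1 - 2 * \<epsilon> * (t - s)" for s y1 y2
    have inS': "y1 \<in> S'" "y2 \<in> S'" "closed_segment y1 y2 \<subseteq> S'"
      if "norm (y1 - x) \<le> \<rho>" "norm (y1 - y2) \<le> r0" for y1 y2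
    proof -
      have "norm (y2 - x) \<le> norm (y1 - x) + norm (y1 - y2)"
        using norm_triangle_ineq[of "y1 - x" "y2 - y1"] by (simp add: norm_minus_commute)
      then have "y1 \<in> cball x e" "y2 \<in> cball x e"
        using that r0 \<rho> by (auto simp: dist_norm norm_minus_commute \<rho>_def)
      then show "y1 \<in> S'" "y2 \<in> S'" "closed_segment y1 y2 \<subseteq> S'"
        using cb[OF x] closed_segment_subset[OF _ _ convex_cball] by blast+
    qed
    have \<Phi>_le: "\<Phi> s y1 y2 \<le> 0"
      if sy: "s \<in> {t-1..t}" "norm (y1 - x) \<le> \<rho>" "norm (y1 - y2) \<le> r0" for s y1 y2
    proof (rule ccontr)
      assume neg: "\<not> \<Phi> s y1 y2 \<le> 0"
      \<comment> \<open>In the coordinates y1 - x and y1 - y2 the domain is a product of an interval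
        and two balls.\<close>
      define dom where "dom = {t-1..t} \<times> (cball (0::real^'d) \<rho> \<times> cball (0::real^'d) r0)"
      define T where "T q = \<Phi> (fst q) (x + fst (snd q)) (x + fst (snd q) - snd (snd q))" for q
      have hc: "continuous_on dom (\<lambda>q. h (fst q) (g q))"
        if "continuous_on dom g" "\<And>q. q \<in> dom \<Longrightarrow> g q \<in> S'" for g
      proof -
        have "continuous_on dom (\<lambda>q. h (fst (fst q, g q)) (snd (fst q, g q)))"
          by (rule continuous_on_compose2[OF h_cont_on[of "t - 1" t]])
            (use that t S'E in \<open>auto simp: dom_def intro!: continuous_intros\<close>)
        then show ?thesis by simp
      qed
      have "continuous_on dom T"
        unfolding T_def \<Phi>_def G_def F_def \<psi>_def
      proof (intro continuous_intros hc)
        fix q assume "q \<in> dom"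
        then show "x + fst (snd q) \<in> S'" "x + fst (snd q) - snd (snd q) \<in> S'"
          using inS'[of "x + fst (snd q)" "x + fst (snd q) - snd (snd q)"] by (auto simp: dom_def)
      qed
      moreover have "compact dom" unfolding dom_def by (intro compact_Times compact_Icc compact_cball)
      moreover have "dom \<noteq> {}" using r0 \<rho> by (auto simp: dom_def)
      ultimately have "\<exists>q\<in>dom. \<forall>q'\<in>dom. T q' \<le> T q" by (intro continuous_attains_sup)
      then obtain s0 \<xi>0 \<zeta>0 where q0: "(s0, \<xi>0, \<zeta>0) \<in> dom" "\<And>q'. q' \<in> dom \<Longrightarrow> T q' \<le> T (s0, \<xi>0, \<zeta>0)"
        by (metis surj_pair)
      define y1 y2 where "y1 = x + \<xi>0" and "y2 = x + \<xi>0 - \<zeta>0"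
      have s0: "s0 \<in> {t-1..t}" and y12: "norm (y1 - x) \<le> \<rho>" "norm (y1 - y2) \<le> r0"
        using q0(1) by (auto simp: dom_def y1_def y2_def)
      have max: "\<Phi> s z1 z2 \<le> \<Phi> s0 y1 y2"
        if "s \<in> {t-1..t}" "norm (z1 - x) \<le> \<rho>" "norm (z1 - z2) \<le> r0" for s z1 z2
        using q0(2)[of "(s, z1 - x, z1 - z2)"] that by (simp add: T_def dom_def y1_def y2_def)
      have \<Phi>pos: "0 < \<Phi> s0 y1 y2"
        using max[OF sy] neg by linarith
      note in0 = inS'[OF y12]
      have E0: "y1 \<in> E" "y2 \<in> E" using in0 S'E by auto
      have o: "h s0 y1 - h s0 y2 \<le> \<epsilon>" by (rule osc[OF s0 in0(1,2)])
      define r where "r = norm (y1 - y2)"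
      have r: "0 \<le> r" "r \<le> r0" using y12 by (auto simp: r_def)
      have G0: "0 \<le> G (y1 - y2)" "3 / 4 * (k * r) \<le> G (y1 - y2)"
        using \<psi>(1)[OF r] k(1) r(1) by (auto simp: G_def r_def[symmetric] mult_left_mono zero_le_mult_iff)
      have F0: "0 \<le> F y1" using m0 by (simp add: F_def)
      have ts0: "0 \<le> 2 * \<epsilon> * (t - s0)" using s0 \<epsilon> by simp
      have bnd: "G (y1 - y2) < \<epsilon>" "F y1 < \<epsilon>" "2 * \<epsilon> * (t - s0) < \<epsilon>"
        using \<Phi>pos o G0(1) F0 ts0 unfolding \<Phi>_def by linarith+
      have kr: "k * r \<le> 2 * \<epsilon>" using bnd(1) G0(2) \<epsilon> by linarith
      have rr0: "r < r0"
      proof (rule ccontr)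
        assume "\<not> r < r0"
        then have "k * r = 2 * \<epsilon>" using r k by simp
        then show False using bnd(1) G0(2) \<epsilon> by linarith
      qed
      have y1\<rho>: "norm (y1 - x) < \<rho>"
      proof (rule ccontr)
        assume "\<not> norm (y1 - x) < \<rho>"
        then have "norm (y1 - x) = \<rho>" using y12 by simp
        then have "F y1 = 2 * \<epsilon>" using \<rho> by (simp add: F_def m_def)
        then show False using bnd \<epsilon> by simp
      qed
      have "\<epsilon> * (2 * (t - s0)) < \<epsilon> * 1" using bnd(3) by (simp only: mult_ac mult_1_right)
      then have s0t: "t - 1 < s0" "s0 \<le> t"
        using s0 \<epsilon>(1) unfolding mult_less_cancel_left_pos[OF \<epsilon>(1)] by auto
      have s00: "0 < s0" using s0t t by linarith
      \<comment> \<open>Off the diagonal the norm in \<open>G\<close> is smooth, so \<open>G\<close>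
        has a jet.\<close>
      have ne: "y1 \<noteq> y2"
        using \<Phi>pos F0 ts0 by (auto simp: \<Phi>_def G_def \<psi>_def)
      then have rpos: "0 < r" by (simp add: r_def)
      define ee where "ee = (1 / r) *\<^sub>R (y1 - y2)"
      have ee: "norm ee = 1" using rpos by (simp add: ee_def r_def)
      define Z where "Z = k *\<^sub>R (((1 / r) *\<^sub>R mat 1 - (1 / r ^ 3) *\<^sub>R outer (y1 - y2) (y1 - y2)) - (2 * kap) *\<^sub>R mat 1)"
      have jG: "has_jet G (y1 - y2) ((k * (1 - 2 * kap * r)) *\<^sub>R ee) Z"
      proof -
        have "has_jet (\<lambda>z. k * (norm z - kap * (norm (z - 0))\<^sup>2)) (y1 - y2)
           (k *\<^sub>R ((1 / norm (y1 - y2)) *\<^sub>R (y1 - y2) - kap *\<^sub>R (2 *\<^sub>R (y1 - y2 - 0))))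
           (k *\<^sub>R (((1 / norm (y1 - y2)) *\<^sub>R mat 1 - (1 / norm (y1 - y2) ^ 3) *\<^sub>R outer (y1 - y2) (y1 - y2))
              - kap *\<^sub>R (2 *\<^sub>R mat 1)))"
          by (intro has_jet_scale has_jet_diff has_jet_norm has_jet_dist_sq) (use ne in simp)
        moreover have "k *\<^sub>R ((1 / norm (y1 - y2)) *\<^sub>R (y1 - y2) - kap *\<^sub>R (2 *\<^sub>R (y1 - y2 - 0)))
            = (k * (1 - 2 * kap * r)) *\<^sub>R ee"
        proof -
          have "y1 - y2 = r *\<^sub>R ee" using rpos by (simp add: ee_def)
          then show ?thesis using rpos
            unfolding r_def[symmetric] by (simp add: algebra_simps)
        qed
        ultimately show ?thesis
          by (simp add: G_def[abs_def] \<psi>_def Z_def r_def mult.commute)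
      qed
      have jF: "has_jet F y1 (m *\<^sub>R (y1 - x)) (m *\<^sub>R mat 1)"
        using has_jet_scale[OF has_jet_dist_sq, of "m / 2" x y1] by (simp add: F_def[abs_def])
      define p X q Y where "p = grad (h s0) y1" and "X = hess (h s0) y1"
        and "q = grad (h s0) y2" and "Y = hess (h s0) y2"
      have near: "\<forall>\<^sub>F s in nhds (y1, y2). norm (fst s - x) < \<rho> \<and> norm (fst s - snd s) < r0"
      proof -
        have "open {s :: (real^'d) \<times> (real^'d). norm (fst s - x) < \<rho> \<and> norm (fst s - snd s) < r0}"
          by (intro open_Collect_conj open_Collect_less continuous_intros)
        from eventually_nhds_in_open[OF this, of "(y1, y2)"] show ?thesis
          using y1\<rho> rr0 by (simp add: r_def)
      qed
      have mx: "\<forall>\<^sub>F s in nhds (y1, y2). h s0 (fst s) - h s0 (snd s) - G (fst s - snd s) - F (fst s)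
          \<le> h s0 y1 - h s0 y2 - G (y1 - y2) - F y1"
        using near
      proof eventually_elim
        case (elim s)
        then show ?case using max[OF s0, of "fst s" "snd s"] by (simp add: \<Phi>_def)
      qed
      note J = jets_at_doubling_max[OF h_jet[OF s00 E0(1), folded p_def X_def]
          h_jet[OF s00 E0(2), folded q_def Y_def] jG jF mx]
      \<comment> \<open>The smallest \<open>n\<close> that the coupling allows for matrices
        differing by \<open>l * r\<close>. It is of order r^2, which tames the factor 1 / r in
        \<open>trace Z\<close>.\<close>
      define n where "n = l\<^sup>2 * r\<^sup>2 / (4 * lam)"
      have n0: "0 \<le> n" using lam by (simp add: n_def)
      have nlam: "n \<le> lam"
      proof -
        have "l * r \<le> 2 * lam" using r0(5) r l0 by (meson mult_left_mono order_trans)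
        then have "(l * r)\<^sup>2 \<le> (2 * lam)\<^sup>2" using l0 r by (intro power_mono) auto
        then show ?thesis using lam by (simp add: n_def field_simps power2_eq_square)
      qed
      have tr: "mdot (A y1) X - mdot (A y2) Y \<le> 2 * n * trace Z + 4 * lam * (ee \<bullet> (Z *v ee)) + m * trace (A y1)"
      proof (rule coupled_trace_bound_direction[OF A_sym[OF E0(1)] A_sym[OF E0(2)] less_imp_le[OF lam] ee
            ell[OF in0(1)] ell[OF in0(2)] _ n0 nlam])
        show "\<bar>\<xi> \<bullet> ((A y1 - A y2) *v \<zeta>)\<bar> \<le> (l * r) * norm \<xi> * norm \<zeta>" for \<xi> \<zeta>
          using lA[OF in0(3), of \<xi> \<zeta>] by (simp add: r_def mult.assoc)
        show "0 \<le> l * r" using l0 r by simp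
        show "(l * r)\<^sup>2 \<le> 4 * lam * n" using lam by (simp add: n_def power_mult_distrib)
        show "\<xi> \<bullet> (X *v \<xi>) - \<zeta> \<bullet> (Y *v \<zeta>) - (\<xi> - \<zeta>) \<bullet> (Z *v (\<xi> - \<zeta>)) - m * (norm \<xi>)\<^sup>2 \<le> 0" for \<xi> \<zeta>
          using J(3)[of \<xi> \<zeta>] by (simp add: scaleR_matrix_vector_assoc[symmetric] power2_norm_eq_inner)
      qed
      have trZ: "trace Z \<le> k * N / r"
      proof -
        have "trace Z = k * (N / r - (1 / r^3) * r\<^sup>2 - 2 * kap * N)"
          by (simp add: Z_def trace_def mat_def outer_def sum_subtractf sum_distrib_left[symmetric] N_def
              r_def power2_norm_eq_inner inner_vec_def sum_divide_distrib)
        also have "\<dots> \<le> k * (N / r)"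
        proof (rule mult_left_mono)
          have "0 \<le> 1 / r ^ 3 * r\<^sup>2" "0 \<le> 2 * kap * N" using rpos kap by (auto simp: N_def)
          then show "N / r - (1 / r^3) * r\<^sup>2 - 2 * kap * N \<le> N / r" by linarith
        qed (use k in simp)
        finally show ?thesis by simp
      qed
      \<comment> \<open>In the radial direction the two 1 / r terms in the Hessian of the norm
        cancel; only the concavity of the modulus remains.\<close>
      have eZe: "ee \<bullet> (Z *v ee) = - 2 * kap * k"
      proof -
        have "(y1 - y2) = r *\<^sub>R ee" using rpos by (simp add: ee_def)
        then have "outer (y1 - y2) (y1 - y2) *v ee = r\<^sup>2 *\<^sub>R ee"
          using ee by (simp add: outer_mult norm_eq_1 power2_eq_square)
        then have "Z *v ee = k *\<^sub>R (((1 / r) *\<^sub>R ee - (1 / r ^ 3 * r\<^sup>2) *\<^sub>R ee) - (2 * kap) *\<^sub>R ee)"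
          by (simp add: Z_def matrix_vector_mult_diff_rdistrib scaleR_matrix_vector_assoc[symmetric])
        also have "1 / r ^ 3 * r\<^sup>2 = 1 / r" using rpos by (simp add: power2_eq_square power3_eq_cube)
        finally show ?thesis using ee by (simp add: norm_eq_1)
      qed
      have trA: "mdot (A y1) X - mdot (A y2) Y \<le> 2 * n * (k * N / r) + 4 * lam * (- 2 * kap * k) + m * \<tau>"
      proof -
        have "2 * n * trace Z \<le> 2 * n * (k * N / r)" using trZ n0 by (intro mult_left_mono) auto
        moreover have "m * trace (A y1) \<le> m * \<tau>" using \<tau>(2)[OF in0(1)] m0 by simp
        ultimately show ?thesis using tr unfolding eZe by linarith
      qed
      have nq: "norm q \<le> k"
      proof -
        have "4 * kap * r \<le> 1"
          using r0 kap r by (meson mult_left_mono order_trans less_imp_le mult_nonneg_nonneg zero_le_numeral)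
        then have "\<bar>1 - 2 * kap * r\<bar> \<le> 1" using kap r by (auto simp: abs_le_iff)
        then have "k * \<bar>1 - 2 * kap * r\<bar> \<le> k * 1" using k(1) by (intro mult_left_mono) auto
        then show ?thesis using J(2) ee k(1) by (simp add: abs_mult)
      qed
      have pq: "p = q + m *\<^sub>R (y1 - x)" using J(1,2) by simp
      have nm: "norm (m *\<^sub>R (y1 - x)) \<le> 4 * \<epsilon> / \<rho>"
      proof -
        have "m * norm (y1 - x) \<le> m * \<rho>" using y12 m0 by (intro mult_left_mono) auto
        also have "\<dots> = 4 * \<epsilon> / \<rho>" using \<rho> by (simp add: m_def power2_eq_square)
        finally show ?thesis using m0 by simp
      qed
      have np: "norm p \<le> k + 4 * \<epsilon> / \<rho>"
        unfolding pq using norm_triangle_ineq[of q "m *\<^sub>R (y1 - x)"] nq nm by linarith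
      have bt: "b y1 \<bullet> p - b y2 \<bullet> q \<le> \<beta> * (2 * k + 4 * \<epsilon> / \<rho>)"
      proof -
        have "b y1 \<bullet> p \<le> \<beta> * (k + 4 * \<epsilon> / \<rho>)"
          using norm_cauchy_schwarz[of "b y1" p] mult_mono[OF \<beta>(2)[OF in0(1)] np] \<beta>(1) by simp
        moreover have "- (b y2 \<bullet> q) \<le> \<beta> * k"
          using norm_cauchy_schwarz[of "b y2" "- q"] mult_mono[OF \<beta>(2)[OF in0(2)] nq] \<beta>(1) by simp
        ultimately show ?thesis by (simp add: algebra_simps)
      qed
      \<comment> \<open>First the gradient is changed, at a cost proportional to its change, then
        the base point, at cost r * k^2. Since k * r \<le> 2 * \<epsilon>, both costs are linear in
        \<open>k\<close> for bounded \<epsilon>.\<close>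
      have Abt: "quad (Ab y1) p / 2 - quad (Ab y2) q / 2
          \<le> \<Lambda> / 2 * (4 * \<epsilon> / \<rho>) * (2 * k + 4 * \<epsilon> / \<rho>) + l / 2 * r * k\<^sup>2"
      proof -
        have halves: "P1 = Q1 + D \<Longrightarrow> D \<le> U \<Longrightarrow> Q1 - Q2 \<le> W \<Longrightarrow> P1 / 2 - Q2 / 2 \<le> U / 2 + W / 2"
          for P1 Q1 Q2 D U W :: real by linarith
        define d where "d = m *\<^sub>R (y1 - x)"
        have "quad (Ab y1) p = quad (Ab y1) q + d \<bullet> (Ab y1 *v (p + q))"
          using quad_add[OF Ab_sym[OF E0(1)], of q d] inner_sym_matrix[OF Ab_sym[OF E0(1)], of q d]
          unfolding pq d_def[symmetric] quad_def matrix_vector_right_distrib inner_add_right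
            inner_add_left by linarith
        moreover have "d \<bullet> (Ab y1 *v (p + q)) \<le> \<Lambda> * ((4 * \<epsilon> / \<rho>) * (2 * k + 4 * \<epsilon> / \<rho>))"
        proof -
          have "norm (p + q) \<le> 2 * k + 4 * \<epsilon> / \<rho>"
            using norm_triangle_ineq[of p q] np nq by linarith
          then have "norm d * norm (p + q) \<le> (4 * \<epsilon> / \<rho>) * (2 * k + 4 * \<epsilon> / \<rho>)"
            using nm \<epsilon> \<rho> unfolding d_def by (intro mult_mono) auto
          then have "\<Lambda> * (norm d * norm (p + q)) \<le> \<Lambda> * ((4 * \<epsilon> / \<rho>) * (2 * k + 4 * \<epsilon> / \<rho>))"
            by (intro mult_left_mono \<Lambda>(1))
          then show ?thesis using \<Lambda>(2)[OF in0(1), of d "p + q"] by (simp add: abs_le_iff)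
        qed
        moreover have "quad (Ab y1) q - quad (Ab y2) q \<le> l * r * k\<^sup>2"
        proof -
          have "quad (Ab y1) q - quad (Ab y2) q = q \<bullet> ((Ab y1 - Ab y2) *v q)"
            by (simp add: quad_def matrix_vector_mult_diff_rdistrib inner_diff_right)
          also have "\<dots> \<le> l * r * (norm q * norm q)"
            using lAb[OF in0(3), of q q] by (simp add: abs_le_iff r_def)
          also have "\<dots> \<le> l * r * (k * k)"
            using nq l0 r k by (intro mult_left_mono mult_mono) auto
          finally show ?thesis by (simp add: power2_eq_square)
        qed
        ultimately have "quad (Ab y1) p / 2 - quad (Ab y2) q / 2
            \<le> \<Lambda> * ((4 * \<epsilon> / \<rho>) * (2 * k + 4 * \<epsilon> / \<rho>)) / 2 + l * r * k\<^sup>2 / 2"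
          by (rule halves)
        then show ?thesis by (simp only: times_divide_eq_left mult.assoc)
      qed
      define N1 N2 where "N1 = lop (A y1) (b y1) p X + quad (Ab y1) p / 2"
        and "N2 = lop (A y2) (b y2) q Y + quad (Ab y2) q / 2"
      have add4: "u \<le> u' \<Longrightarrow> v \<le> v' \<Longrightarrow> z \<le> z1 + z2 \<Longrightarrow> c + u / 2 + v + z \<le> c + u' / 2 + v' + z1 + z2"
        for c u u' v v' z z1 z2 :: real by linarith
      have "N2 - N1 - 2 * \<epsilon> \<le> 0"
      proof (rule derivative_nonpos_at_past_min)
        show "((\<lambda>s. - \<Phi> s y1 y2) has_real_derivative N2 - N1 - 2 * \<epsilon>) (at s0)"
          unfolding \<Phi>_def N1_def N2_def p_def X_def q_def Y_def
          using h_eq[OF s00 E0(1)] h_eq[OF s00 E0(2)] by (auto intro!: derivative_eq_intros)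
        show "\<forall>\<^sub>F s in at_left s0. - \<Phi> s0 y1 y2 \<le> - \<Phi> s y1 y2"
          using eventually_at_left_real[OF s0t(1)]
          by eventually_elim (use max y12 s0t in auto)
      qed
      then have "0 \<le> 2 * \<epsilon> + (mdot (A y1) X - mdot (A y2) Y) / 2 + (b y1 \<bullet> p - b y2 \<bullet> q)
          + (quad (Ab y1) p / 2 - quad (Ab y2) q / 2)"
        by (simp add: N1_def N2_def lop_def diff_divide_distrib)
      also have "\<dots> \<le> 2 * \<epsilon> + (2 * (l\<^sup>2 * r\<^sup>2 / (4 * lam)) * (k * N / r) + 4 * lam * (- 2 * kap * k) + 4 * \<epsilon> / \<rho>\<^sup>2 * \<tau>) / 2
        + \<beta> * (2 * k + 4 * \<epsilon> / \<rho>) + \<Lambda> / 2 * (4 * \<epsilon> / \<rho>) * (2 * k + 4 * \<epsilon> / \<rho>) + l / 2 * r * k\<^sup>2"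
        by (rule add4[OF trA[unfolded n_def m_def] bt Abt])
      also have "\<dots> < 0"
        by (rule doubling_inequality[of \<epsilon> \<epsilon>1 \<rho> r lam l \<tau> \<beta> \<Lambda> N k C0 kap])
          (use \<epsilon> \<rho> rpos r r0 lam l0 \<tau> \<beta> \<Lambda> k kr in \<open>auto simp: \<epsilon>1_def N_def C0_def kap_def\<close>)
      finally show False by simp
    qed
    have nd: "norm (x - y) \<le> r0" using y by (simp add: dist_norm)
    have nd': "norm (y - x) \<le> \<rho>" "norm (y - x) \<le> r0"
      using nd r0(3) by (auto simp: norm_minus_commute)
    have Gx: "G (x - y) \<le> K * \<epsilon> * norm (y - x)" "G (y - x) \<le> K * \<epsilon> * norm (y - x)"
      using \<psi>(2)[of "norm (y - x)"] nd' k(1)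
      by (auto simp: G_def k_def[symmetric] norm_minus_commute[of x y] intro!: mult_left_mono)
    have Fy: "F y \<le> 2 / \<rho> * \<epsilon> * norm (y - x)"
    proof -
      have "2 * \<epsilon> / \<rho>\<^sup>2 * (norm (y - x) * norm (y - x)) \<le> 2 * \<epsilon> / \<rho>\<^sup>2 * (\<rho> * norm (y - x))"
        using nd' \<epsilon> \<rho> by (intro mult_left_mono mult_right_mono) auto
      also have "\<dots> = 2 / \<rho> * \<epsilon> * norm (y - x)" using \<rho> by (simp add: power2_eq_square)
      finally show ?thesis by (simp add: F_def m_def power2_eq_square)
    qed
    \<comment> \<open>The inequality for \<Phi> is used at time \<open>t\<close> for (x, y) and for
      (y, x); in the first case \<open>F\<close> vanishes, in the second it is itself Lipschitz
      small.\<close>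
    have "0 \<le> 2 / \<rho> * \<epsilon> * norm (y - x)" using \<rho> \<epsilon> by simp
    moreover have "h t x - h t y \<le> G (x - y)"
      using \<Phi>_le[of t x y] nd \<rho> by (simp add: \<Phi>_def F_def)
    moreover have "h t y - h t x \<le> G (y - x) + F y"
      using \<Phi>_le[of t y x] nd' by (simp add: \<Phi>_def)
    ultimately show ?thesis using Gx Fy unfolding distrib_right abs_le_iff by linarith
  qed
  show ?thesis
  proof (rule exI[of _ S'], rule exI[of _ r0], rule exI[of _ "K + 2 / \<rho>"],
      intro conjI S'c S'E r0(1) ballI allI impI)
    show "0 \<le> K + 2 / \<rho>" using K \<rho> by simp
    show "cball x r0 \<subseteq> S'" if "x \<in> S" for x
      using r0(3) e(1) by (intro order_trans[OF _ cb[OF that]]) (auto simp: \<rho>_def)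
    show "\<bar>h t y - h t x\<bar> \<le> (K + 2 / \<rho>) * \<epsilon> * norm (y - x)"
      if "1 < t" "x \<in> S" "0 < \<epsilon>" "\<epsilon> \<le> \<epsilon>0" "y \<in> cball x r0"
        "\<forall>s\<in>{t-1..t}. \<forall>y\<in>S'. \<forall>y'\<in>S'. h s y - h s y' \<le> \<epsilon>" for t x \<epsilon> y
      using main[OF that(1-4) _ that(5)] that(6) by blast
  qed
qed

end

section \<open>Convergence\<close>

context quadratic_flow
begin

text \<open>As \<open>h\<close> may be unbounded on \<open>E\<close>, asymptotic bounds are taken
  modulo arbitrarily small multiples of \<open>w\<close>; on compact sets the correction
  disappears.\<close>

definition eventual_upper :: "real set" where
  "eventual_upper = {c. \<forall>\<sigma>>0. \<exists>t0. \<forall>t\<ge>t0. \<forall>x\<in>E. h t x \<le> c + \<sigma> * w x}"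

definition eventual_lower :: "real set" where
  "eventual_lower = {c. \<forall>\<sigma>>0. \<exists>t0. \<forall>t\<ge>t0. \<forall>x\<in>E. c - \<sigma> * w x \<le> h t x}"

lemma exp_decay_eventually:
  assumes "0 < \<sigma>"
  obtains t0 where "t1 \<le> t0" "\<And>t. t0 \<le> t \<Longrightarrow> s * exp (- al * (t - t1)) \<le> \<sigma>"
proof (rule that[of "t1 + \<bar>s\<bar> / (\<sigma> * al)"])
  show "t1 \<le> t1 + \<bar>s\<bar> / (\<sigma> * al)" using assms al_pos by simp
  fix t assume "t1 + \<bar>s\<bar> / (\<sigma> * al) \<le> t"
  then have "\<bar>s\<bar> / (\<sigma> * al) * (\<sigma> * al) \<le> (t - t1) * (\<sigma> * al)"
    using assms al_pos by (intro mult_right_mono) auto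
  then have "\<bar>s\<bar> \<le> \<sigma> * (al * (t - t1))" using assms al_pos by (simp add: mult_ac)
  also have "\<dots> \<le> \<sigma> * exp (al * (t - t1))"
    using assms exp_ge_add_one_self[of "al * (t - t1)"] by (intro mult_left_mono) linarith+
  finally have "s \<le> \<sigma> * exp (al * (t - t1))" by simp
  then show "s * exp (- al * (t - t1)) \<le> \<sigma>"
    by (simp add: exp_minus divide_inverse[symmetric] pos_divide_le_eq)
qed

text \<open>A bound at a single time suffices: under the barrier the slope decays exponentially and
  leaves the cost s * C / al. An improved bound at one late time therefore lowers the infimum of
  \<open>eventual_upper\<close>, which is how \<open>limits_equal\<close> reaches its
  contradiction.\<close>

lemma eventual_upperI:
  assumes "0 \<le> t1" "0 \<le> s" "s \<le> 1" "\<And>x. x \<in> E \<Longrightarrow> h t1 x \<le> c + s * w x"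
  shows "c + s * (C / al) \<in> eventual_upper"
  unfolding eventual_upper_def
proof (intro CollectI allI impI)
  fix \<sigma> :: real assume "0 < \<sigma>"
  then obtain t0 where t0: "t1 \<le> t0" "\<And>t. t0 \<le> t \<Longrightarrow> s * exp (- al * (t - t1)) \<le> \<sigma>"
    using exp_decay_eventually by blast
  have "h t x \<le> c + s * (C / al) + \<sigma> * w x" if "t0 \<le> t" "x \<in> E" for t x
  proof -
    have "t1 \<le> t" using t0 that by simp
    have "h t x \<le> c + s * barrier t1 t x"
      by (rule upper_comparison[OF assms \<open>t1 \<le> t\<close> that(2)])
    also have "\<dots> \<le> c + s * (exp (- al * (t - t1)) * w x + C / al)"
      using barrier_le[OF \<open>t1 \<le> t\<close>] assms(2) by (intro add_left_mono mult_left_mono)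
    also have "\<dots> = c + s * (C / al) + s * exp (- al * (t - t1)) * w x"
      by (simp add: algebra_simps)
    also have "\<dots> \<le> c + s * (C / al) + \<sigma> * w x"
      using t0(2)[OF that(1)] w_nonneg[OF that(2)] by (intro add_left_mono mult_right_mono)
    finally show ?thesis .
  qed
  then show "\<exists>t0. \<forall>t\<ge>t0. \<forall>x\<in>E. h t x \<le> c + s * (C / al) + \<sigma> * w x" by blast
qed

lemma eventual_lowerI:
  assumes "0 \<le> t1" "0 \<le> s" "\<And>x. x \<in> E \<Longrightarrow> c - s * w x \<le> h t1 x"
  shows "c - s * (C / al) \<in> eventual_lower"
  unfolding eventual_lower_def
proof (intro CollectI allI impI)
  fix \<sigma> :: real assume "0 < \<sigma>"
  then obtain t0 where t0: "t1 \<le> t0" "\<And>t. t0 \<le> t \<Longrightarrow> s * exp (- al * (t - t1)) \<le> \<sigma>"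
    using exp_decay_eventually by blast
  have "c - s * (C / al) - \<sigma> * w x \<le> h t x" if "t0 \<le> t" "x \<in> E" for t x
  proof -
    have "t1 \<le> t" using t0 that by simp
    have "s * exp (- al * (t - t1)) * w x \<le> \<sigma> * w x"
      using t0(2)[OF that(1)] w_nonneg[OF that(2)] by (intro mult_right_mono)
    then have "c - s * (C / al) - \<sigma> * w x \<le> c - s * (exp (- al * (t - t1)) * w x + C / al)"
      by (simp add: algebra_simps)
    also have "\<dots> \<le> c - s * barrier t1 t x"
      using barrier_le[OF \<open>t1 \<le> t\<close>] assms(2) by (intro diff_left_mono mult_left_mono)
    also have "\<dots> \<le> h t x"
      by (rule lower_comparison[OF assms \<open>t1 \<le> t\<close> that(2)])
    finally show ?thesis .
  qed
  then show "\<exists>t0. \<forall>t\<ge>t0. \<forall>x\<in>E. c - s * (C / al) - \<sigma> * w x \<le> h t x" by blast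
qed

lemma eventual_upper_nonempty: "eventual_upper \<noteq> {}"
  using h0_upper eventual_upperI[of 0 1] by fastforce

lemma eventual_lower_nonempty: "eventual_lower \<noteq> {}"
  using h0_lower eventual_lowerI[of 0] by fastforce

lemma eventual_lower_le_upper:
  assumes "c \<in> eventual_lower" "d \<in> eventual_upper"
  shows "c \<le> d"
proof (rule field_le_epsilon)
  fix e :: real assume e: "0 < e"
  define \<sigma> where "\<sigma> = e / (2 * (w x0 + 1))"
  have w0: "0 \<le> w x0" using w_nonneg x0_in by blast
  have \<sigma>: "0 < \<sigma>" "2 * (\<sigma> * w x0) \<le> e" using e w0 by (auto simp: \<sigma>_def field_simps)
  obtain t1 where t1: "\<And>t. t1 \<le> t \<Longrightarrow> c - \<sigma> * w x0 \<le> h t x0"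
    using assms(1) \<sigma>(1) x0_in unfolding eventual_lower_def by blast
  obtain t2 where t2: "\<And>t. t2 \<le> t \<Longrightarrow> h t x0 \<le> d + \<sigma> * w x0"
    using assms(2) \<sigma>(1) x0_in unfolding eventual_upper_def by blast
  from t1[of "max t1 t2"] t2[of "max t1 t2"] show "c \<le> d + e"
    using \<sigma>(2) by simp
qed

section \<open>Extremal asymptotic constants\<close>

definition upper_limit :: real where "upper_limit = Inf eventual_upper"
definition lower_limit :: real where "lower_limit = Sup eventual_lower"

lemma upper_limit_le: "c \<in> eventual_upper \<Longrightarrow> upper_limit \<le> c"
proof -
  obtain d where "d \<in> eventual_lower" using eventual_lower_nonempty by blast
  then have "bdd_below eventual_upper" using eventual_lower_le_upper by (intro bdd_belowI[of _ d]) auto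
  then show "c \<in> eventual_upper \<Longrightarrow> upper_limit \<le> c"
    unfolding upper_limit_def by (rule cInf_lower[rotated])
qed

lemma lower_limit_ge: "c \<in> eventual_lower \<Longrightarrow> c \<le> lower_limit"
proof -
  obtain d where "d \<in> eventual_upper" using eventual_upper_nonempty by blast
  then have "bdd_above eventual_lower" using eventual_lower_le_upper by (intro bdd_aboveI[of _ d]) auto
  then show "c \<in> eventual_lower \<Longrightarrow> c \<le> lower_limit"
    unfolding lower_limit_def by (rule cSup_upper[rotated])
qed

lemma lower_limit_le_upper_limit: "lower_limit \<le> upper_limit"
  unfolding lower_limit_def upper_limit_def
  using eventual_upper_nonempty eventual_lower_nonempty eventual_lower_le_upper
  by (intro cSup_least cInf_greatest) auto

lemma eventual_upper_bound:
  assumes "0 < \<epsilon>" "0 < \<sigma>"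
  obtains t0 where "\<And>t x. t0 \<le> t \<Longrightarrow> x \<in> E \<Longrightarrow> h t x \<le> upper_limit + \<epsilon> + \<sigma> * w x"
proof -
  obtain c where c: "c \<in> eventual_upper" "c < upper_limit + \<epsilon>"
    using cInf_lessD[OF eventual_upper_nonempty, of "upper_limit + \<epsilon>"] assms(1)
    by (auto simp: upper_limit_def)
  then obtain t0 where "\<And>t x. t0 \<le> t \<Longrightarrow> x \<in> E \<Longrightarrow> h t x \<le> c + \<sigma> * w x"
    using assms(2) unfolding eventual_upper_def by blast
  then show ?thesis using c(2) by (intro that[of t0]) force
qed

lemma eventual_lower_bound:
  assumes "0 < \<epsilon>" "0 < \<sigma>"
  obtains t0 where "\<And>t x. t0 \<le> t \<Longrightarrow> x \<in> E \<Longrightarrow> lower_limit - \<epsilon> - \<sigma> * w x \<le> h t x"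
proof -
  obtain c where c: "c \<in> eventual_lower" "lower_limit - \<epsilon> < c"
    using less_cSupD[OF eventual_lower_nonempty, of "lower_limit - \<epsilon>"] assms(1)
    by (auto simp: lower_limit_def)
  then obtain t0 where "\<And>t x. t0 \<le> t \<Longrightarrow> x \<in> E \<Longrightarrow> c - \<sigma> * w x \<le> h t x"
    using assms(2) unfolding eventual_lower_def by blast
  then show ?thesis using c(2) by (intro that[of t0]) force
qed

lemma w_bounded_on:
  assumes "compact S" "S \<subseteq> E"
  obtains R where "0 < R" "\<And>x. x \<in> S \<Longrightarrow> w x \<le> R"
proof -
  have "compact (w ` S)"
    by (rule compact_continuous_image[OF continuous_on_subset[OF w_cont assms(2)] assms(1)])
  then obtain B where "\<And>y. y \<in> w ` S \<Longrightarrow> norm y \<le> B"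
    using compact_imp_bounded bounded_iff by metis
  then have "w x \<le> max 1 B" if "x \<in> S" for x using that by force
  then show ?thesis by (intro that[of "max 1 B"]) auto
qed

text \<open>The quadratic term is nonnegative, so dropping it leaves a linear supersolution.\<close>

lemma lower_supersolution:
  assumes "0 \<le> t" "0 < d"
  shows "supersolution t (t + 1) (\<lambda>s y. (h s y - c) / d)"
  unfolding supersolution_def
proof (intro conjI allI impI)
  show "continuous_on ({t..t + 1} \<times> E) (\<lambda>p. (h (fst p) (snd p) - c) / d)"
    using assms by (intro continuous_intros h_cont_on) auto
  fix s y assume s: "t < s" "s \<le> t + 1" and y: "y \<in> E"
  have s0: "0 < s" using s assms by simp
  let ?p = "grad (h s) y" and ?H = "hess (h s) y"
  have "has_jet (\<lambda>y. (1 / d) * (h s y - c)) y ((1 / d) *\<^sub>R (?p - 0)) ((1 / d) *\<^sub>R (?H - 0))"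
    by (intro has_jet_scale has_jet_diff has_jet_const h_jet s0 y)
  then have "has_jet (\<lambda>y. (h s y - c) / d) y ((1 / d) *\<^sub>R ?p) ((1 / d) *\<^sub>R ?H)" by simp
  moreover have "((\<lambda>s. (h s y - c) / d) has_real_derivative
      ((lop (A y) (b y) ?p ?H + quad (Ab y) ?p / 2) - 0) / d) (at s)"
    by (intro DERIV_cdivide DERIV_diff h_eq[OF s0 y] DERIV_const)
  moreover have "lop (A y) (b y) ((1 / d) *\<^sub>R ?p) ((1 / d) *\<^sub>R ?H)
      \<le> ((lop (A y) (b y) ?p ?H + quad (Ab y) ?p / 2) - 0) / d"
    using quad_Ab_nonneg[OF y, of ?p] assms(2) unfolding lop_scale by (simp add: divide_right_mono)
  ultimately show "\<exists>p H d'. has_jet (\<lambda>y. (h s y - c) / d) y p H \<and>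
      ((\<lambda>s. (h s y - c) / d) has_real_derivative d') (at s) \<and> lop (A y) (b y) p H \<le> d'"
    by blast
qed

text \<open>The exponential with the larger rate \<open>ku\<close> turns the gap below
  \<open>c\<close> into a linear supersolution: \<open>ku * A\<close> dominates \<open>Ab\<close>,
  so the rank-one term of the Hessian outweighs the quadratic term of the equation.\<close>

lemma upper_supersolution:
  assumes "0 \<le> t" "0 < d"
  shows "supersolution t (t + 1) (\<lambda>s y. (1 - exp (ku * (h s y - c))) / d)"
  unfolding supersolution_def
proof (intro conjI allI impI)
  show "continuous_on ({t..t + 1} \<times> E) (\<lambda>p. (1 - exp (ku * (h (fst p) (snd p) - c))) / d)"
    using assms by (intro continuous_intros h_cont_on) auto
  fix s y assume s: "t < s" "s \<le> t + 1" and y: "y \<in> E"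
  have s0: "0 < s" using s assms by simp
  let ?p = "grad (h s) y" and ?H = "hess (h s) y"
  define e where "e = ku * exp (ku * (h s y - c))"
  have e: "0 \<le> e" using kl_pos ku_ge by (simp add: e_def)
  define p H N where "p = (1 / d) *\<^sub>R ((- e) *\<^sub>R ?p)"
    and "H = (1 / d) *\<^sub>R ((- e) *\<^sub>R (?H + ku *\<^sub>R outer ?p ?p))"
    and "N = lop (A y) (b y) ?p ?H + quad (Ab y) ?p / 2"
  have "has_jet (\<lambda>y. (1 / d) * (1 - exp (ku * (h s y - c)))) y
      ((1 / d) *\<^sub>R (0 - e *\<^sub>R (?p - 0))) ((1 / d) *\<^sub>R (0 - e *\<^sub>R ((?H - 0) + ku *\<^sub>R outer (?p - 0) (?p - 0))))"
    unfolding e_def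
    by (intro has_jet_scale has_jet_diff has_jet_const has_jet_exp h_jet s0 y)
  then have "has_jet (\<lambda>y. (1 / d) * (1 - exp (ku * (h s y - c)))) y p H"
    by (simp add: p_def H_def)
  then have "has_jet (\<lambda>y. (1 - exp (ku * (h s y - c))) / d) y p H" by simp
  moreover have "((\<lambda>s. (1 - exp (ku * (h s y - c))) / d) has_real_derivative - (e * N) / d) (at s)"
    unfolding e_def N_def using h_eq[OF s0 y] assms(2) by (auto intro!: derivative_eq_intros)
  moreover have "lop (A y) (b y) p H \<le> - (e * N) / d"
  proof -
    have "lop (A y) (b y) p H = (1 / d) * (- e * (lop (A y) (b y) ?p ?H + ku * quad (A y) ?p / 2))"
      unfolding p_def H_def lop_scale
      by (simp add: lop_def mdot_add mdot_scale mdot_outer quad_def add_divide_distrib)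
    also have "\<dots> \<le> (1 / d) * (- e * N)"
      unfolding N_def using ku[OF y, of ?p] e assms(2)
      by (intro mult_left_mono mult_left_mono_neg) auto
    finally show ?thesis by simp
  qed
  ultimately show "\<exists>p H d'. has_jet (\<lambda>y. (1 - exp (ku * (h s y - c))) / d) y p H \<and>
      ((\<lambda>s. (1 - exp (ku * (h s y - c))) / d) has_real_derivative d') (at s) \<and> lop (A y) (b y) p H \<le> d'"
    by blast
qed

lemma w_sublevel_compact:
  obtains K where "compact K" "K \<subseteq> E" "\<And>x. x \<in> E - K \<Longrightarrow> R \<le> w x"
  using w_coercive[of R] by blast

lemma limits_equal: "lower_limit = upper_limit"
proof (rule ccontr)
  assume "lower_limit \<noteq> upper_limit"
  define D where "D = upper_limit - lower_limit"
  have D: "0 < D" using \<open>lower_limit \<noteq> upper_limit\<close> lower_limit_le_upper_limit by (simp add: D_def)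
  define ca where "ca = C / al"
  \<comment> \<open>Outside the set \<open>K\<close> below, a gain \<open>g\<close> is replaced by
    the slope \<open>g / R\<close>. Its cost (g / R) * ca is at most g / 2 because R \<ge> 2 * ca,
    and R \<ge> 2 / ku keeps \<open>g / R\<close> at most 1 / 2, so that the total slope in the
    upper case stays at most 1.\<close>
  define R where "R = 2 * ca + 2 / ku + 1"
  have ku0: "0 < ku" using kl_pos ku_ge by simp
  have CA: "0 \<le> ca" using C_nonneg al_pos by (simp add: ca_def)
  have R: "0 < R" "2 * ca \<le> R" "2 / ku \<le> R"
  proof -
    have "0 \<le> 2 / ku" using ku0 by simp
    then show "0 < R" "2 * ca \<le> R" "2 / ku \<le> R"
      using CA unfolding R_def by linarith+
  qed
  obtain K where K: "compact K" "K \<subseteq> E" "\<And>x. x \<in> E - K \<Longrightarrow> R \<le> w x"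
    using w_sublevel_compact by blast
  \<comment> \<open>\<open>D + 2\<close> will bound the oscillation of \<open>h\<close> on
    \<open>S'\<close> at late times, so \<open>r0\<close> and \<open>L\<close> are available before
    the time is chosen.\<close>
  obtain S' r0 L where L: "compact S'" "S' \<subseteq> E" "0 < r0" "0 \<le> L"
    and lip: "\<And>t \<epsilon>. 1 < t \<Longrightarrow> 0 < \<epsilon> \<Longrightarrow> \<epsilon> \<le> D + 2 \<Longrightarrow>
       \<forall>s\<in>{t-1..t}. \<forall>y\<in>S'. \<forall>y'\<in>S'. h s y - h s y' \<le> \<epsilon> \<Longrightarrow>
       \<forall>y\<in>cball x0 r0. \<bar>h t y - h t x0\<bar> \<le> L * \<epsilon> * norm (y - x0)"
    using interior_lipschitz[of "{x0}" "D + 2"] x0_in by auto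
  obtain RS where RS: "0 < RS" "\<And>x. x \<in> S' \<Longrightarrow> w x \<le> RS" using w_bounded_on[OF L(1,2)] by blast
  define r where "r = min r0 (D / (4 * (L * (D + 2) + 1)))"
  have L1: "0 < L * (D + 2) + 1" using L(4) D by (simp add: add_nonneg_pos)
  have r: "0 < r" "r \<le> r0" using L(3) L1 D by (auto simp: r_def)
  have Lr: "L * (D + 2) * r \<le> D / 4"
  proof -
    have "r \<le> D / (4 * (L * (D + 2) + 1))" by (simp add: r_def)
    then have "4 * (L * (D + 2) + 1) * r \<le> D" using L1 by (simp add: field_simps)
    then show ?thesis using r(1) by (simp add: algebra_simps)
  qed
  obtain \<Omega> \<eta> where \<Omega>: "compact \<Omega>" "\<Omega> \<subseteq> E" and \<eta>: "0 < \<eta>" "\<eta> \<le> 1"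
    and spread: "\<And>z t x. supersolution t (t + 1) z \<Longrightarrow> \<forall>s\<in>{t..t+1}. \<forall>y\<in>\<Omega>. 0 \<le> z s y \<Longrightarrow>
       \<forall>y\<in>cball x0 r. 1 \<le> z t y \<Longrightarrow> x \<in> K \<Longrightarrow> \<eta> \<le> z (t + 1) x"
    using positivity_propagation[OF K(1,2) r(1)] by auto
  obtain R\<Omega> where R\<Omega>: "0 < R\<Omega>" "\<And>x. x \<in> \<Omega> \<Longrightarrow> w x \<le> R\<Omega>" using w_bounded_on[OF \<Omega>] by blast
  define d where "d = 1 - exp (- ku * (D / 4))"
  have d: "0 < d" "d < 1" using ku0 D by (auto simp: d_def)
  \<comment> \<open>A common gain on \<open>K\<close>: the first entry comes from the lower case,
    the second from the upper case after the exponential is undone.\<close>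
  define g where "g = min (\<eta> * (D / 4)) (\<eta> * d / ku)"
  have g: "g \<le> \<eta> * (D / 4)" "g \<le> \<eta> * d / ku"
    unfolding g_def by (rule min.cobounded1, rule min.cobounded2)
  have g0: "0 < g" using \<eta> D d ku0 by (simp add: g_def)
  have gR: "g / R * ca \<le> g / 2" "g / R \<le> 1 / 2"
  proof -
    have "g * (2 * ca) \<le> g * R" using g0 R by (intro mult_left_mono) auto
    moreover have "g * (2 * u) \<le> g * R \<Longrightarrow> g / R * u \<le> g / 2" for u
      using R(1) by (simp add: field_simps)
    ultimately show "g / R * ca \<le> g / 2" by blast
    have "\<eta> * d \<le> 1" using \<eta> d by (simp add: mult_le_one)
    then have "\<eta> * d / ku \<le> 1 / ku" using ku0 by (simp add: divide_right_mono)
    then have "2 * g \<le> R" using g(2) R(3) by simp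
    then show "g / R \<le> 1 / 2" using R(1) by (simp add: field_simps)
  qed
  define Q where "Q = RS + R\<Omega> + ca"
  have Q: "0 < Q" using RS R\<Omega> CA by (simp add: Q_def)
  \<comment> \<open>\<epsilon> and \<sigma> are chosen last: \<open>g\<close>, \<open>RS\<close> and
    \<open>R\<Omega>\<close> are fixed by now, so the errors in the late bounds can be made small
    against the gain.\<close>
  define \<epsilon> where "\<epsilon> = min (1 / 4) (g / 16)"
  define \<sigma> where "\<sigma> = min (1 / 2) (\<epsilon> / Q)"
  have \<epsilon>: "0 < \<epsilon>" "\<epsilon> \<le> 1 / 4" "\<epsilon> \<le> g / 16"
    using g0 unfolding \<epsilon>_def by auto
  have \<sigma>: "0 < \<sigma>" "\<sigma> \<le> 1 / 2" "\<sigma> * Q \<le> \<epsilon>"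
  proof -
    show "0 < \<sigma>" using \<epsilon> Q by (simp add: \<sigma>_def)
    show "\<sigma> \<le> 1 / 2" unfolding \<sigma>_def by (rule min.cobounded1)
    have "\<sigma> \<le> \<epsilon> / Q" by (simp add: \<sigma>_def)
    then show "\<sigma> * Q \<le> \<epsilon>" using Q by (simp add: field_simps)
  qed
  have \<sigma>R: "\<sigma> * RS \<le> \<epsilon>" "\<sigma> * R\<Omega> + \<sigma> * ca \<le> \<epsilon>"
  proof -
    have "\<sigma> * RS + \<sigma> * R\<Omega> + \<sigma> * ca \<le> \<epsilon>" using \<sigma>(3) by (simp add: Q_def algebra_simps)
    moreover have "0 \<le> \<sigma> * RS" "0 \<le> \<sigma> * R\<Omega>" "0 \<le> \<sigma> * ca" using \<sigma> RS R\<Omega> CA by auto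
    ultimately show "\<sigma> * RS \<le> \<epsilon>" "\<sigma> * R\<Omega> + \<sigma> * ca \<le> \<epsilon>" by linarith+
  qed
  have \<sigma>R0: "0 \<le> \<sigma> * R\<Omega>" using \<sigma>(1) R\<Omega>(1) by simp
  obtain t1 where up: "\<And>t x. t1 \<le> t \<Longrightarrow> x \<in> E \<Longrightarrow> h t x \<le> upper_limit + \<epsilon> + \<sigma> * w x"
    using eventual_upper_bound[OF \<epsilon>(1) \<sigma>(1)] by blast
  obtain t2 where lo: "\<And>t x. t2 \<le> t \<Longrightarrow> x \<in> E \<Longrightarrow> lower_limit - \<epsilon> - \<sigma> * w x \<le> h t x"
    using eventual_lower_bound[OF \<epsilon>(1) \<sigma>(1)] by blast
  define t where "t = max 2 (max t1 t2 + 1)"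
  have t: "1 < t" "t1 \<le> t - 1" "t2 \<le> t - 1" by (auto simp: t_def)
  have ball: "\<bar>h t y - h t x0\<bar> \<le> D / 4" if y: "y \<in> cball x0 r" for y
  proof -
    have "\<bar>h t y - h t x0\<bar> \<le> L * (D + 2) * norm (y - x0)"
    proof (rule bspec[OF lip[OF t(1)]], goal_cases)
      case 3
      have "h s z - h s z' \<le> D + 2" if "s \<in> {t-1..t}" "z \<in> S'" "z' \<in> S'" for s z z'
      proof -
        have "h s z \<le> upper_limit + \<epsilon> + \<sigma> * w z" "lower_limit - \<epsilon> - \<sigma> * w z' \<le> h s z'"
          using up[of s z] lo[of s z'] that t L(2) by auto
        moreover have "\<sigma> * w z \<le> \<sigma> * RS" "\<sigma> * w z' \<le> \<sigma> * RS"
          using RS(2) that \<sigma>(1) by auto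
        ultimately show ?thesis using \<sigma>R(1) \<epsilon>(2) by (simp add: D_def)
      qed
      then show ?case by blast
    qed (use D y r in auto)
    also have "\<dots> \<le> L * (D + 2) * r"
      using y L(4) D by (intro mult_left_mono) (auto simp: dist_norm norm_minus_commute)
    finally show ?thesis using Lr by simp
  qed
  have t0: "0 \<le> t" "0 \<le> t + 1" using t by auto
  show False
  \<comment> \<open>On which side of the midpoint \<open>h t x0\<close> lies decides which limit is
    contradicted; on the ball \<open>h\<close> then keeps the distance D / 4 from that
    limit.\<close>
  proof (cases "(lower_limit + upper_limit) / 2 \<le> h t x0")
    case True
    define c where "c = lower_limit - \<epsilon> - \<sigma> * R\<Omega>"
    have "c + g - (g / R + \<sigma>) * w x \<le> h (t + 1) x" if x: "x \<in> E" for x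
    proof (cases "x \<in> K")
      case True
      have "\<eta> \<le> (h (t + 1) x - c) / (D / 4)"
      proof (rule spread[OF lower_supersolution[OF t0(1)] _ _ True])
        show "\<forall>s\<in>{t..t + 1}. \<forall>y\<in>\<Omega>. 0 \<le> (h s y - c) / (D / 4)"
        proof (intro ballI)
          fix s y assume that: "s \<in> {t..t + 1}" "y \<in> \<Omega>"
          have "\<sigma> * w y \<le> \<sigma> * R\<Omega>" using R\<Omega> that \<sigma> by auto
          then have "c \<le> h s y" using lo[of s y] that t \<Omega> by (auto simp: c_def)
          then show "0 \<le> (h s y - c) / (D / 4)" using D by simp
        qed
        show "\<forall>y\<in>cball x0 r. 1 \<le> (h t y - c) / (D / 4)"
        proof (intro ballI)
          fix y assume that: "y \<in> cball x0 r"
          have "lower_limit + D / 4 \<le> h t y"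
            using abs_le_D1[OF ball[OF that]] abs_le_D2[OF ball[OF that]] \<open>(lower_limit + upper_limit) / 2 \<le> h t x0\<close>
            unfolding D_def by (simp add: field_simps)
          moreover have "c \<le> lower_limit" using \<epsilon>(1) \<sigma>R0 by (simp add: c_def)
          ultimately show "1 \<le> (h t y - c) / (D / 4)" using D by (simp add: field_simps)
        qed
      qed (use D in simp)
      then have "c + \<eta> * (D / 4) \<le> h (t + 1) x" using D by (simp add: field_simps)
      moreover have "0 \<le> (g / R + \<sigma>) * w x" using g0 R \<sigma> w_nonneg[OF x] by simp
      ultimately show ?thesis using g(1) by linarith
    next
      case False
      then have "R \<le> w x" using K(3) x by blast
      then have "g / R * R \<le> g / R * w x" using g0 R by (intro mult_left_mono) auto
      then have "g \<le> g / R * w x" using R(1) by simp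
      moreover have "lower_limit - \<epsilon> - \<sigma> * w x \<le> h (t + 1) x" using lo x t by auto
      moreover have "c \<le> lower_limit - \<epsilon>" using \<sigma>R0 by (simp add: c_def)
      ultimately show ?thesis unfolding distrib_right by linarith
    qed
    \<comment> \<open>The net improvement is at least g / 2 - 2 * \<epsilon>, which is positive as
      \<epsilon> \<le> g / 16.\<close>
    then have "c + g - (g / R + \<sigma>) * ca \<in> eventual_lower"
      unfolding ca_def using g0 R \<sigma> by (intro eventual_lowerI[OF t0(2)]) auto
    then have "c + g - (g / R + \<sigma>) * ca \<le> lower_limit" by (rule lower_limit_ge)
    then show False
      using gR(1) \<sigma>R(2) \<epsilon>(1,3) g0 unfolding c_def distrib_right by linarith
  next
    case False
    then have high: "h t x0 < (lower_limit + upper_limit) / 2" by simp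
    define c where "c = upper_limit + \<epsilon> + \<sigma> * R\<Omega>"
    have "h (t + 1) x \<le> c - g + (g / R + \<sigma>) * w x" if x: "x \<in> E" for x
    proof (cases "x \<in> K")
      case True
      have "\<eta> \<le> (1 - exp (ku * (h (t + 1) x - c))) / d"
      proof (rule spread[OF upper_supersolution[OF t0(1) d(1)] _ _ True])
        show "\<forall>s\<in>{t..t + 1}. \<forall>y\<in>\<Omega>. 0 \<le> (1 - exp (ku * (h s y - c))) / d"
        proof (intro ballI)
          fix s y assume that: "s \<in> {t..t + 1}" "y \<in> \<Omega>"
          have "\<sigma> * w y \<le> \<sigma> * R\<Omega>" using R\<Omega> that \<sigma> by auto
          then have "h s y \<le> c" using up[of s y] that t \<Omega> by (auto simp: c_def)
          then have "ku * (h s y - c) \<le> 0" using ku0 by (simp add: mult_nonneg_nonpos)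
          then show "0 \<le> (1 - exp (ku * (h s y - c))) / d" using d by simp
        qed
        show "\<forall>y\<in>cball x0 r. 1 \<le> (1 - exp (ku * (h t y - c))) / d"
        proof (intro ballI)
          fix y assume that: "y \<in> cball x0 r"
          have "h t y \<le> upper_limit - D / 4"
            using abs_le_D1[OF ball[OF that]] abs_le_D2[OF ball[OF that]] high unfolding D_def by (simp add: field_simps)
          moreover have "upper_limit \<le> c" using \<epsilon>(1) \<sigma>R0 by (simp add: c_def)
          ultimately have "ku * (h t y - c) \<le> ku * (- (D / 4))"
            using ku0 by (intro mult_left_mono) auto
          then have "exp (ku * (h t y - c)) \<le> exp (- ku * (D / 4))" by simp
          then have "d \<le> 1 - exp (ku * (h t y - c))" by (simp add: d_def)
          then show "1 \<le> (1 - exp (ku * (h t y - c))) / d" using d by simp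
        qed
      qed
      then have "exp (ku * (h (t + 1) x - c)) \<le> 1 - \<eta> * d" using d by (simp add: field_simps)
      \<comment> \<open>The tangent bound for exp turns the multiplicative gain into an additive
        one.\<close>
      moreover have "1 + ku * (h (t + 1) x - c) \<le> exp (ku * (h (t + 1) x - c))" by (rule exp_ge_add_one_self)
      ultimately have "ku * (h (t + 1) x - c) \<le> - (\<eta> * d)" by linarith
      then have "h (t + 1) x \<le> c - \<eta> * d / ku" using ku0 by (simp add: field_simps)
      moreover have "0 \<le> (g / R + \<sigma>) * w x" using g0 R \<sigma> w_nonneg[OF x] by simp
      ultimately show ?thesis using g(2) by linarith
    next
      case False
      then have "R \<le> w x" using K(3) x by blast
      then have "g / R * R \<le> g / R * w x" using g0 R by (intro mult_left_mono) auto
      then have "g \<le> g / R * w x" using R(1) by simp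
      moreover have "h (t + 1) x \<le> upper_limit + \<epsilon> + \<sigma> * w x" using up x t by auto
      moreover have "upper_limit + \<epsilon> \<le> c" using \<sigma>R0 by (simp add: c_def)
      ultimately show ?thesis unfolding distrib_right by linarith
    qed
    moreover have "0 \<le> g / R + \<sigma>" using g0 R(1) \<sigma>(1) by simp
    moreover have "g / R + \<sigma> \<le> 1" using gR(2) \<sigma>(2) by linarith
    ultimately have "c - g + (g / R + \<sigma>) * ca \<in> eventual_upper"
      unfolding ca_def by (intro eventual_upperI[OF t0(2)])
    then have "upper_limit \<le> c - g + (g / R + \<sigma>) * ca" by (rule upper_limit_le)
    then show False
      using gR(1) \<sigma>R(2) \<epsilon>(1,3) g0 unfolding c_def distrib_right by linarith
  qed
qed

lemma uniform_convergence:
  assumes "compact S" "S \<subseteq> E" "0 < \<epsilon>"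
  obtains t0 where "\<And>t x. t0 \<le> t \<Longrightarrow> x \<in> S \<Longrightarrow> \<bar>h t x - upper_limit\<bar> \<le> \<epsilon>"
proof -
  obtain R where R: "0 < R" "\<And>x. x \<in> S \<Longrightarrow> w x \<le> R" using w_bounded_on[OF assms(1,2)] by blast
  define \<sigma> where "\<sigma> = \<epsilon> / (2 * R)"
  have \<sigma>: "0 < \<sigma>" "\<sigma> * R = \<epsilon> / 2" using assms R by (auto simp: \<sigma>_def)
  have e: "0 < \<epsilon> / 2" using assms by simp
  obtain t1 where up: "\<And>t x. t1 \<le> t \<Longrightarrow> x \<in> E \<Longrightarrow> h t x \<le> upper_limit + \<epsilon> / 2 + \<sigma> * w x"
    using eventual_upper_bound[OF e \<sigma>(1)] by blast
  obtain t2 where lo: "\<And>t x. t2 \<le> t \<Longrightarrow> x \<in> E \<Longrightarrow> lower_limit - \<epsilon> / 2 - \<sigma> * w x \<le> h t x"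
    using eventual_lower_bound[OF e \<sigma>(1)] by blast
  have "\<bar>h t x - upper_limit\<bar> \<le> \<epsilon>" if "max t1 t2 \<le> t" "x \<in> S" for t x
  proof -
    have "\<sigma> * w x \<le> \<sigma> * R" using R that \<sigma> by simp
    then show ?thesis
      using up[of t x] lo[of t x] that assms(2) \<sigma>(2) limits_equal by (auto simp: abs_le_iff)
  qed
  then show ?thesis by (rule that)
qed

theorem converges_to_constant: "tends_locally_uniformly E h (\<lambda>_. upper_limit)"
  unfolding tends_locally_uniformly_def uniform_limit_iff
proof (intro allI impI)
  fix S and e :: real assume S: "compact S \<and> S \<subseteq> E" and e: "0 < e"
  obtain t0 where "\<And>t x. t0 \<le> t \<Longrightarrow> x \<in> S \<Longrightarrow> \<bar>h t x - upper_limit\<bar> \<le> e / 2"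
    using uniform_convergence[of S "e / 2"] S e by auto
  then have "\<forall>t\<ge>t0. \<forall>x\<in>S. dist (h t x) upper_limit < e"
    using e by (fastforce simp: dist_real_def)
  then show "\<forall>\<^sub>F t in at_top. \<forall>x\<in>S. dist (h t x) upper_limit < e"
    by (auto simp: eventually_at_top_linorder)
qed

text \<open>By uniform convergence the oscillation of \<open>h\<close> on \<open>S'\<close> over a
  unit time interval tends to 0, and the local Lipschitz constant is proportional to it.\<close>

theorem gradient_converges_to_zero: "tends_locally_uniformly E (\<lambda>t. grad (h t)) (\<lambda>_. 0)"
  unfolding tends_locally_uniformly_def uniform_limit_iff
proof (intro allI impI)
  fix S and e :: real assume S: "compact S \<and> S \<subseteq> E" and e: "0 < e"
  obtain S' r L where L: "compact S'" "S' \<subseteq> E" "0 < r" "0 \<le> L"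
    and lip: "\<And>t x \<epsilon>. 1 < t \<Longrightarrow> x \<in> S \<Longrightarrow> 0 < \<epsilon> \<Longrightarrow> \<epsilon> \<le> 1 \<Longrightarrow>
       \<forall>s\<in>{t-1..t}. \<forall>y\<in>S'. \<forall>y'\<in>S'. h s y - h s y' \<le> \<epsilon> \<Longrightarrow>
       \<forall>y\<in>cball x r. \<bar>h t y - h t x\<bar> \<le> L * \<epsilon> * norm (y - x)"
    using interior_lipschitz[of S 1] S by auto
  define \<epsilon> where "\<epsilon> = min 1 (e / (2 * (L + 1)))"
  have \<epsilon>: "0 < \<epsilon>" "\<epsilon> \<le> 1" "L * \<epsilon> < e"
  proof -
    show "0 < \<epsilon>" "\<epsilon> \<le> 1" using e L(4) by (auto simp: \<epsilon>_def)
    have "\<epsilon> \<le> e / (2 * (L + 1))" by (simp add: \<epsilon>_def)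
    then have "2 * (L + 1) * \<epsilon> \<le> e" using L(4) by (simp add: field_simps)
    moreover have "0 \<le> L * \<epsilon>" using L(4) \<open>0 < \<epsilon>\<close> by simp
    ultimately show "L * \<epsilon> < e" using \<open>0 < \<epsilon>\<close> by (simp add: algebra_simps)
  qed
  obtain t0 where t0: "\<And>t x. t0 \<le> t \<Longrightarrow> x \<in> S' \<Longrightarrow> \<bar>h t x - upper_limit\<bar> \<le> \<epsilon> / 2"
    using uniform_convergence[OF L(1,2), of "\<epsilon> / 2"] \<epsilon> by auto
  have "dist (grad (h t) x) 0 < e" if t: "max 2 (t0 + 1) \<le> t" and x: "x \<in> S" for t x
  proof -
    have "norm (grad (h t) x) \<le> L * \<epsilon>"
    proof (rule gradient_bound_of_lipschitz[OF has_jet_derivative[OF h_jet] L(3)])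
      fix y assume y: "y \<in> cball x r"
      show "\<bar>h t y - h t x\<bar> \<le> L * \<epsilon> * norm (y - x)"
      proof (rule bspec[OF lip[OF _ x \<epsilon>(1,2)] y])
        have "h s z - h s z' \<le> \<epsilon>" if "s \<in> {t-1..t}" "z \<in> S'" "z' \<in> S'" for s z z'
        proof -
          have "\<bar>h s z - upper_limit\<bar> \<le> \<epsilon> / 2" "\<bar>h s z' - upper_limit\<bar> \<le> \<epsilon> / 2"
            using t0[of s z] t0[of s z'] that t by simp_all
          then show ?thesis by linarith
        qed
        then show "\<forall>s\<in>{t-1..t}. \<forall>y\<in>S'. \<forall>y'\<in>S'. h s y - h s y' \<le> \<epsilon>" by blast
      qed (use t in simp)
    qed (use t x S in auto)
    then show ?thesis using \<epsilon>(3) by simp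
  qed
  then show "\<forall>\<^sub>F t in at_top. \<forall>x\<in>S. dist (grad (h t) x) 0 < e"
    by (auto simp: eventually_at_top_linorder intro!: exI[of _ "max 2 (t0 + 1)"])
qed

end

section \<open>Stopping the martingale problem\<close>

lemma coord_algebra_generators:
  "{{\<omega> \<in> path_space E. \<omega> t \<in> Some ` S} |t S. t \<in> T \<and> S \<in> sets borel} \<subseteq> Pow (path_space E)"
  by blast

lemma space_coord_algebra: "space (coord_algebra E T) = path_space E"
  unfolding coord_algebra_def by (rule space_measure_of[OF coord_algebra_generators])

lemma sets_coord_algebra_mono:
  assumes "T \<subseteq> T'"
  shows "sets (coord_algebra E T) \<subseteq> sets (coord_algebra E T')"
  unfolding coord_algebra_def
  by (rule measure_of_subset[OF coord_algebra_generators]) (use assms in blast)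

lemma coord_event_in_sets:
  assumes "t \<in> T" "S \<in> sets borel"
  shows "{\<omega> \<in> path_space E. \<omega> t \<in> Some ` S} \<in> sets (coord_algebra E T)"
  unfolding coord_algebra_def sets_measure_of[OF coord_algebra_generators]
  using assms by (intro sigma_sets.Basic) blast

text \<open>Discrete optional stopping: \<open>B j\<close> is the event of not having stopped by
  time \<open>t j\<close>. One step of \<open>Z\<close> adds the increment of \<open>Y\<close> times
  the indicator of \<open>B j\<close>, which has mean zero because \<open>B j\<close> is known at
  time \<open>t j\<close>.\<close>

lemma stopped_martingale_expectation:
  fixes Z :: "nat \<Rightarrow> 'a \<Rightarrow> real" and t :: "nat \<Rightarrow> real"
  assumes P: "prob_space P" and sub: "\<And>s. 0 \<le> s \<Longrightarrow> subalgebra P (F s)"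
    and Y: "is_martingale P F Y"
    and t: "0 \<le> t 0" "\<And>j. t j \<le> t (Suc j)"
    and B: "\<And>j. B j \<in> sets (F (t j))" "\<And>j. B (Suc j) \<subseteq> B j"
    and Z0: "Z 0 = Y (t 0)"
    and ZS: "\<And>j. Z (Suc j) = (\<lambda>\<omega>. if \<omega> \<in> B j then Y (t (Suc j)) \<omega> else Z j \<omega>)"
  shows "integrable P (Z j)" "integral\<^sup>L P (Z j) = integral\<^sup>L P (Y (t 0))"
proof -
  have t0: "0 \<le> t j" for j by (induction j) (use t in \<open>auto intro: order_trans\<close>)
  have ZB: "\<omega> \<in> B j \<Longrightarrow> Z j \<omega> = Y (t j) \<omega>" for j \<omega>
  proof (cases j)
    case (Suc i)
    then show "\<omega> \<in> B j \<Longrightarrow> Z j \<omega> = Y (t j) \<omega>" using ZS B(2)[of i] by auto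
  qed (simp add: Z0)
  have int: "integrable P (Y (t j))" for j
    using Y t0 by (simp add: is_martingale_def)
  have "integrable P (Z j) \<and> integral\<^sup>L P (Z j) = integral\<^sup>L P (Y (t 0))"
  proof (induction j)
    case 0
    then show ?case using int by (simp add: Z0)
  next
    case (Suc j)
    interpret finite_measure_subalgebra P "F (t j)"
      using P sub[OF t0] by (simp add: finite_measure_subalgebra_def finite_measure_subalgebra_axioms_def
          prob_space.finite_measure)
    have BP: "B j \<in> sets P" using B(1) sub[OF t0] by (auto simp: subalgebra_def)
    have "AE \<omega> in P. real_cond_exp P (F (t j)) (Y (t (Suc j))) \<omega> = Y (t j) \<omega>"
      using Y t0 t(2) by (simp add: is_martingale_def)
    then have "(\<integral>\<omega>\<in>B j. real_cond_exp P (F (t j)) (Y (t (Suc j))) \<omega> \<partial>P) = (\<integral>\<omega>\<in>B j. Y (t j) \<omega> \<partial>P)"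
      unfolding set_lebesgue_integral_def
      using int[of j] BP by (intro integral_cong_AE) auto
    then have "(\<integral>\<omega>\<in>B j. Y (t (Suc j)) \<omega> \<partial>P) = (\<integral>\<omega>\<in>B j. Y (t j) \<omega> \<partial>P)"
      using real_cond_exp_intA[OF int B(1), of "Suc j"] by simp
    moreover have setint: "set_integrable P (B j) (Y (t i))" for i
      unfolding set_integrable_def using integrable_mult_indicator[OF BP int] .
    ultimately have zero: "(\<integral>\<omega>\<in>B j. (Y (t (Suc j)) \<omega> - Y (t j) \<omega>) \<partial>P) = 0"
      by (simp add: set_integral_diff)
    have eq: "Z (Suc j) = (\<lambda>\<omega>. Z j \<omega> + indicator (B j) \<omega> *\<^sub>R (Y (t (Suc j)) \<omega> - Y (t j) \<omega>))"
      using ZB by (auto simp: ZS fun_eq_iff indicator_def)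
    have "set_integrable P (B j) (\<lambda>\<omega>. Y (t (Suc j)) \<omega> - Y (t j) \<omega>)"
      by (intro set_integral_diff setint)
    then show ?case
      unfolding eq using Suc zero by (simp add: set_integrable_def set_lebesgue_integral_def)
  qed
  then show "integrable P (Z j)" "integral\<^sup>L P (Z j) = integral\<^sup>L P (Y (t 0))" by auto
qed

text \<open>\<open>Z\<close> freezes \<open>Y\<close> at the first index whose event fails; the
  implication identifies \<open>i\<close> as this index as soon as one exists up to
  \<open>j\<close>.\<close>

lemma stopped_value:
  fixes Z :: "nat \<Rightarrow> 'a \<Rightarrow> real"
  assumes B: "\<And>j. B (Suc j) \<subseteq> B j"
    and Z0: "Z 0 = Y 0"
    and ZS: "\<And>j. Z (Suc j) = (\<lambda>\<omega>. if \<omega> \<in> B j then Y (Suc j) \<omega> else Z j \<omega>)"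
  shows "\<exists>i\<le>j. Z j \<omega> = Y i \<omega> \<and> ((\<exists>k\<le>j. \<omega> \<notin> B k) \<longrightarrow> \<omega> \<notin> B i \<and> (\<forall>k<i. \<omega> \<in> B k))"
proof (induction j)
  case 0
  then show ?case using Z0 by auto
next
  case (Suc j)
  have dec: "\<omega> \<in> B k" if "k \<le> j" "\<omega> \<in> B j" for k
    using that(1) by (induction k rule: inc_induct) (use that(2) B in auto)
  show ?case
  proof (cases "\<omega> \<in> B j")
    case True
    then have "\<omega> \<notin> B k \<Longrightarrow> k \<le> Suc j \<Longrightarrow> k = Suc j" for k using dec le_Suc_eq by blast
    then show ?thesis using True ZS dec by (intro exI[of _ "Suc j"]) (auto simp: less_Suc_eq_le)
  next
    case False
    obtain i where i: "i \<le> j" "Z j \<omega> = Y i \<omega>"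
      "(\<exists>k\<le>j. \<omega> \<notin> B k) \<longrightarrow> \<omega> \<notin> B i \<and> (\<forall>k<i. \<omega> \<in> B k)"
      using Suc by blast
    have "\<omega> \<notin> B i \<and> (\<forall>k<i. \<omega> \<in> B k)" using i(3) False by blast
    moreover have "Z (Suc j) \<omega> = Y i \<omega>" using ZS False i(2) by simp
    ultimately show ?thesis using i(1) by (intro exI[of _ i]) simp
  qed
qed

lemma exit_cap_inside:
  assumes "0 \<le> s" "s < exit_cap U t \<omega>" "0 \<le> t"
  shows "\<omega> s \<in> Some ` U"
proof (rule ccontr)
  assume "\<omega> s \<notin> Some ` U"
  then have "hitting_time (- (Some ` U)) \<omega> \<le> ennreal s"
    unfolding hitting_time_def using assms(1) by (intro Inf_lower) auto
  then have "min (ennreal t) (hitting_time (- (Some ` U)) \<omega>) \<le> ennreal s" by (simp add: min.coboundedI2)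
  then have "exit_cap U t \<omega> \<le> s"
    unfolding exit_cap_def using assms(1) by (metis enn2real_ennreal enn2real_mono ennreal_less_top)
  then show False using assms(2) by simp
qed

lemma exit_cap_eq:
  assumes "0 \<le> t" "\<And>s. 0 \<le> s \<Longrightarrow> s \<le> t \<Longrightarrow> \<omega> s \<in> Some ` U"
  shows "exit_cap U t \<omega> = t"
proof -
  have "ennreal t \<le> hitting_time (- (Some ` U)) \<omega>"
    unfolding hitting_time_def
  proof (rule Inf_greatest)
    fix z assume "z \<in> {ennreal t |t. 0 \<le> t \<and> \<omega> t \<in> - Some ` U}"
    then obtain s where s: "0 \<le> s" "\<omega> s \<notin> Some ` U" "z = ennreal s" by auto
    then have "t < s" using assms(2)[of s] by force
    then show "ennreal t \<le> z" using s by (simp add: ennreal_leI)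
  qed
  then show ?thesis using assms(1) by (simp add: exit_cap_def min_absorb1)
qed

lemma exit_cap_0: "exit_cap U 0 \<omega> = 0"
  by (simp add: exit_cap_def)

text \<open>Open subsets of \<open>E\<close> stay open in the one-point compactification, so a path
  that visits one is inside during a whole time interval. This lets grid times detect the
  visit.\<close>

lemma path_in_open:
  assumes \<omega>: "\<omega> \<in> path_space E" and G: "open G" "G \<subseteq> E" and t: "0 \<le> t" "\<omega> t \<in> Some ` G"
  obtains e where "0 < e" "\<And>s. 0 \<le> s \<Longrightarrow> \<bar>s - t\<bar> < e \<Longrightarrow> \<omega> s \<in> Some ` G"
proof -
  have "openin (top_of_set E) G" using G by (metis inf.absorb2 openin_open)
  then have "openin (Alexandroff_compactification (top_of_set E)) (Some ` G)"
    by (auto simp: openin_Alexandroff_compactification)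
  moreover have "continuous_map (top_of_set {0..}) (Alexandroff_compactification (top_of_set E)) \<omega>"
    using \<omega> by (simp add: path_space_def)
  ultimately have "openin (top_of_set {0..}) {s \<in> topspace (top_of_set {0..}). \<omega> s \<in> Some ` G}"
    by (rule openin_continuous_map_preimage[rotated])
  then obtain W where W: "open W" "{s \<in> {0..}. \<omega> s \<in> Some ` G} = {0..} \<inter> W"
    by (auto simp: openin_open)
  have "t \<in> W" using t W(2) by auto
  then obtain e where "0 < e" "\<And>s. dist s t < e \<Longrightarrow> s \<in> W" using W(1) by (meson open_dist)
  then show ?thesis using W(2) by (intro that[of e]) (auto simp: dist_real_def)
qed

text \<open>\<open>None\<close> is absorbing, so a path alive at time \<open>d\<close> was alive
  before; its image of \<open>{0..d}\<close> is then a compact part of \<open>E\<close> and lies in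
  one member of the increasing exhaustion.\<close>

lemma path_in_exhaustion:
  assumes \<omega>: "\<omega> \<in> path_space E" and En: "\<And>n::nat. open (En n)" "\<And>n. En n \<subseteq> En (Suc n)" "E = (\<Union>n. En n)"
    and d: "0 \<le> d" "\<omega> d \<noteq> None"
  obtains n0 where "\<And>n s. n0 \<le> n \<Longrightarrow> 0 \<le> s \<Longrightarrow> s \<le> d \<Longrightarrow> \<omega> s \<in> Some ` En n"
proof -
  let ?X = "Alexandroff_compactification (top_of_set E)"
  have cont: "continuous_map (top_of_set {0..}) ?X \<omega>"
    using \<omega> by (simp add: path_space_def)
  have alive: "\<omega> s \<noteq> None" if "0 \<le> s" "s \<le> d" for s
  proof
    assume "\<omega> s = None"
    moreover have "\<forall>s t. 0 \<le> s \<and> s \<le> t \<and> \<omega> s = None \<longrightarrow> \<omega> t = None"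
      using \<omega> by (simp add: path_space_def)
    ultimately have "\<omega> d = None" using that by blast
    then show False using d by simp
  qed
  have inE: "\<omega> ` {0..d} \<subseteq> Some ` E"
  proof
    fix z assume "z \<in> \<omega> ` {0..d}"
    then obtain s where s: "0 \<le> s" "s \<le> d" "z = \<omega> s" by auto
    have "\<omega> s \<in> topspace ?X" using continuous_map_funspace[OF cont] s by auto
    then show "z \<in> Some ` E" using alive[OF s(1,2)] s by auto
  qed
  have "compactin (top_of_set {0..}) {0..d}" by (simp add: compactin_subtopology)
  then have cpt: "compactin ?X (\<omega> ` {0..d})" by (rule image_compactin[OF _ cont])
  have "openin ?X U" if U: "U \<in> range (\<lambda>n. Some ` En n)" for U
  proof -
    obtain n where "U = Some ` En n" using U by blast
    moreover have "openin (top_of_set E) (En n)" using En by (metis UN_upper inf.absorb2 openin_open UNIV_I)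
    ultimately show ?thesis by (auto simp: openin_Alexandroff_compactification)
  qed
  moreover have "\<omega> ` {0..d} \<subseteq> \<Union> (range (\<lambda>n. Some ` En n))"
    using inE unfolding En(3) by (simp add: image_UN)
  ultimately obtain \<F> where F: "finite \<F>" "\<F> \<subseteq> range (\<lambda>n. Some ` En n)" "\<omega> ` {0..d} \<subseteq> \<Union>\<F>"
    using compactinD[OF cpt] by meson
  obtain I where I: "finite I" "\<F> = (\<lambda>n. Some ` En n) ` I"
    using finite_subset_image[OF F(1,2)] by auto
  have mono: "En i \<subseteq> En n" if "i \<le> n" for i n
    using that by (rule lift_Suc_mono_le[where f = En, rotated]) (rule En(2))
  show ?thesis
  proof (rule that[of "Max (insert 0 I)"])
    fix n s assume n: "Max (insert 0 I) \<le> n" and s: "0 \<le> s" "s \<le> d"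
    have "\<omega> s \<in> \<omega> ` {0..d}" using s by auto
    then obtain i where "i \<in> I" "\<omega> s \<in> Some ` En i" using F(3) unfolding I(2) by blast
    moreover have "i \<le> n" using n I(1) \<open>i \<in> I\<close> by auto
    ultimately show "\<omega> s \<in> Some ` En n" using mono by blast
  qed
qed

text \<open>The martingale is stopped at the first dyadic grid time at which the path is in \<open>ball y \<epsilon>\<close>;
  this avoids optional stopping in continuous time.\<close>

lemma recurrent_superharmonic_nonneg:
  fixes f :: "real ^ 'd \<Rightarrow> real"
  assumes En: "\<And>n::nat. open (En n)" "\<And>n. En n \<subseteq> En (Suc n)" "E = (\<Union>n. En n)"
    and P: "solves_gmp_at E En a b x P"
    and hit: "AE \<omega> in P. hitting_time (Some ` ball y \<epsilon>) \<omega> < \<infinity>" and G: "ball y \<epsilon> \<subseteq> E"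
    and f: "Ck_on 2 E f" "\<And>z. z \<in> E \<Longrightarrow> second_order_op a b f z \<le> 0"
      "\<And>z. z \<in> ball y \<epsilon> \<Longrightarrow> f z = 0" "\<And>z. - c \<le> f z"
  shows "0 \<le> f x"
proof -
  interpret prob_space P using P by (simp add: solves_gmp_at_def)
  have setsP: "sets P = sets (coord_algebra E {0..})" and start: "AE \<omega> in P. \<omega> 0 = Some x"
    using P by (auto simp: solves_gmp_at_def)
  have spP: "space P = path_space E"
    using sets_eq_imp_space_eq[OF setsP] by (simp add: space_coord_algebra)
  have sub: "subalgebra P (coord_algebra E {0..s})" for s
    using sets_coord_algebra_mono[of "{0..s}" "{0..}" E]
    by (auto simp: subalgebra_def spP space_coord_algebra setsP)
  define g where "g = second_order_op a b f"
  define M where "M n t \<omega> = f (the (\<omega> (exit_cap (En n) t \<omega>)))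
      - (LINT s:{0..exit_cap (En n) t \<omega>}|lborel. g (the (\<omega> s)))" for n t \<omega>
  have mart: "is_martingale P (\<lambda>t. coord_algebra E {0..t}) (M n)" for n
    using P f(1) by (simp add: solves_gmp_at_def M_def[abs_def] g_def)
  \<comment> \<open>Before the exit the path is in \<open>En n\<close>; the right end point, where
    it may have left, is a null set.\<close>
  have lint: "(LINT s:{0..exit_cap (En n) t \<omega>}|lborel. g (the (\<omega> s))) \<le> 0" if "0 \<le> t" for n t \<omega>
  proof -
    have "AE s in lborel. 0 \<le> - (indicator {0..exit_cap (En n) t \<omega>} s *\<^sub>R g (the (\<omega> s)))"
      using AE_lborel_singleton[of "exit_cap (En n) t \<omega>"]
    proof eventually_elim
      case (elim s)
      show ?case
      proof (cases "s \<in> {0..exit_cap (En n) t \<omega>}")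
        case True
        then have "\<omega> s \<in> Some ` En n" using elim that by (intro exit_cap_inside[of s _ t]) auto
        then have "the (\<omega> s) \<in> E" using En(3) by auto
        then show ?thesis using f(2) by (simp add: g_def mult_nonneg_nonpos)
      qed simp
    qed
    from integral_nonneg_AE[OF this] show ?thesis by (simp add: set_lebesgue_integral_def)
  qed
  have lower: "- c \<le> M n t \<omega>" if "0 \<le> t" for n t \<omega>
    using lint[OF that, of n \<omega>] f(4)[of "the (\<omega> (exit_cap (En n) t \<omega>))"] by (simp add: M_def)
  \<comment> \<open>One index \<open>k\<close> plays three roles: the domain \<open>En k\<close>,
    the mesh \<open>1 / 2 ^ k\<close> and, in \<open>W\<close>, the horizon \<open>k\<close>,
    reached after \<open>k * 2 ^ k\<close> steps.\<close>
  define B where "B (k::nat) j = {\<omega> \<in> path_space E. \<forall>i\<le>j. \<omega> (real i / 2 ^ k) \<notin> Some ` ball y \<epsilon>}" for k j :: nat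
  define Z where "Z k = rec_nat (M k 0) (\<lambda>j Zj \<omega>. if \<omega> \<in> B k j then M k (real (Suc j) / 2 ^ k) \<omega> else Zj \<omega>)" for k
  have Z0: "Z k 0 = M k (real 0 / 2 ^ k)" for k by (simp add: Z_def)
  have ZS: "Z k (Suc j) = (\<lambda>\<omega>. if \<omega> \<in> B k j then M k (real (Suc j) / 2 ^ k) \<omega> else Z k j \<omega>)" for k j
    unfolding Z_def by simp
  have Bdec: "B k (Suc j) \<subseteq> B k j" for k j unfolding B_def using le_SucI by blast
  have Bmeas: "B k j \<in> sets (coord_algebra E {0..real j / 2 ^ k})" for k j
  proof -
    have "B k j = path_space E - (\<Union>i\<le>j. {\<omega> \<in> path_space E. \<omega> (real i / 2 ^ k) \<in> Some ` ball y \<epsilon>})"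
      by (auto simp: B_def)
    also have "\<dots> \<in> sets (coord_algebra E {0..real j / 2 ^ k})"
      unfolding space_coord_algebra[symmetric, of E "{0..real j / 2 ^ k}"]
    proof (rule sets.compl_sets, rule sets.finite_UN)
      fix i assume "i \<in> {..j}"
      then show "{\<omega> \<in> space (coord_algebra E {0..real j / 2 ^ k}). \<omega> (real i / 2 ^ k) \<in> Some ` ball y \<epsilon>}
          \<in> sets (coord_algebra E {0..real j / 2 ^ k})"
        unfolding space_coord_algebra by (intro coord_event_in_sets) (auto simp: divide_right_mono)
    qed simp
    finally show ?thesis .
  qed
  have stop: "integrable P (Z k j)" "integral\<^sup>L P (Z k j) = integral\<^sup>L P (M k 0)" for k j
    using stopped_martingale_expectation[where P = P and F = "\<lambda>t. coord_algebra E {0..t}" and Y = "M k" and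
        t = "\<lambda>j. real j / 2 ^ k" and B = "B k" and Z = "Z k", OF prob_space_axioms sub mart _ _ Bmeas Bdec Z0 ZS]
    by (auto simp: divide_right_mono)
  have M0: "integral\<^sup>L P (M k 0) = f x" for k
  proof -
    have M0': "M k 0 \<omega> = f x" if "\<omega> 0 = Some x" for \<omega>
    proof -
      have "(LINT s:{0..0::real}|lborel. g (the (\<omega> s))) = 0"
        unfolding set_lebesgue_integral_def
        by (rule integral_eq_zero_AE) (use AE_lborel_singleton[of "0::real"] in eventually_elim, simp)
      then show ?thesis using that by (simp add: M_def exit_cap_0)
    qed
    have "integral\<^sup>L P (M k 0) = integral\<^sup>L P (\<lambda>\<omega>. f x)"
    proof (rule integral_cong_AE)
      show "M k 0 \<in> borel_measurable P" using stop(1)[of k 0] by (simp add: Z_def)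
      show "AE \<omega> in P. M k 0 \<omega> = f x" using start by eventually_elim (rule M0')
    qed simp
    then show ?thesis by (simp add: prob_space)
  qed
  \<comment> \<open>The negative part is bounded by \<open>\<bar>c\<bar>\<close>, so dominated
    convergence applies once the stopped value is eventually nonnegative along almost every
    path.\<close>
  define W where "W k \<omega> = min (Z k (k * 2 ^ k) \<omega>) 0" for k \<omega>
  have Wbound: "norm (W k \<omega>) \<le> \<bar>c\<bar>" for k \<omega>
  proof -
    obtain i where "Z k (k * 2 ^ k) \<omega> = M k (real i / 2 ^ k) \<omega>"
      using stopped_value[where Z = "Z k" and Y = "\<lambda>i. M k (real i / 2 ^ k)" and B = "B k" and j = "k * 2^k" and \<omega> = \<omega>,
          OF Bdec Z0 ZS] by blast
    then have "- c \<le> Z k (k * 2 ^ k) \<omega>" using lower by simp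
    then show ?thesis by (auto simp: W_def min_def)
  qed
  have Wlim: "AE \<omega> in P. (\<lambda>k. W k \<omega>) \<longlonglongrightarrow> 0"
    using start hit AE_space
  proof eventually_elim
    case (elim \<omega>)
    have \<omega>: "\<omega> \<in> path_space E" using elim spP by simp
    have "{ennreal t |t. 0 \<le> t \<and> \<omega> t \<in> Some ` ball y \<epsilon>} \<noteq> {}"
      using elim(2) unfolding hitting_time_def by (metis Inf_empty top.not_eq_extremum infinity_ennreal_def)
    then obtain t where t: "0 \<le> t" "\<omega> t \<in> Some ` ball y \<epsilon>" by auto
    obtain e where e: "0 < e" "\<And>s. 0 \<le> s \<Longrightarrow> \<bar>s - t\<bar> < e \<Longrightarrow> \<omega> s \<in> Some ` ball y \<epsilon>"
      using path_in_open[OF \<omega> open_ball G t] by blast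
    \<comment> \<open>The time interval spent in the ball contains a dyadic time \<open>d\<close>,
      which is a grid time for every finer mesh.\<close>
    obtain k0 where k0: "(1 / 2) ^ k0 < e" using real_arch_pow_inv[OF e(1), of "1 / 2"] by auto
    define j0 where "j0 = nat \<lceil>t * 2 ^ k0\<rceil>"
    define d where "d = real j0 / 2 ^ k0"
    have j0: "t * 2 ^ k0 \<le> real j0" "real j0 < t * 2 ^ k0 + 1"
      using t(1) by (auto simp: j0_def of_nat_nat) linarith
    have d: "t \<le> d" "d < t + e"
    proof -
      show "t \<le> d" using j0(1) by (simp add: d_def field_simps)
      have "d < t + (1 / 2) ^ k0" using j0(2) by (simp add: d_def field_simps power_divide)
      then show "d < t + e" using k0 by simp
    qed
    have d0: "0 \<le> d" using d t by simp
    have hitd: "\<omega> d \<in> Some ` ball y \<epsilon>" using e(2)[of d] d d0 by auto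
    obtain n0 where n0: "\<And>n s. n0 \<le> n \<Longrightarrow> 0 \<le> s \<Longrightarrow> s \<le> d \<Longrightarrow> \<omega> s \<in> Some ` En n"
      using path_in_exhaustion[OF \<omega> En d0] hitd by blast
    have "W k \<omega> = 0" if k: "max (max k0 n0) (nat \<lceil>d\<rceil>) \<le> k" for k
    proof -
      have dk: "d \<le> real k" using k by linarith
      define j where "j = j0 * 2 ^ (k - k0)"
      have jd: "real j / 2 ^ k = d"
      proof -
        have "(2::real) ^ k = 2 ^ k0 * 2 ^ (k - k0)" using k by (simp add: power_add[symmetric])
        then show ?thesis by (simp add: j_def d_def)
      qed
      have "real j \<le> real (k * 2 ^ k)" using jd dk by (simp add: field_simps)
      then have jN: "j \<le> k * 2 ^ k" by (simp only: of_nat_le_iff)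
      have jB: "\<omega> \<notin> B k j" using hitd jd by (auto simp: B_def)
      obtain i where i: "Z k (k * 2 ^ k) \<omega> = M k (real i / 2 ^ k) \<omega>" "\<omega> \<notin> B k i" "\<And>l. l < i \<Longrightarrow> \<omega> \<in> B k l"
        using stopped_value[where Z = "Z k" and Y = "\<lambda>i. M k (real i / 2 ^ k)" and B = "B k" and j = "k * 2^k" and \<omega> = \<omega>,
            OF Bdec Z0 ZS] jB jN by blast
      have "i \<le> j" using i(3)[of j] jB by (meson not_le)
      then have id: "real i / 2 ^ k \<le> d" unfolding jd[symmetric] by (simp add: divide_right_mono)
      have "\<omega> (real i / 2 ^ k) \<in> Some ` ball y \<epsilon>"
      proof -
        obtain l where l: "l \<le> i" "\<omega> (real l / 2 ^ k) \<in> Some ` ball y \<epsilon>"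
          using i(2) \<omega> by (auto simp: B_def)
        have "\<not> l < i"
        proof
          assume "l < i"
          then show False using i(3)[of l] l(2) unfolding B_def by blast
        qed
        then have "l = i" using l(1) by simp
        then show ?thesis using l(2) by simp
      qed
      then obtain z where z: "\<omega> (real i / 2 ^ k) = Some z" "z \<in> ball y \<epsilon>" by blast
      \<comment> \<open>For large \<open>k\<close> the path stays in \<open>En k\<close> up to time
        \<open>d\<close>, so the exit is not yet active and the stopped value is \<open>f\<close> in
        the ball, hence 0, minus a nonpositive integral.\<close>
      have "exit_cap (En k) (real i / 2 ^ k) \<omega> = real i / 2 ^ k"
        by (rule exit_cap_eq) (use n0[of k] k id in auto)
      then have "0 \<le> M k (real i / 2 ^ k) \<omega>"
        using lint[of "real i / 2 ^ k" k \<omega>] z f(3) by (simp add: M_def)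
      then show ?thesis using i(1) by (simp add: W_def)
    qed
    then have "\<forall>\<^sub>F k in sequentially. W k \<omega> = 0"
      by (intro eventually_sequentiallyI[of "max (max k0 n0) (nat \<lceil>d\<rceil>)"])
    then show ?case by (rule tendsto_eventually)
  qed
  have Wint: "W k \<in> borel_measurable P" for k
    using stop(1)[of k "k * 2 ^ k"] unfolding W_def[abs_def] by measurable
  have "(\<lambda>k. integral\<^sup>L P (W k)) \<longlonglongrightarrow> integral\<^sup>L P (\<lambda>\<omega>. 0)"
    by (rule integral_dominated_convergence[where w = "\<lambda>\<omega>. \<bar>c\<bar>"]) (use Wint Wlim Wbound in auto)
  then have lim: "(\<lambda>k. integral\<^sup>L P (W k)) \<longlonglongrightarrow> 0" by simp
  have "integral\<^sup>L P (W k) \<le> f x" for k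
  proof -
    have "integral\<^sup>L P (W k) \<le> integral\<^sup>L P (Z k (k * 2 ^ k))"
    proof (rule integral_mono)
      show "integrable P (W k)"
        by (rule integrable_const_bound[where B = "\<bar>c\<bar>"]) (use Wbound Wint in auto)
    qed (use stop in \<open>auto simp: W_def\<close>)
    then show ?thesis using stop(2) M0 by simp
  qed
  then show ?thesis by (intro tendsto_upperbound[OF lim]) auto
qed

section \<open>Regularity and translation of the hypotheses\<close>

lemma Ck_on_mono: "Ck_on (Suc k) U f \<Longrightarrow> Ck_on k U f"
proof (induction k arbitrary: f)
  case 0
  then show ?case by (simp add: differentiable_imp_continuous_on)
next
  case (Suc k)
  then show ?case by (metis Ck_on.simps(2))
qed

lemma Ck_on_2_continuous:
  assumes "Ck_on 2 U f"
  shows "continuous_on U f" "continuous_on U (grad f)" "continuous_on U (hess f)"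
proof -
  have C: "f differentiable_on U" "\<And>i. partial i f differentiable_on U"
    "\<And>i j. continuous_on U (partial i (partial j f))"
    using assms by (auto simp: numeral_2_eq_2)
  show "continuous_on U f" by (rule differentiable_imp_continuous_on[OF C(1)])
  show "continuous_on U (grad f)"
    unfolding grad_def[abs_def]
    by (intro continuous_on_vec_lambda differentiable_imp_continuous_on C(2))
  show "continuous_on U (hess f)"
    unfolding hess_def[abs_def] by (intro continuous_on_vec_lambda C(3))
qed

text \<open>The way back from jets to the test functions of the martingale problem.\<close>

lemma Ck_on_2I:
  assumes U: "open U" and jet: "\<And>x. x \<in> U \<Longrightarrow> has_jet f x (P x) (H x)"
    and cont: "continuous_on U H"
  shows "Ck_on 2 U f"
proof -
  have 1: "f differentiable_on U"
    unfolding differentiable_on_eq_differentiable_at[OF U]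
    using has_jet_derivative[OF jet] by (meson differentiableI)
  have 2: "partial j f differentiable (at x)" if x: "x \<in> U" for x j
  proof -
    obtain G where G: "\<forall>\<^sub>F y in nhds x. (f has_derivative (\<lambda>\<xi>. G y \<bullet> \<xi>)) (at y)"
      "(G has_derivative (\<lambda>\<xi>. H x *v \<xi>)) (at x)"
      using jet[OF x] unfolding has_jet_def by blast
    have eq: "\<forall>\<^sub>F y in nhds x. partial j f y = G y $ j"
      using G(1) by eventually_elim (rule has_derivative_gradD)
    have "((\<lambda>y. G y $ j) has_derivative (\<lambda>\<xi>. (H x *v \<xi>) $ j)) (at x)"
      by (rule bounded_linear.has_derivative[OF bounded_linear_vec_nth G(2)])
    then have "(partial j f has_derivative (\<lambda>\<xi>. (H x *v \<xi>) $ j)) (at x)"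
    proof (rule has_derivative_transform_eventually)
      show "\<forall>\<^sub>F y in at x. G y $ j = partial j f y"
        using eq by (simp add: eventually_at_filter eventually_mono)
      show "G x $ j = partial j f x"
        using eventually_nhds_x_imp_x[OF eq] by simp
    qed simp
    then show ?thesis by (rule differentiableI)
  qed
  have "partial i (partial j f) x = H x $ j $ i" if "x \<in> U" for i j x
    using has_jetD(2)[OF jet[OF that]] by (simp add: hess_def vec_eq_iff)
  then have 3: "continuous_on U (partial i (partial j f))" for i j
    by (subst continuous_on_cong[OF refl]) (auto intro!: continuous_intros cont)
  show ?thesis
    using 1 2 3 by (simp add: numeral_2_eq_2 differentiable_on_eq_differentiable_at[OF U])
qed

section \<open>The operators in terms of jets\<close>

lemma second_order_op_lop: "second_order_op a b f x = lop (a x) (b x) (grad f x) (hess f x)"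
  by (simp add: second_order_op_def lop_def mdot_def hess_def grad_def inner_vec_def)

lemma Fop_lop:
  "Fop A Ab B V f x = lop (A x) (B x) (grad f x) (hess f x) + quad (Ab x) (grad f x) / 2 + V x"
  unfolding Fop_def lop_def quad_def inner_matrix_vector
  by (simp add: mdot_def hess_def grad_def inner_vec_def algebra_simps)

lemma drift_eq: "drift Ab B f x = B x + Ab x *v grad f x"
  by (simp add: drift_def grad_def matrix_vector_mult_def vec_eq_iff)

text \<open>\<open>Fop\<close> is quadratic in the gradient, so its expansion around
  \<open>g\<close> is exact: the linear part is the operator with drift \<open>drift Ab B g\<close>,
  and \<open>V\<close> cancels.\<close>

lemma Fop_diff:
  assumes "transpose (Ab x) = Ab x"
  shows "Fop A Ab B V f x - Fop A Ab B V g x =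
    lop (A x) (drift Ab B g x) (grad f x - grad g x) (hess f x - hess g x)
      + quad (Ab x) (grad f x - grad g x) / 2"
  using quad_diff_shift[OF assms, of "grad f x" "grad g x"]
    inner_sym_matrix[OF assms, of "grad g x" "grad f x - grad g x"]
  unfolding Fop_lop drift_eq lop_diff
  by (simp add: lop_def inner_add_left inner_commute[of "Ab x *v grad g x"] inner_diff_left
      inner_diff_right)

section \<open>Uniform coefficient bounds on compact sets\<close>

lemma matrix_form_bound:
  fixes M :: "real ^ 'd ^ 'd"
  shows "\<bar>\<xi> \<bullet> (M *v \<zeta>)\<bar> \<le> (\<Sum>i\<in>UNIV. \<Sum>j\<in>UNIV. \<bar>M $ i $ j\<bar>) * (norm \<xi> * norm \<zeta>)"
proof -
  have "\<bar>\<xi> \<bullet> (M *v \<zeta>)\<bar> \<le> (\<Sum>i\<in>UNIV. \<Sum>j\<in>UNIV. \<bar>\<xi> $ i * M $ i $ j * \<zeta> $ j\<bar>)"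
    unfolding inner_matrix_vector by (intro order_trans[OF sum_abs] sum_mono order_refl)
  also have "\<dots> \<le> (\<Sum>i\<in>UNIV. \<Sum>j\<in>UNIV. norm \<xi> * \<bar>M $ i $ j\<bar> * norm \<zeta>)"
    unfolding abs_mult
    by (intro sum_mono mult_mono mult_nonneg_nonneg component_le_norm_cart) auto
  also have "\<dots> = (\<Sum>i\<in>UNIV. \<Sum>j\<in>UNIV. \<bar>M $ i $ j\<bar>) * (norm \<xi> * norm \<zeta>)"
    by (simp add: sum_distrib_left sum_distrib_right mult_ac)
  finally show ?thesis .
qed

lemma bounded_on_compact:
  fixes f :: "'a::topological_space \<Rightarrow> real"
  assumes "continuous_on E f" "compact S" "S \<subseteq> E"
  shows "\<exists>c\<ge>0. \<forall>x\<in>S. \<bar>f x\<bar> \<le> c"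
proof -
  have "compact (f ` S)"
    by (rule compact_continuous_image[OF continuous_on_subset[OF assms(1,3)] assms(2)])
  then obtain B where "\<And>y. y \<in> f ` S \<Longrightarrow> norm y \<le> B"
    using compact_imp_bounded bounded_iff by metis
  then show ?thesis by (intro exI[of _ "max 0 B"]) force
qed

lemma matrix_bounded_on_compact:
  fixes M :: "real ^ 'd \<Rightarrow> real ^ 'd ^ 'd"
  assumes cont: "\<And>i j. continuous_on E (\<lambda>x. M x $ i $ j)" and S: "compact S" "S \<subseteq> E"
  shows "form_bounded_on S M"
proof -
  have "\<exists>c. \<forall>i j. 0 \<le> c i j \<and> (\<forall>x\<in>S. \<bar>M x $ i $ j\<bar> \<le> c i j)"
    using bounded_on_compact[OF cont S] by metis
  then obtain c where c: "\<And>i j. 0 \<le> c i j" "\<And>i j x. x \<in> S \<Longrightarrow> \<bar>M x $ i $ j\<bar> \<le> c i j" by blast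
  have "\<bar>\<xi> \<bullet> (M x *v \<zeta>)\<bar> \<le> (\<Sum>i\<in>UNIV. \<Sum>j\<in>UNIV. c i j) * (norm \<xi> * norm \<zeta>)" if "x \<in> S" for x \<xi> \<zeta>
    by (intro order_trans[OF matrix_form_bound] mult_right_mono sum_mono c that) auto
  then show ?thesis unfolding form_bounded_on_def by (meson c(1) sum_nonneg)
qed

text \<open>The mean value theorem along segments inside \<open>S\<close>; since \<open>S\<close>
  may fail to be convex, \<open>form_lipschitz_on\<close> quantifies over such segments.\<close>

lemma locally_lipschitz_of_C1:
  fixes f :: "real ^ 'd \<Rightarrow> real"
  assumes f: "f differentiable_on E" "open E" and cont: "\<And>i. continuous_on E (partial i f)"
    and S: "compact S" "S \<subseteq> E"
  shows "\<exists>l\<ge>0. \<forall>x y. closed_segment x y \<subseteq> S \<longrightarrow> \<bar>f x - f y\<bar> \<le> l * norm (x - y)"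
proof -
  have "continuous_on E (\<lambda>x. norm (grad f x))"
    unfolding grad_def[abs_def] by (intro continuous_on_norm continuous_on_vec_lambda cont)
  then obtain l where l0: "0 \<le> l" and l: "\<And>x. x \<in> S \<Longrightarrow> \<bar>norm (grad f x)\<bar> \<le> l"
    using bounded_on_compact[OF _ S] by blast
  have "\<bar>f x - f y\<bar> \<le> l * norm (x - y)" if seg: "closed_segment x y \<subseteq> S" for x y
  proof -
    have "norm (f x - f y) \<le> l * norm (x - y)"
    proof (rule differentiable_bound[OF convex_closed_segment[of x y]])
      fix z assume z: "z \<in> closed_segment x y"
      then have "z \<in> E" using seg S by auto
      then have "(f has_derivative (\<lambda>\<xi>. grad f z \<bullet> \<xi>)) (at z)"
        using f differentiable_partial differentiable_on_eq_differentiable_at by blast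
      then show "(f has_derivative (\<lambda>\<xi>. grad f z \<bullet> \<xi>)) (at z within closed_segment x y)"
        by (rule has_derivative_at_withinI)
      show "onorm (\<lambda>\<xi>. grad f z \<bullet> \<xi>) \<le> l"
      proof (rule onorm_le)
        fix \<xi>
        have "norm (grad f z \<bullet> \<xi>) \<le> norm (grad f z) * norm \<xi>"
          using Cauchy_Schwarz_ineq2 by simp
        also have "\<dots> \<le> l * norm \<xi>" using l[of z] z seg by (intro mult_right_mono) auto
        finally show "norm (grad f z \<bullet> \<xi>) \<le> l * norm \<xi>" .
      qed
    qed auto
    then show ?thesis by simp
  qed
  then show ?thesis using l0 by blast
qed

lemma Ck_holder_on_2_C1:
  assumes "Ck_holder_on 2 \<gamma> U f"
  shows "f differentiable_on U" "\<And>i. continuous_on U (partial i f)"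
  using assms by (auto simp: numeral_2_eq_2 intro: differentiable_imp_continuous_on)

lemma matrix_lipschitz_on_compact:
  fixes M :: "real ^ 'd \<Rightarrow> real ^ 'd ^ 'd"
  assumes M: "\<And>i j. Ck_holder_on 2 \<gamma> E (\<lambda>x. M x $ i $ j)" and E: "open E"
    and S: "compact S" "S \<subseteq> E"
  shows "form_lipschitz_on S M"
proof -
  have "\<exists>c. \<forall>i j. 0 \<le> c i j \<and>
      (\<forall>x y. closed_segment x y \<subseteq> S \<longrightarrow> \<bar>M x $ i $ j - M y $ i $ j\<bar> \<le> c i j * norm (x - y))"
    using locally_lipschitz_of_C1[OF Ck_holder_on_2_C1(1)[OF M] E Ck_holder_on_2_C1(2)[OF M] S] by metis
  then obtain c where c: "\<And>i j. 0 \<le> c i j" "\<And>i j x y. closed_segment x y \<subseteq> S \<Longrightarrow>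
      \<bar>M x $ i $ j - M y $ i $ j\<bar> \<le> c i j * norm (x - y)" by blast
  have "\<bar>\<xi> \<bullet> ((M x - M y) *v \<zeta>)\<bar> \<le> (\<Sum>i\<in>UNIV. \<Sum>j\<in>UNIV. c i j) * norm (x - y) * (norm \<xi> * norm \<zeta>)"
    if "closed_segment x y \<subseteq> S" for x y \<xi> \<zeta>
  proof -
    have "(\<Sum>i\<in>UNIV. \<Sum>j\<in>UNIV. \<bar>(M x - M y) $ i $ j\<bar>) \<le> (\<Sum>i\<in>UNIV. \<Sum>j\<in>UNIV. c i j * norm (x - y))"
      using c(2)[OF that] by (intro sum_mono) simp
    also have "\<dots> = (\<Sum>i\<in>UNIV. \<Sum>j\<in>UNIV. c i j) * norm (x - y)"
      by (simp add: sum_distrib_right)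
    finally show ?thesis
      by (intro order_trans[OF matrix_form_bound] mult_right_mono) auto
  qed
  then show ?thesis unfolding form_lipschitz_on_def by (meson c(1) sum_nonneg)
qed

section \<open>Finite bounds from extended-real limits\<close>

lemma SUP_tendsto_minus_infinityD:
  assumes "(\<lambda>n. SUP x\<in>X n. ereal (f x)) \<longlonglongrightarrow> - \<infinity>"
  shows "\<exists>n0. \<forall>n\<ge>n0. \<forall>x\<in>X n. f x \<le> c"
proof -
  have "\<forall>\<^sub>F n in sequentially. (SUP x\<in>X n. ereal (f x)) < ereal c"
    using assms unfolding tendsto_MInfty by blast
  then obtain n0 where "\<And>n. n0 \<le> n \<Longrightarrow> (SUP x\<in>X n. ereal (f x)) < ereal c"
    by (auto simp: eventually_sequentially)
  then have "f x \<le> c" if "n0 \<le> n" "x \<in> X n" for n x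
    using that SUP_lessD less_imp_le by fastforce
  then show ?thesis by blast
qed

lemma INF_tendsto_infinityD:
  assumes "(\<lambda>n. INF x\<in>X n. ereal (f x)) \<longlonglongrightarrow> \<infinity>"
  shows "\<exists>n0. \<forall>n\<ge>n0. \<forall>x\<in>X n. c \<le> f x"
proof -
  have "\<forall>\<^sub>F n in sequentially. ereal c < (INF x\<in>X n. ereal (f x))"
    using assms unfolding tendsto_PInfty by blast
  then obtain n0 where "\<And>n. n0 \<le> n \<Longrightarrow> ereal c < (INF x\<in>X n. ereal (f x))"
    by (auto simp: eventually_sequentially)
  then have "c \<le> f x" if "n0 \<le> n" "x \<in> X n" for n x
    using that less_INF_D less_imp_le by fastforce
  then show ?thesis by blast
qed

lemma SUP_less_infinityD:
  assumes "(SUP x\<in>X. ereal (f x)) < \<infinity>"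
  shows "\<exists>c. \<forall>x\<in>X. f x \<le> c"
proof -
  obtain c where "(SUP x\<in>X. ereal (f x)) < ereal c" using ereal_dense2[OF assms] by blast
  then have "f x \<le> c" if "x \<in> X" for x
    using that SUP_lessD less_imp_le by fastforce
  then show ?thesis by blast
qed

lemma compact_in_exhaustion:
  fixes En :: "nat \<Rightarrow> 'a::topological_space set"
  assumes En: "\<And>n. open (En n)" "\<And>n. En n \<subseteq> En (Suc n)" and S: "compact S" "S \<subseteq> (\<Union>n. En n)"
  shows "\<exists>n. S \<subseteq> En n"
proof -
  obtain I where I: "finite I" "S \<subseteq> (\<Union>n\<in>I. En n)"
    using compactE_image[OF S(1), of UNIV En] En(1) S(2) by auto
  have "En i \<subseteq> En n" if "i \<le> n" for i n
    using that by (rule lift_Suc_mono_le[where f = En, rotated]) (rule En(2))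
  then have "En i \<subseteq> En (Max (insert 0 I))" if "i \<in> I" for i using I(1) that by simp
  then have "S \<subseteq> En (Max (insert 0 I))" using I(2) by blast
  then show ?thesis by blast
qed

text \<open>Used for the cube and then for the square of the positive part, this makes
  \<open>cutoff\<close> twice continuously differentiable.\<close>

lemma positive_part_power_derivative:
  "((\<lambda>u::real. max u 0 ^ Suc (Suc n)) has_real_derivative real (Suc (Suc n)) * max u 0 ^ Suc n) (at u)"
proof -
  consider "0 < u" | "u < 0" | "u = 0" by linarith
  then show ?thesis
  proof cases
    case 1
    have "((\<lambda>u::real. u ^ Suc (Suc n)) has_real_derivative real (Suc (Suc n)) * max u 0 ^ Suc n) (at u)"
      using DERIV_pow[of "Suc (Suc n)" u] 1 by simp
    then show ?thesis
      by (rule has_field_derivative_transform_within_open[OF _ open_greaterThan]) (use 1 in auto)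
  next
    case 2
    have "((\<lambda>u::real. 0) has_real_derivative real (Suc (Suc n)) * max u 0 ^ Suc n) (at u)"
      using 2 by simp
    then show ?thesis
      by (rule has_field_derivative_transform_within_open[OF _ open_lessThan]) (use 2 in auto)
  next
    case 3
    have "((\<lambda>h::real. max h 0 ^ Suc n) \<longlongrightarrow> max 0 0 ^ Suc n) (at 0)"
      by (intro tendsto_intros)
    then have "((\<lambda>h::real. max h 0 ^ Suc n) \<longlongrightarrow> 0) (at 0)" by simp
    moreover have "\<forall>\<^sub>F h::real in at 0. max h 0 ^ Suc n = (max (0 + h) 0 ^ Suc (Suc n) - max 0 0 ^ Suc (Suc n)) / h"
      by (auto simp: eventually_at_filter max_def)
    ultimately have "((\<lambda>h::real. (max (0 + h) 0 ^ Suc (Suc n) - max 0 0 ^ Suc (Suc n)) / h) \<longlongrightarrow> 0) (at 0)"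
      by (rule Lim_transform_eventually)
    then show ?thesis unfolding DERIV_def using 3 by simp
  qed
qed

text \<open>Because of \<open>cutoff'' \<le> k * cutoff'\<close>, the composition of \<open>cutoff k m\<close> with a supersolution of the
  quadratic equation is superharmonic; it is constant where the supersolution exceeds \<open>m\<close>.\<close>

definition cutoff :: "real \<Rightarrow> real \<Rightarrow> real \<Rightarrow> real" where
  "cutoff k m s = - (max (1 - exp (k * (s - m))) 0 ^ 3)"

definition cutoff' :: "real \<Rightarrow> real \<Rightarrow> real \<Rightarrow> real" where
  "cutoff' k m s = 3 * k * (max (1 - exp (k * (s - m))) 0 ^ 2 * exp (k * (s - m)))"

definition cutoff'' :: "real \<Rightarrow> real \<Rightarrow> real \<Rightarrow> real" where
  "cutoff'' k m s = k * cutoff' k m s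
     - 6 * k\<^sup>2 * (max (1 - exp (k * (s - m))) 0 * (exp (k * (s - m)))\<^sup>2)"

lemma cutoff_derivative: "(cutoff k m has_real_derivative cutoff' k m s) (at s)"
proof -
  have e: "((\<lambda>s. 1 - exp (k * (s - m))) has_real_derivative - (exp (k * (s - m)) * k)) (at s)"
    by (auto intro!: derivative_eq_intros)
  have "((\<lambda>s. max (1 - exp (k * (s - m))) 0 ^ Suc (Suc 1)) has_real_derivative
      real (Suc (Suc 1)) * max (1 - exp (k * (s - m))) 0 ^ Suc 1 * (- (exp (k * (s - m)) * k))) (at s)"
    by (rule DERIV_chain2[OF positive_part_power_derivative e])
  from DERIV_minus[OF this] show ?thesis
    by (simp add: cutoff_def[abs_def] cutoff'_def numeral_3_eq_3 numeral_2_eq_2 algebra_simps)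
qed

lemma cutoff'_derivative: "(cutoff' k m has_real_derivative cutoff'' k m s) (at s)"
proof -
  have e: "((\<lambda>s. 1 - exp (k * (s - m))) has_real_derivative - (exp (k * (s - m)) * k)) (at s)"
    by (auto intro!: derivative_eq_intros)
  have "((\<lambda>s. max (1 - exp (k * (s - m))) 0 ^ Suc (Suc 0)) has_real_derivative
      real (Suc (Suc 0)) * max (1 - exp (k * (s - m))) 0 ^ Suc 0 * (- (exp (k * (s - m)) * k))) (at s)"
    by (rule DERIV_chain2[OF positive_part_power_derivative e])
  then have d: "((\<lambda>s. (max (1 - exp (k * (s - m))) 0)\<^sup>2) has_real_derivative
      - 2 * max (1 - exp (k * (s - m))) 0 * exp (k * (s - m)) * k) (at s)"
    by (simp add: numeral_2_eq_2 algebra_simps)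
  have "((\<lambda>s. exp (k * (s - m))) has_real_derivative exp (k * (s - m)) * k) (at s)"
    by (auto intro!: derivative_eq_intros)
  from DERIV_cmult[OF DERIV_mult[OF d this], of "3 * k"] show ?thesis
    by (simp add: cutoff'_def[abs_def] cutoff''_def power2_eq_square algebra_simps)
qed

lemma cutoff_bounds:
  assumes "0 < k"
  shows "- 1 \<le> cutoff k m s" "0 \<le> cutoff' k m s" "cutoff'' k m s \<le> k * cutoff' k m s"
proof -
  have "max (1 - exp (k * (s - m))) 0 ^ 3 \<le> 1" by (intro power_le_one) auto
  then show "- 1 \<le> cutoff k m s" by (simp add: cutoff_def)
  show "0 \<le> cutoff' k m s" "cutoff'' k m s \<le> k * cutoff' k m s"
    using assms by (auto simp: cutoff'_def cutoff''_def)
qed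

lemma cutoff_eq_0:
  assumes "0 < k" "m \<le> s"
  shows "cutoff k m s = 0" "cutoff' k m s = 0" "cutoff'' k m s = 0"
proof -
  have "1 \<le> exp (k * (s - m))" using assms by simp
  then have "max (1 - exp (k * (s - m))) 0 = 0" by simp
  then show "cutoff k m s = 0" "cutoff' k m s = 0" "cutoff'' k m s = 0"
    by (simp_all add: cutoff_def cutoff'_def cutoff''_def)
qed

lemma cutoff_nonnegD:
  assumes "0 < k" "0 \<le> cutoff k m s"
  shows "m \<le> s"
proof (rule ccontr)
  assume "\<not> m \<le> s"
  then have "k * (s - m) < 0" using assms by (simp add: mult_pos_neg)
  then have "0 < max (1 - exp (k * (s - m))) 0" by simp
  then have "0 < max (1 - exp (k * (s - m))) 0 ^ 3" by (rule zero_less_power)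
  then show False using assms(2) by (simp add: cutoff_def)
qed

section \<open>One-sided bounds on the ergodic solution\<close>

lemma continuous_outer:
  "continuous_on S f \<Longrightarrow> continuous_on S g \<Longrightarrow> continuous_on S (\<lambda>x. outer (f x) (g x))"
  unfolding outer_def by (intro continuous_on_vec_lambda continuous_intros)

text \<open>The test function \<open>cutoff k m (\<phi> - u)\<close> vanishes on
  \<open>En N\<close>, where \<phi> is not known to be a supersolution, and is superharmonic
  elsewhere by \<open>Fop_diff\<close>. Recurrence makes it nonnegative, and the cutoff is
  nonnegative only where \<open>\<phi> - u\<close> is at least \<open>m\<close>.\<close>

lemma ergodic_solution_below_supersolution:
  fixes E :: "(real ^ 'd) set" and En :: "nat \<Rightarrow> (real ^ 'd) set"
  assumes En: "\<And>n. open (En n)" "\<And>n. En n \<subseteq> En (Suc n)" "E = (\<Union>n. En n)"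
    and N: "compact (closure (En N))" "closure (En N) \<subseteq> E" "y \<in> En N"
    and sym: "\<And>x. x \<in> E \<Longrightarrow> transpose (Ab x) = Ab x"
    and k: "0 < k" "\<And>x \<xi>. x \<in> E \<Longrightarrow> 0 \<le> quad (A x) \<xi>"
      "\<And>x \<xi>. x \<in> E \<Longrightarrow> k * quad (A x) \<xi> \<le> quad (Ab x) \<xi>"
    and C2: "Ck_on 2 E \<phi>" "Ck_on 2 E u"
    and \<phi>: "\<And>x. x \<in> E - En N \<Longrightarrow> Fop A Ab B V \<phi> x \<le> lam"
    and u: "\<And>x. x \<in> E \<Longrightarrow> Fop A Ab B V u x = lam"
    and P: "\<And>x. x \<in> E \<Longrightarrow> solves_gmp_at E En A (drift Ab B u) x (P x)"
    and hit: "\<And>x \<epsilon>. x \<in> E \<Longrightarrow> 0 < \<epsilon> \<Longrightarrow> AE \<omega> in P x. hitting_time (Some ` ball y \<epsilon>) \<omega> < \<infinity>"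
  shows "\<exists>m. \<forall>x\<in>E. u x + m \<le> \<phi> x"
proof -
  have oE: "open E" using En by auto
  define g where "g x = \<phi> x - u x" for x
  have gc: "continuous_on E g"
    unfolding g_def by (intro continuous_on_diff Ck_on_2_continuous(1) C2)
  obtain c where c: "\<And>x. x \<in> closure (En N) \<Longrightarrow> \<bar>g x\<bar> \<le> c"
    using bounded_on_compact[OF gc N(1,2)] by blast
  \<comment> \<open>A lower bound of \<open>\<phi> - u\<close> on \<open>En N\<close>, so that the
    cutoff is constant there.\<close>
  define m where "m = - c"
  have gm: "m \<le> g x" if "x \<in> En N" for x
  proof -
    have "x \<in> closure (En N)" using that closure_subset by blast
    from c[OF this] show ?thesis by (simp add: m_def abs_le_iff)
  qed
  define p H where "p x = grad \<phi> x - grad u x" and "H x = hess \<phi> x - hess u x" for x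
  have jg: "has_jet g x (p x) (H x)" if "x \<in> E" for x
    unfolding g_def p_def H_def
    by (intro has_jet_diff Ck_on_2_has_jet[OF C2(1) oE that] Ck_on_2_has_jet[OF C2(2) oE that])
  define f where "f x = cutoff k m (g x)" for x
  have jf: "has_jet f x (cutoff' k m (g x) *\<^sub>R p x)
      (cutoff' k m (g x) *\<^sub>R H x + cutoff'' k m (g x) *\<^sub>R outer (p x) (p x))" if "x \<in> E" for x
    unfolding f_def
    by (rule has_jet_compose[OF jg[OF that] always_eventually[OF allI] cutoff'_derivative])
      (rule cutoff_derivative)
  have fC2: "Ck_on 2 E f"
  proof (rule Ck_on_2I[OF oE jf])
    show "continuous_on E (\<lambda>x. cutoff' k m (g x) *\<^sub>R H x + cutoff'' k m (g x) *\<^sub>R outer (p x) (p x))"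
      unfolding cutoff'_def cutoff''_def p_def H_def
      by (intro continuous_intros continuous_outer gc Ck_on_2_continuous C2)
  qed
  have Lf: "second_order_op A (drift Ab B u) f x \<le> 0" if x: "x \<in> E" for x
  proof -
    let ?a = "cutoff' k m (g x)" and ?b = "cutoff'' k m (g x)"
    have "second_order_op A (drift Ab B u) f x
        = ?a * lop (A x) (drift Ab B u x) (p x) (H x) + ?b * quad (A x) (p x) / 2"
      unfolding second_order_op_lop has_jetD[OF jf[OF x]]
      by (simp add: lop_def mdot_add mdot_scale mdot_outer quad_def algebra_simps)
    also have "lop (A x) (drift Ab B u x) (p x) (H x) = Fop A Ab B V \<phi> x - lam - quad (Ab x) (p x) / 2"
      using Fop_diff[where Ab = Ab and x = x, OF sym[OF x], of A B V \<phi> u] u[OF x] by (simp add: p_def H_def)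
    \<comment> \<open>By \<open>cutoff'' \<le> k * cutoff'\<close> and the bound of
      \<open>k * A\<close> by \<open>Ab\<close>, the quadratic term absorbs the second-order term of
      the composition.\<close>
    also have "?a * (Fop A Ab B V \<phi> x - lam - quad (Ab x) (p x) / 2) + ?b * quad (A x) (p x) / 2
        \<le> ?a * (Fop A Ab B V \<phi> x - lam)"
    proof -
      have "?b * quad (A x) (p x) \<le> k * ?a * quad (A x) (p x)"
        by (intro mult_right_mono cutoff_bounds k x)
      also have "\<dots> = ?a * (k * quad (A x) (p x))" by simp
      also have "\<dots> \<le> ?a * quad (Ab x) (p x)" by (intro mult_left_mono cutoff_bounds k x)
      finally show ?thesis by (simp add: algebra_simps)
    qed
    also have "\<dots> \<le> 0"
    proof (cases "x \<in> En N")
      case True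
      then show ?thesis using cutoff_eq_0[OF k(1) gm] by simp
    next
      case False
      then show ?thesis using \<phi>[of x] x cutoff_bounds(2)[OF k(1)] by (simp add: mult_nonneg_nonpos)
    qed
    finally show ?thesis .
  qed
  obtain \<epsilon> where \<epsilon>: "0 < \<epsilon>" "ball y \<epsilon> \<subseteq> En N"
    using En(1)[of N] N(3) open_contains_ball by blast
  have yE: "ball y \<epsilon> \<subseteq> E" using \<epsilon> En(3) by blast
  have "m \<le> g x" if x: "x \<in> E" for x
  proof (rule cutoff_nonnegD[OF k(1)])
    have "0 \<le> f x"
    proof (rule recurrent_superharmonic_nonneg[OF En P[OF x] hit[OF x \<epsilon>(1)] yE fC2 Lf])
      show "f z = 0" if "z \<in> ball y \<epsilon>" for z
        using that \<epsilon>(2) cutoff_eq_0(1)[OF k(1) gm] by (auto simp: f_def)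
      show "- 1 \<le> f z" for z using cutoff_bounds(1)[OF k(1)] by (simp add: f_def)
    qed
    then show "0 \<le> cutoff k m (g x)" by (simp add: f_def)
  qed
  then show ?thesis by (intro exI[of _ m]) (auto simp: g_def algebra_simps)
qed

text \<open>A stationary analogue of \<open>upper_comparison\<close>, in which the coercive function
  \<open>\<phi> - \<psi>\<close> supplies the second exponential. Outside \<open>K\<close> both
  \<open>u - \<psi>\<close> and \<open>\<phi> - \<psi>\<close> have rate at most -1, being
  differences with a strict subsolution; on \<open>K\<close> the constant \<open>c\<close> excludes
  negative values.\<close>

lemma subsolution_below_solution:
  fixes E :: "(real ^ 'd) set"
  assumes E: "open E" and K: "compact K" "K \<subseteq> E"
    and symA: "\<And>x. x \<in> E \<Longrightarrow> transpose (A x) = A x"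
    and sym: "\<And>x. x \<in> E \<Longrightarrow> transpose (Ab x) = Ab x"
    and k: "0 < k" "\<And>x \<xi>. x \<in> E \<Longrightarrow> 0 \<le> quad (A x) \<xi>"
      "\<And>x \<xi>. x \<in> E \<Longrightarrow> k * quad (A x) \<xi> \<le> quad (Ab x) \<xi>"
    and C2: "Ck_on 2 E \<phi>" "Ck_on 2 E \<psi>" "Ck_on 2 E u"
    and \<phi>: "\<And>x. x \<in> E - K \<Longrightarrow> Fop A Ab B V \<phi> x \<le> lam"
    and \<psi>: "\<And>x. x \<in> E - K \<Longrightarrow> lam + 1 \<le> Fop A Ab B V \<psi> x"
    and u: "\<And>x. x \<in> E \<Longrightarrow> Fop A Ab B V u x = lam"
    and coercive: "\<And>c. \<exists>S. compact S \<and> S \<subseteq> E \<and> (\<forall>x\<in>E - S. c \<le> \<phi> x - \<psi> x)"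
  shows "\<exists>c. \<forall>x\<in>E. \<psi> x \<le> u x + c"
proof -
  note cont = Ck_on_2_continuous(1)[OF C2(1)] Ck_on_2_continuous(1)[OF C2(2)] Ck_on_2_continuous(1)[OF C2(3)]
  have "continuous_on E (\<lambda>x. \<psi> x - u x)" by (intro continuous_intros cont)
  then obtain c where c: "\<And>x. x \<in> K \<Longrightarrow> \<bar>\<psi> x - u x\<bar> \<le> c"
    using bounded_on_compact[OF _ K] by blast
  define D1 where "D1 x = c - (\<psi> x - u x)" for x
  define D2 where "D2 x = \<phi> x - \<psi> x" for x
  have key: "0 \<le> exp (k * D1 z) + \<epsilon> * exp (k * D2 z) - 1" if \<epsilon>: "0 < \<epsilon>" and z: "z \<in> E" for \<epsilon> z
  proof (rule ccontr)
    define S where "S x = exp (k * D1 x) + \<epsilon> * exp (k * D2 x) - 1" for x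
    assume "\<not> 0 \<le> exp (k * D1 z) + \<epsilon> * exp (k * D2 z) - 1"
    then have zneg: "S z < 0" by (simp add: S_def)
    obtain T where T: "compact T" "T \<subseteq> E" "\<And>x. x \<in> E - T \<Longrightarrow> - ln \<epsilon> / k \<le> \<phi> x - \<psi> x"
      using coercive[of "- ln \<epsilon> / k"] by blast
    have outside: "0 \<le> S x" if "x \<in> E - T" for x
    proof -
      have "- ln \<epsilon> \<le> k * D2 x" using T(3)[OF that] k(1) by (simp add: D2_def field_simps)
      then have "exp (- ln \<epsilon>) \<le> exp (k * D2 x)" by simp
      then have "\<epsilon> * exp (- ln \<epsilon>) \<le> \<epsilon> * exp (k * D2 x)" using \<epsilon> by simp
      moreover have "\<epsilon> * exp (- ln \<epsilon>) = 1" using \<epsilon> by (simp add: exp_minus)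
      ultimately show ?thesis using exp_gt_zero[of "k * D1 x"] unfolding S_def by linarith
    qed
    have zT: "z \<in> T" using outside[of z] z zneg by force
    have "continuous_on E S" unfolding S_def D1_def D2_def by (intro continuous_intros cont)
    then have "continuous_on T S" using T(2) continuous_on_subset by blast
    then obtain x where x: "x \<in> T" "\<And>y. y \<in> T \<Longrightarrow> S x \<le> S y"
      using continuous_attains_inf[OF T(1)] zT by blast
    have xE: "x \<in> E" using x T by blast
    have xneg: "S x < 0" using x(2)[OF zT] zneg by simp
    have min: "S x \<le> S y" if "y \<in> E" for y
      using x(2)[of y] outside[of y] xneg that by (cases "y \<in> T") auto
    have "x \<notin> K"
    proof
      assume "x \<in> K"
      then have "0 \<le> k * D1 x" using c[of x] k(1) by (simp add: D1_def abs_le_iff)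
      then have "1 \<le> exp (k * D1 x)" by simp
      moreover have "0 \<le> \<epsilon> * exp (k * D2 x)" using \<epsilon> by simp
      ultimately show False using xneg unfolding S_def by linarith
    qed
    define p1 H1 where "p1 = 0 - (grad \<psi> x - grad u x)" and "H1 = 0 - (hess \<psi> x - hess u x)"
    define p2 H2 where "p2 = grad \<phi> x - grad \<psi> x" and "H2 = hess \<phi> x - hess \<psi> x"
    note jets = Ck_on_2_has_jet[OF C2(1) E xE] Ck_on_2_has_jet[OF C2(2) E xE] Ck_on_2_has_jet[OF C2(3) E xE]
    have j1: "has_jet D1 x p1 H1"
      unfolding D1_def p1_def H1_def by (intro has_jet_diff has_jet_const jets)
    have j2: "has_jet D2 x p2 H2"
      unfolding D2_def p2_def H2_def by (intro has_jet_diff jets)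
    have jS: "has_jet S x ((k * exp (k * D1 x)) *\<^sub>R p1 + (\<epsilon> * (k * exp (k * D2 x))) *\<^sub>R p2)
       ((k * exp (k * D1 x)) *\<^sub>R (H1 + k *\<^sub>R outer p1 p1)
        + (\<epsilon> * (k * exp (k * D2 x))) *\<^sub>R (H2 + k *\<^sub>R outer p2 p2))"
      unfolding S_def[abs_def]
      using has_jet_diff[OF has_jet_add[OF has_jet_exp[OF j1, of k]
            has_jet_scale[OF has_jet_exp[OF j2, of k], of \<epsilon>]] has_jet_const[of 1]] by simp
    have "\<forall>\<^sub>F y in nhds x. S x \<le> S y"
      using eventually_nhds_in_open[OF E xE] by eventually_elim (rule min)
    note J = jet_at_min[OF jS this]
    note h0 = mdot_nonneg[OF symA[OF xE] k(2)[OF xE] J(2)]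
    let ?b = "drift Ab B u x" and ?q = "grad \<psi> x - grad u x"
    have f\<psi>: "lop (A x) ?b ?q (hess \<psi> x - hess u x) + quad (Ab x) ?q / 2 = Fop A Ab B V \<psi> x - lam"
      using Fop_diff[where Ab = Ab and x = x, OF sym[OF xE], of A B V \<psi> u] u[OF xE] by simp
    have f\<phi>: "lop (A x) ?b (grad \<phi> x - grad u x) (hess \<phi> x - hess u x) + quad (Ab x) (grad \<phi> x - grad u x) / 2
        = Fop A Ab B V \<phi> x - lam"
      using Fop_diff[where Ab = Ab and x = x, OF sym[OF xE], of A B V \<phi> u] u[OF xE] by simp
    have c1: "lop (A x) ?b p1 H1 + quad (Ab x) p1 / 2 + ?q \<bullet> (Ab x *v p1) \<le> - 1"
    proof -
      have "lop (A x) ?b 0 0 = 0" "quad (Ab x) 0 = 0" by (simp_all add: lop_def quad_def)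
      then show ?thesis
        using quad_diff_shift[OF sym[OF xE], of 0 ?q] f\<psi> \<psi>[of x] xE \<open>x \<notin> K\<close>
        unfolding p1_def H1_def lop_diff[of _ _ 0] by simp
    qed
    have c2: "lop (A x) ?b p2 H2 + quad (Ab x) p2 / 2 + ?q \<bullet> (Ab x *v p2) \<le> - 1"
    proof -
      have "p2 = (grad \<phi> x - grad u x) - ?q" "H2 = (hess \<phi> x - hess u x) - (hess \<psi> x - hess u x)"
        by (simp_all add: p2_def H2_def)
      then show ?thesis
        using quad_diff_shift[OF sym[OF xE], of "grad \<phi> x - grad u x" ?q] f\<psi> f\<phi> \<psi>[of x] \<phi>[of x]
          xE \<open>x \<notin> K\<close> lop_diff[of "A x" ?b "grad \<phi> x - grad u x" ?q "hess \<phi> x - hess u x" "hess \<psi> x - hess u x"]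
        by simp
    qed
    have "0 \<le> k * exp (k * D1 x) * (- 1) + \<epsilon> * (k * exp (k * D2 x)) * (- 1)"
      by (rule two_exponentials_at_min[OF _ _ J(1) h0 k(3)[OF xE] c1 c2]) (use k \<epsilon> in auto)
    moreover have "0 < k * exp (k * D1 x)" "0 < \<epsilon> * (k * exp (k * D2 x))" using k \<epsilon> by auto
    ultimately show False by linarith
  qed
  have "\<psi> x \<le> u x + c" if x: "x \<in> E" for x
  proof -
    have "1 \<le> exp (k * D1 x)"
    proof (rule field_le_epsilon)
      fix e :: real assume "0 < e"
      then show "1 \<le> exp (k * D1 x) + e"
        using key[of "e / exp (k * D2 x)" x] x by simp
    qed
    then have "0 \<le> D1 x" using k(1) by (simp add: zero_le_mult_iff)
    then show ?thesis by (simp add: D1_def)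
  qed
  then show ?thesis by blast
qed

theorem theorem2p11:
  fixes E :: "(real ^ 'd) set" and En :: "nat \<Rightarrow> (real ^ 'd) set" and x0 :: "real ^ 'd"
    and A Abar :: "real ^ 'd \<Rightarrow> real ^ 'd ^ 'd" and B :: "real ^ 'd \<Rightarrow> real ^ 'd"
    and V \<phi>0 \<psi>0 :: "real ^ 'd \<Rightarrow> real"
    and \<gamma> \<kappa>l \<kappa>u \<delta> \<alpha> K :: real
    and lamhat :: real and vhat mhat :: "real ^ 'd \<Rightarrow> real"
    and v0 :: "real ^ 'd \<Rightarrow> real" and v h :: "real \<Rightarrow> real ^ 'd \<Rightarrow> real"
  assumes E: "open E" "connected E" "star_shaped_at x0 E"
    and En: "\<And>n. open (En n)" "\<And>n. bounded (En n)" "\<And>n. connected (En n)"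
      "\<And>n. star_shaped_at x0 (En n)"
      "\<And>n. \<exists>\<gamma>'. 0 < \<gamma>' \<and> \<gamma>' \<le> 1 \<and> Ck_holder_boundary 2 \<gamma>' (En n)"
      "\<And>n. closure (En n) \<subseteq> En (Suc n)" "E = (\<Union>n. En n)"
    and gamma: "0 < \<gamma>" "\<gamma> \<le> 1"
    and sym: "\<And>x. x \<in> E \<Longrightarrow> transpose (A x) = A x" "\<And>x. x \<in> E \<Longrightarrow> transpose (Abar x) = Abar x"
    and A: "\<And>i j. Ck_holder_on 2 \<gamma> E (\<lambda>x. A x $ i $ j)"
    and Abar: "\<And>i j. Ck_holder_on 2 \<gamma> E (\<lambda>x. Abar x $ i $ j)"
    and B: "\<And>i. Ck_holder_on 1 \<gamma> E (\<lambda>x. B x $ i)"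
    and V: "Ck_holder_on 1 \<gamma> E V"
    and hyp1_elliptic: "\<And>n. \<exists>c>0. \<forall>x\<in>En n. \<forall>\<xi>. c * (norm \<xi>)\<^sup>2 \<le> \<xi> \<bullet> (A x *v \<xi>)"
    and hyp1_kappa: "0 < \<kappa>l" "\<kappa>l \<le> \<kappa>u"
      "\<And>x. x \<in> E \<Longrightarrow> psd_le (\<kappa>l *\<^sub>R A x) (Abar x) \<and> psd_le (Abar x) (\<kappa>u *\<^sub>R A x)"
    and hyp2: "Ck_on 3 E \<phi>0" "\<And>x. x \<in> E \<Longrightarrow> 0 \<le> \<phi>0 x"
      "(\<lambda>n. SUP x\<in>E - En n. ereal (Fop A Abar B V \<phi>0 x)) \<longlonglongrightarrow> -\<infinity>"
    and hyp3: "well_posed E En A (drift Abar B \<phi>0)"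
    and hyp4: "(\<lambda>n. INF x\<in>E - En n. ereal (\<phi>0 x)) \<longlonglongrightarrow> \<infinity>"
      "1 < \<delta>" "(\<lambda>n. SUP x\<in>E - En n. ereal (Fop A Abar B V (\<lambda>y. \<delta> * \<phi>0 y) x)) \<longlonglongrightarrow> -\<infinity>"
    and hyp5: "Ck_on 3 E \<psi>0" "0 < \<alpha>" "0 < K"
      "(\<lambda>n. INF x\<in>E - En n. ereal (Fop A Abar B V \<psi>0 x)) \<longlonglongrightarrow> \<infinity>"
      "(\<lambda>n. INF x\<in>E - En n. ereal (\<phi>0 x - \<psi>0 x)) \<longlonglongrightarrow> \<infinity>"
      "(INF x\<in>E. ereal (\<psi>0 x + K * \<phi>0 x)) > -\<infinity>"
      "(SUP x\<in>E. ereal (Fop A Abar B V (\<lambda>y. \<delta> * \<phi>0 y) x + \<alpha> * (\<delta> * \<phi>0 x - \<psi>0 x))) < \<infinity>"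
    and ergodic_pair: "Ck_on 2 E vhat" "\<And>x. x \<in> E \<Longrightarrow> Fop A Abar B V vhat x = lamhat"
      "ergodic_with_density E En A (drift Abar B vhat) mhat"
    and v0: "continuous_on E v0" "(SUP x\<in>E. ereal (\<bar>v0 x\<bar> - \<phi>0 x)) < \<infinity>"
    and v: "classical_solution E (Fop A Abar B V) v0 v"
      "\<And>T. 0 \<le> T \<Longrightarrow> (SUP (t, x)\<in>{0..T} \<times> E. ereal (v t x - \<phi>0 x)) < \<infinity>"
    and h: "h = (\<lambda>t x. v t x - lamhat * t - vhat x)"
  shows "(\<exists>C. tends_locally_uniformly E h (\<lambda>_. C)) \<and>
         tends_locally_uniformly E (\<lambda>t. grad (h t)) (\<lambda>_. 0)"
proof -
  have En_mono: "En n \<subseteq> En (Suc n)" for n using En(6)[of n] closure_subset by blast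
  have cl: "compact (closure (En n))" "closure (En n) \<subseteq> E" for n
  proof -
    show "compact (closure (En n))" using En(2) by (simp add: compact_closure)
    show "closure (En n) \<subseteq> E" using En(6)[of n] En(7) by blast
  qed
  have x0En: "x0 \<in> En n" for n using En(4) by (simp add: star_shaped_at_def)
  have x0E: "x0 \<in> E" using E(3) by (simp add: star_shaped_at_def)
  have exhaust: "\<exists>n. S \<subseteq> En n" if "compact S" "S \<subseteq> E" for S
    using compact_in_exhaustion[where En = En, OF En(1) En_mono that(1)] that(2) En(7) by simp
  have quad_def': "\<xi> \<bullet> (M *v \<xi>) = quad M \<xi>" for M :: "real^'d^'d" and \<xi> by (simp add: quad_def)
  have elliptic: "\<exists>c>0. \<forall>x\<in>S. \<forall>\<xi>. c * (norm \<xi>)\<^sup>2 \<le> quad (A x) \<xi>" if S: "compact S" "S \<subseteq> E" for S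
  proof -
    obtain n where "S \<subseteq> En n" using exhaust[OF S] by blast
    then show ?thesis using hyp1_elliptic[of n] unfolding quad_def' by blast
  qed
  have A0: "0 \<le> quad (A x) \<xi>" if x: "x \<in> E" for x \<xi>
  proof -
    obtain c where "0 < c" "c * (norm \<xi>)\<^sup>2 \<le> quad (A x) \<xi>" using elliptic[of "{x}"] x by auto
    moreover have "0 \<le> c * (norm \<xi>)\<^sup>2" using \<open>0 < c\<close> by simp
    ultimately show ?thesis by linarith
  qed
  have kl: "\<kappa>l * quad (A x) \<xi> \<le> quad (Abar x) \<xi>" and ku: "quad (Abar x) \<xi> \<le> \<kappa>u * quad (A x) \<xi>"
    if "x \<in> E" for x \<xi>
    using hyp1_kappa(3)[OF that] unfolding psd_le_def quad_def
    by (simp_all add: matrix_vector_mult_diff_rdistrib scaleR_matrix_vector_assoc[symmetric]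
        inner_diff_right)
  have C2: "Ck_on 2 E \<phi>0" "Ck_on 2 E \<psi>0"
    using Ck_on_mono[of 2 E \<phi>0] Ck_on_mono[of 2 E \<psi>0] hyp2(1) hyp5(1)
    by (simp_all add: numeral_3_eq_3 numeral_2_eq_2)
  let ?F = "Fop A Abar B V"
  have coercive: "\<exists>S. compact S \<and> S \<subseteq> E \<and> (\<forall>x\<in>E - S. c \<le> f x)"
    if lim: "(\<lambda>n. INF x\<in>E - En n. ereal (f x)) \<longlonglongrightarrow> \<infinity>" for f c
  proof -
    obtain n where n: "\<forall>x\<in>E - En n. c \<le> f x" using INF_tendsto_infinityD[OF lim] by blast
    have "E - closure (En n) \<subseteq> E - En n" using closure_subset by blast
    then show ?thesis using n cl by (intro exI[of _ "closure (En n)"]) blast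
  qed
  obtain P where P: "gmp_unique_solution E En A (drift Abar B vhat) P" "positive_recurrent E P"
    using ergodic_pair(3) unfolding ergodic_with_density_def by blast
  obtain n1 where n1: "\<And>n x. n1 \<le> n \<Longrightarrow> x \<in> E - En n \<Longrightarrow> ?F \<phi>0 x \<le> lamhat"
    using SUP_tendsto_minus_infinityD[OF hyp2(3)] by blast
  obtain n2 where n2: "\<And>n x. n2 \<le> n \<Longrightarrow> x \<in> E - En n \<Longrightarrow> lamhat + 1 \<le> ?F \<psi>0 x"
    using INF_tendsto_infinityD[OF hyp5(4)] by blast
  have "\<exists>m. \<forall>x\<in>E. vhat x + m \<le> \<phi>0 x"
  proof (rule ergodic_solution_below_supersolution[OF En(1) En_mono En(7) cl x0En sym(2) hyp1_kappa(1) A0 kl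
        C2(1) ergodic_pair(1) _ ergodic_pair(2)])
    show "?F \<phi>0 x \<le> lamhat" if "x \<in> E - En n1" for x using n1[OF order_refl that] .
    show "solves_gmp_at E En A (drift Abar B vhat) x (P x)" if "x \<in> E" for x
      using P(1) that by (simp add: gmp_unique_solution_def)
    show "AE \<omega> in P x. hitting_time (Some ` ball x0 \<epsilon>) \<omega> < \<infinity>" if "x \<in> E" "0 < \<epsilon>" for x \<epsilon>
      using P(2) that x0E unfolding positive_recurrent_def recurrent_diffusion_def by blast
  qed
  then obtain m where m: "\<And>x. x \<in> E \<Longrightarrow> vhat x + m \<le> \<phi>0 x" by blast
  have "\<exists>c. \<forall>x\<in>E. \<psi>0 x \<le> vhat x + c"
  proof (rule subsolution_below_solution[OF E(1) cl sym hyp1_kappa(1) A0 kl C2 ergodic_pair(1) _ _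
        ergodic_pair(2) coercive[OF hyp5(5)]])
    fix x assume "x \<in> E - closure (En (max n1 n2))"
    then have x: "x \<in> E - En (max n1 n2)" using closure_subset by blast
    show "?F \<phi>0 x \<le> lamhat" by (rule n1[OF _ x]) simp
    show "lamhat + 1 \<le> ?F \<psi>0 x" by (rule n2[OF _ x]) simp
  qed
  then obtain c2 where c2: "\<And>x. x \<in> E \<Longrightarrow> \<psi>0 x \<le> vhat x + c2" by blast
  obtain c5 where c5: "\<And>x. x \<in> E \<Longrightarrow> ?F (\<lambda>y. \<delta> * \<phi>0 y) x + \<alpha> * (\<delta> * \<phi>0 x - \<psi>0 x) \<le> c5"
    using SUP_less_infinityD[OF hyp5(7)] by blast
  obtain c0 where c0: "\<And>x. x \<in> E \<Longrightarrow> \<bar>v0 x\<bar> - \<phi>0 x \<le> c0"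
    using SUP_less_infinityD[OF v0(2)] by blast
  have vbound: "\<exists>c. \<forall>t\<in>{0..T}. \<forall>x\<in>E. v t x - \<phi>0 x \<le> c" if "0 \<le> T" for T
    using SUP_less_infinityD[of "\<lambda>(t, x). v t x - \<phi>0 x" "{0..T} \<times> E"] v(2)[OF that]
    by (fastforce simp: case_prod_unfold)
  \<comment> \<open>The shift by \<open>m\<close> makes \<open>w\<close> at least (\<delta> - 1) *
    \<open>\<phi>0\<close>, hence nonnegative and coercive.\<close>
  define w where "w x = \<delta> * \<phi>0 x - vhat x - m" for x
  \<comment> \<open>From \<open>c5\<close>, once \<open>\<psi>0\<close> is bounded by
    \<open>vhat + c2\<close> so that \<delta> * \<open>\<phi>0\<close> - \<open>\<psi>0\<close> is
    at least \<open>w + m - c2\<close>.\<close>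
  define C where "C = max 0 (c5 - lamhat + \<alpha> * (c2 - m))"
  have C12: "C12_on E v" and vc: "continuous_on ({0..} \<times> E) (\<lambda>(t, x). v t x)"
    and veq: "\<And>t x. 0 < t \<Longrightarrow> x \<in> E \<Longrightarrow> deriv (\<lambda>s. v s x) t = ?F (v t) x"
    and vinit: "\<And>x. x \<in> E \<Longrightarrow> v 0 x = v0 x"
    using v(1) unfolding classical_solution_def by auto
  have vC2: "Ck_on 2 E (v t)" if "0 < t" for t using C12 that by (simp add: C12_on_def)
  have jvhat: "has_jet vhat x (grad vhat x) (hess vhat x)" if "x \<in> E" for x
    by (rule Ck_on_2_has_jet[OF ergodic_pair(1) E(1) that])
  have jh: "has_jet (h t) x (grad (v t) x - grad vhat x) (hess (v t) x - hess vhat x)"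
    if "0 < t" "x \<in> E" for t x
    using has_jet_diff[OF has_jet_diff[OF Ck_on_2_has_jet[OF vC2[OF that(1)] E(1) that(2)]
          has_jet_const[of "lamhat * t"]] jvhat[OF that(2)]] by (simp add: h)
  have j\<phi>: "has_jet (\<lambda>y. \<delta> * \<phi>0 y) x (\<delta> *\<^sub>R grad \<phi>0 x) (\<delta> *\<^sub>R hess \<phi>0 x)" if "x \<in> E" for x
    by (rule has_jet_scale[OF Ck_on_2_has_jet[OF C2(1) E(1) that]])
  have jw: "has_jet w x (\<delta> *\<^sub>R grad \<phi>0 x - grad vhat x) (\<delta> *\<^sub>R hess \<phi>0 x - hess vhat x)" if "x \<in> E" for x
    using has_jet_diff[OF has_jet_diff[OF j\<phi>[OF that] jvhat[OF that]] has_jet_const[of m]]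
    by (simp add: w_def[abs_def])
  have w_ge: "(\<delta> - 1) * \<phi>0 x \<le> w x" if "x \<in> E" for x
    using m[OF that] by (simp add: w_def algebra_simps)
  have A_cont: "continuous_on E (\<lambda>x. A x $ i $ j)" and Abar_cont: "continuous_on E (\<lambda>x. Abar x $ i $ j)" for i j
    using Ck_holder_on_2_C1(1)[OF A] Ck_holder_on_2_C1(1)[OF Abar] differentiable_imp_continuous_on by blast+
  have drift_cont: "continuous_on E (drift Abar B vhat)"
  proof -
    have "continuous_on E (\<lambda>x. B x $ i)" for i
      using B[of i] by (auto intro: differentiable_imp_continuous_on)
    moreover have "continuous_on E (partial j vhat)" for j
      using ergodic_pair(1) by (auto simp: numeral_2_eq_2 intro: differentiable_imp_continuous_on)
    ultimately show ?thesis
      unfolding drift_def[abs_def] by (intro continuous_on_vec_lambda continuous_on_add continuous_on_sum continuous_on_mult Abar_cont)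
  qed
  interpret quadratic_flow E x0 A Abar "drift Abar B vhat" \<kappa>l \<kappa>u \<alpha> C w h
  proof
    show "open E" "star_shaped_at x0 E" by (rule E)+
    show "transpose (A x) = A x" "transpose (Abar x) = Abar x" if "x \<in> E" for x by (rule sym[OF that])+
    fix S assume S: "compact S" "S \<subseteq> E"
    show "\<exists>c>0. \<forall>x\<in>S. \<forall>\<xi>. c * (norm \<xi>)\<^sup>2 \<le> quad (A x) \<xi>" by (rule elliptic[OF S])
    show "form_bounded_on S A" by (rule matrix_bounded_on_compact[OF A_cont S])
    show "form_bounded_on S Abar" by (rule matrix_bounded_on_compact[OF Abar_cont S])
    show "form_lipschitz_on S A" by (rule matrix_lipschitz_on_compact[OF A E(1) S])
    show "form_lipschitz_on S Abar" by (rule matrix_lipschitz_on_compact[OF Abar E(1) S])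
    show "\<exists>l\<ge>0. \<forall>x\<in>S. norm (drift Abar B vhat x) \<le> l"
      using bounded_on_compact[OF continuous_on_norm[OF drift_cont] S] by auto
  next
    show "0 < \<kappa>l" "\<kappa>l \<le> \<kappa>u" by (rule hyp1_kappa)+
    show "\<kappa>l * quad (A x) \<xi> \<le> quad (Abar x) \<xi>" "quad (Abar x) \<xi> \<le> \<kappa>u * quad (A x) \<xi>" if "x \<in> E" for x \<xi>
      by (rule kl[OF that], rule ku[OF that])
    have "continuous_on ({0..} \<times> E) (\<lambda>p. v (fst p) (snd p) - lamhat * fst p - vhat (snd p))"
    proof (intro continuous_intros)
      show "continuous_on ({0..} \<times> E) (\<lambda>p. v (fst p) (snd p))" using vc by (simp add: case_prod_unfold)
      show "continuous_on ({0..} \<times> E) (\<lambda>p. vhat (snd p))"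
        by (rule continuous_on_compose2[OF Ck_on_2_continuous(1)[OF ergodic_pair(1)] continuous_on_snd[OF continuous_on_id]])
          auto
    qed
    then show "continuous_on ({0..} \<times> E) (\<lambda>(t, x). h t x)" by (simp add: h case_prod_unfold)
    show "has_jet (h t) x (grad (h t) x) (hess (h t) x)" if "0 < t" "x \<in> E" for t x
      using jh[OF that] has_jetD[OF jh[OF that]] by simp
    show "((\<lambda>s. h s x) has_real_derivative lop (A x) (drift Abar B vhat x) (grad (h t) x) (hess (h t) x)
        + quad (Abar x) (grad (h t) x) / 2) (at t)" if tx: "0 < t" "x \<in> E" for t x
    proof -
      have "(\<lambda>s. v s x) differentiable (at t)" using C12 tx by (simp add: C12_on_def)
      then have "((\<lambda>s. v s x) has_real_derivative ?F (v t) x) (at t)"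
        using veq[OF tx] by (simp add: DERIV_deriv_iff_real_differentiable[symmetric])
      then have "((\<lambda>s. h s x) has_real_derivative ?F (v t) x - lamhat) (at t)"
        unfolding h by (auto intro!: derivative_eq_intros)
      moreover have "?F (v t) x - lamhat = lop (A x) (drift Abar B vhat x) (grad (h t) x) (hess (h t) x)
          + quad (Abar x) (grad (h t) x) / 2"
        using Fop_diff[where Ab = Abar and x = x, OF sym(2)[OF tx(2)], of A B V "v t" vhat] ergodic_pair(2)[OF tx(2)]
          has_jetD[OF jh[OF tx]] by simp
      ultimately show ?thesis by simp
    qed
    show "0 < \<alpha>" by (rule hyp5)
    show "0 \<le> C" by (simp add: C_def)
    show "0 \<le> w x" if "x \<in> E" for x
    proof -
      have "0 \<le> (\<delta> - 1) * \<phi>0 x" using hyp2(2)[OF that] hyp4(2) by simp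
      then show ?thesis using w_ge[OF that] by linarith
    qed
    show "has_jet w x (grad w x) (hess w x)" if "x \<in> E" for x
      using jw[OF that] has_jetD[OF jw[OF that]] by simp
    show "lop (A x) (drift Abar B vhat x) (grad w x) (hess w x) + quad (Abar x) (grad w x) / 2 \<le> C - \<alpha> * w x"
      if x: "x \<in> E" for x
    proof -
      have "lop (A x) (drift Abar B vhat x) (grad w x) (hess w x) + quad (Abar x) (grad w x) / 2
          = ?F (\<lambda>y. \<delta> * \<phi>0 y) x - lamhat"
        using Fop_diff[where Ab = Abar and x = x, OF sym(2)[OF x], of A B V "\<lambda>y. \<delta> * \<phi>0 y" vhat] ergodic_pair(2)[OF x]
        unfolding has_jetD[OF jw[OF x]] has_jetD[OF j\<phi>[OF x]] by simp
      also have "\<dots> \<le> c5 - lamhat - \<alpha> * (\<delta> * \<phi>0 x - \<psi>0 x)" using c5[OF x] by simp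
      also have "\<dots> \<le> c5 - lamhat - \<alpha> * (w x + m - c2)"
        using c2[OF x] hyp5(2) by (intro diff_left_mono mult_left_mono) (auto simp: w_def)
      also have "\<dots> = (c5 - lamhat + \<alpha> * (c2 - m)) - \<alpha> * w x" by (simp add: algebra_simps)
      also have "\<dots> \<le> C - \<alpha> * w x" by (simp add: C_def)
      finally show ?thesis .
    qed
    have \<phi>scale: "c \<le> (\<delta> - 1) * \<phi>0 x" if "c / (\<delta> - 1) \<le> \<phi>0 x" for c x
      using that hyp4(2) by (simp add: field_simps)
    show "\<exists>S. compact S \<and> S \<subseteq> E \<and> (\<forall>x\<in>E - S. c \<le> w x)" for c
    proof -
      obtain S where S: "compact S" "S \<subseteq> E" "\<forall>x\<in>E - S. c / (\<delta> - 1) \<le> \<phi>0 x"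
        using coercive[OF hyp4(1)] by blast
      then have "c \<le> w x" if "x \<in> E - S" for x
        using \<phi>scale[of c x] w_ge[of x] that by fastforce
      then show ?thesis using S by blast
    qed
    \<comment> \<open>In \<open>w - h\<close> the function \<open>vhat\<close> cancels. What remains
      is (\<delta> - 1) * \<open>\<phi>0\<close> minus \<open>v - \<phi>0\<close>, which is bounded
      above on the time interval, plus terms bounded on it.\<close>
    show "\<exists>S. compact S \<and> S \<subseteq> E \<and> (\<forall>t\<in>{0..T}. \<forall>x\<in>E - S. c \<le> w x - h t x)" for T c
    proof (cases "0 \<le> T")
      case True
      obtain cT where cT: "\<And>t x. t \<in> {0..T} \<Longrightarrow> x \<in> E \<Longrightarrow> v t x - \<phi>0 x \<le> cT"
        using vbound[OF True] by blast
      define c' where "c' = c + cT + m + \<bar>lamhat\<bar> * T"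
      obtain S where S: "compact S" "S \<subseteq> E" "\<forall>x\<in>E - S. c' / (\<delta> - 1) \<le> \<phi>0 x"
        using coercive[OF hyp4(1)] by blast
      have "c \<le> w x - h t x" if t: "t \<in> {0..T}" and x: "x \<in> E - S" for t x
      proof -
        have "c' \<le> (\<delta> - 1) * \<phi>0 x" using S(3) x \<phi>scale by blast
        moreover have "- lamhat * t \<le> \<bar>lamhat\<bar> * T"
        proof -
          have "- lamhat * t \<le> \<bar>lamhat\<bar> * t" using t by (intro mult_right_mono) auto
          also have "\<dots> \<le> \<bar>lamhat\<bar> * T" using t by (intro mult_left_mono) auto
          finally show ?thesis .
        qed
        moreover have "v t x - \<phi>0 x \<le> cT" using cT[OF t] x by blast
        ultimately show ?thesis by (simp add: w_def h c'_def algebra_simps)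
      qed
      then show ?thesis using S by blast
    qed auto
    show "\<exists>c. \<forall>x\<in>E. h 0 x \<le> c + w x"
    proof (intro exI ballI)
      fix x assume x: "x \<in> E"
      have "0 \<le> (\<delta> - 1) * \<phi>0 x" using hyp2(2)[OF x] hyp4(2) by simp
      then show "h 0 x \<le> (c0 + m) + w x"
        using c0[OF x] by (simp add: h vinit[OF x] w_def algebra_simps)
    qed
    show "\<exists>c s. 0 \<le> s \<and> (\<forall>x\<in>E. c - s * w x \<le> h 0 x)"
    proof (intro exI conjI ballI)
      \<comment> \<open>One \<open>\<phi>0\<close> bounds \<open>v0\<close> from below and another
        bounds \<open>vhat\<close> from above; each is at most w / (\<delta> - 1). A slope above 1
        is allowed on this side.\<close>
      show "0 \<le> 2 / (\<delta> - 1)" using hyp4(2) by simp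
      fix x assume x: "x \<in> E"
      have "2 / (\<delta> - 1) * ((\<delta> - 1) * \<phi>0 x) \<le> 2 / (\<delta> - 1) * w x"
        using w_ge[OF x] hyp4(2) by (intro mult_left_mono) auto
      then have "2 * \<phi>0 x \<le> 2 / (\<delta> - 1) * w x" using hyp4(2) by simp
      moreover have "- \<phi>0 x - c0 \<le> v0 x" using c0[OF x] by (simp add: abs_le_iff)
      ultimately show "(m - c0) - 2 / (\<delta> - 1) * w x \<le> h 0 x"
        using m[OF x] by (simp add: h vinit[OF x])
    qed
  qed
  show ?thesis using converges_to_constant gradient_converges_to_zero by blast
qed

end
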